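(* Let $R=K[x_1,\dots,x_n]$ be a polynomial ring over a field $K$ and let $I=\mathrm{Sss}(\{\lambda\})\subset R$, $\lambda\in P_n$, be a principal Borel symmetric strongly shifted ideal. Then the toric ideal of $G(I)$, which is also the defining ideal of the special fiber ring $\mathcal F(I)$, is generated by quadrics, namely the symmetric exchange relations $$T_rT_s-T_tT_w\qquad(1)$$ where $r,s,t,w\in G(I)$ satisfy, for some indices $i,j$, $\deg_i(r)>\deg_i(s)$, $\deg_j(r)<\deg_j(s)$, $t=rx_j/x_i\in G(I)$ and $w=sx_i/x_j\in G(I)$. Moreover, the defining ideal of the Rees ring $\mathcal R(I)$ is also generated by quadrics, specifically by the exchange relations (1) together with the relations $$x_iT_u-x_{u_{\max}}T_v,$$ where $u,v\in G(I)$, $v\prec u$, $x_i\in C(u)$ and $x_iu=x_{u_{\max}}v$.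
   Context: $\mathfrak S_n$ acts on $R$ by $\sigma(x_k)=x_{\sigma(k)}$. $P_n=\{\lambda\in\mathbb Z^n: 0\le\lambda_1\le\cdots\le\lambda_n\}$, $|\lambda|=\sum\lambda_i$, $x^\lambda=x_1^{\lambda_1}\cdots x_n^{\lambda_n}$. For an $\mathfrak S_n$-fixed monomial ideal $I$ put $P(I)=\{\lambda\in P_n: x^\lambda\in I\}$. An $\mathfrak S_n$-fixed monomial ideal $I$ is symmetric strongly shifted if for every $\lambda\in P(I)$ and $1\le i<j\le n$ with $\lambda_i<\lambda_j$ one has $x^\lambda x_i/x_j\in I$. $\mathrm{Sss}(\{\lambda\})$ is the smallest symmetric strongly shifted ideal containing $x^\lambda$. All ideals considered are proper. $G(I)$ is the set of minimal monomial generators; $\deg_i(m)$ is the exponent of $x_i$ in the monomial $m$. The toric ideal of $G(I)$ is the kernel of $K[T_m:m\in G(I)]\to R$, $T_m\mapsto m$. The Rees ring is $\mathcal R(I)=\bigoplus_{i\ge0}I^it^i\subseteq R[t]$, with defining ideal the kernel of $R[T_m:m\in G(I)]\to\mathcal R(I)$, $T_m\mapsto mt$; the special fiber ring is $\mathcal F(I)=\mathcal R(I)/(x_1,\dots,x_n)\mathcal R(I)$, with defining ideal the kernel of the induced map $K[T_m:m\in G(I)]\to\mathcal F(I)$. Order $\prec$ on monomials: for distinct monomials $v=\tau(x^\mu)$ and $u=\sigma(x^\lambda)$ with $\lambda,\mu\in P_n$, $\sigma,\tau\in\mathfrak S_n$, set $v\prec u$ if either $\mu\neq\lambda$ and ($|\mu|<|\lambda|$,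 or $|\mu|=|\lambda|$ and the leftmost nonzero entry of $\mu-\lambda$ is positive), or $\mu=\lambda$ and the leftmost nonzero entry of (exponent vector of $v$) minus (exponent vector of $u$) is positive. For $u=\sigma(x^\lambda)=\prod_kx_{\sigma(k)}^{\lambda_k}\in G(I)$ put $p=\#\{k:\lambda_k<\lambda_n-1\}$, $r=\#\{k:\lambda_k=\lambda_n\}$, $u_{\max}=\max\{\sigma(k):\lambda_k=\lambda_n\}$, and $$C(u)=(x_{\sigma(1)},\dots,x_{\sigma(p)})+(x_{\sigma(k)}:\ p+1\le k\le n-r,\ \sigma(k)<u_{\max}).$$ *)

theory Defs
  imports
    "HOL-Library.Poly_Mapping"
    "HOL-Computational_Algebra.Polynomial"
    "HOL-Combinatorics.Permutations"
    "HOL-Algebra.QuotRing"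
    "HOL-Algebra.Ideal_Product"
begin

section \<open>Polynomial rings\<close>

text \<open>
  A monomial is identified with its exponent vector. Polynomials over the coefficients
  \<^typ>\<open>'a\<close> in variables indexed by \<^typ>\<open>'v\<close> form the commutative ring type of finitely supported
  functions on monomials; the polynomial rings themselves are carrier-based rings cut out of it.
\<close>

type_synonym 'v monomial = "'v \<Rightarrow>\<^sub>0 nat"
type_synonym ('v, 'a) mpoly = "'v monomial \<Rightarrow>\<^sub>0 'a"

definition mp_const :: "'a::zero \<Rightarrow> ('v, 'a) mpoly" where
  "mp_const c = Poly_Mapping.single 0 c"

definition mp_monom :: "'v monomial \<Rightarrow> ('v, 'a::zero_neq_one) mpoly" where
  "mp_monom m = Poly_Mapping.single m 1"

definition mp_var :: "'v \<Rightarrow> ('v, 'a::zero_neq_one) mpoly" where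
  "mp_var v = mp_monom (Poly_Mapping.single v 1)"

text \<open>The homomorphism acting as \<open>h\<close> on coefficients and sending the variable \<open>v\<close> to \<open>f v\<close>.\<close>

definition mp_eval ::
  "('a::zero \<Rightarrow> 'b::comm_semiring_1) \<Rightarrow> ('v \<Rightarrow> 'b) \<Rightarrow> ('v, 'a) mpoly \<Rightarrow> 'b" where
  "mp_eval h f q = (\<Sum>m\<in>Poly_Mapping.keys q.
     h (Poly_Mapping.lookup q m) *
     (\<Prod>v\<in>Poly_Mapping.keys m. f v ^ Poly_Mapping.lookup m v))"

definition ring_on :: "'a::comm_ring_1 set \<Rightarrow> 'a ring" where
  "ring_on A = \<lparr>carrier = A, mult = (*), one = 1, zero = 0, add = (+)\<rparr>"

text \<open>\<open>mpoly_ring A V\<close> is $A[x_v : v \in V]$.\<close>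

definition mpoly_ring :: "'a::comm_ring_1 set \<Rightarrow> 'v set \<Rightarrow> ('v, 'a) mpoly ring" where
  "mpoly_ring A V = ring_on {q. \<forall>m\<in>Poly_Mapping.keys q.
     Poly_Mapping.lookup q m \<in> A \<and> Poly_Mapping.keys m \<subseteq> V}"

text \<open>$R = K[x_1,\dots,x_n]$, where $K$ is all of \<^typ>\<open>'k\<close>.\<close>

definition poly_ring :: "nat \<Rightarrow> (nat, 'k::field) mpoly ring" where
  "poly_ring n = mpoly_ring UNIV {1..n}"


section \<open>Symmetric strongly shifted ideals\<close>

definition partitions :: "nat \<Rightarrow> nat monomial set" where
  "partitions n = {lam. Poly_Mapping.keys lam \<subseteq> {1..n} \<and> mono_on {1..n} (Poly_Mapping.lookup lam)}"

definition weight :: "nat \<Rightarrow> nat monomial \<Rightarrow> nat" where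
  "weight n lam = (\<Sum>i=1..n. Poly_Mapping.lookup lam i)"

definition perm_act :: "(nat \<Rightarrow> nat) \<Rightarrow> (nat, 'k::field) mpoly \<Rightarrow> (nat, 'k) mpoly" where
  "perm_act sg = mp_eval mp_const (\<lambda>k. mp_var (sg k))"

definition monomial_ideal :: "nat \<Rightarrow> (nat, 'k::field) mpoly set \<Rightarrow> bool" where
  "monomial_ideal n I \<longleftrightarrow>
     (\<exists>M. (\<forall>m\<in>M. Poly_Mapping.keys m \<subseteq> {1..n}) \<and> I = genideal (poly_ring n) (mp_monom ` M))"

definition symmetric_monomial_ideal :: "nat \<Rightarrow> (nat, 'k::field) mpoly set \<Rightarrow> bool" where
  "symmetric_monomial_ideal n I \<longleftrightarrow>
     monomial_ideal n I \<and> (\<forall>sg. sg permutes {1..n} \<longrightarrow> perm_act sg ` I = I)"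

definition P_of :: "nat \<Rightarrow> (nat, 'k::field) mpoly set \<Rightarrow> nat monomial set" where
  "P_of n I = {lam \<in> partitions n. mp_monom lam \<in> I}"

text \<open>The monomial $m x_i / x_j$; only meaningful (and only used) when $x_j$ divides $m$.\<close>

definition swap_var :: "'v monomial \<Rightarrow> 'v \<Rightarrow> 'v \<Rightarrow> 'v monomial" where
  "swap_var m i j = m + Poly_Mapping.single i 1 - Poly_Mapping.single j 1"

definition symmetric_strongly_shifted :: "nat \<Rightarrow> (nat, 'k::field) mpoly set \<Rightarrow> bool" where
  "symmetric_strongly_shifted n I \<longleftrightarrow>
     symmetric_monomial_ideal n I \<and>
     (\<forall>lam\<in>P_of n I. \<forall>i\<in>{1..n}. \<forall>j\<in>{1..n}.
        i < j \<and> Poly_Mapping.lookup lam i < Poly_Mapping.lookup lam j \<longrightarrow>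
        mp_monom (swap_var lam i j) \<in> I)"

text \<open>
  The family is nonempty (it contains the unit ideal) and closed under intersection, so this is
  the smallest symmetric strongly shifted ideal containing all $x^\lambda$, $\lambda \in B$.
\<close>

definition Sss :: "nat \<Rightarrow> nat monomial set \<Rightarrow> (nat, 'k::field) mpoly set" where
  "Sss n B = \<Inter> {I. symmetric_strongly_shifted n I \<and> mp_monom ` B \<subseteq> I}"

text \<open>The minimal monomial generators: the monomials of \<open>I\<close> that are minimal under divisibility.\<close>

definition min_gens :: "nat \<Rightarrow> (nat, 'k::field) mpoly set \<Rightarrow> nat monomial set" where
  "min_gens n I = {m. Poly_Mapping.keys m \<subseteq> {1..n} \<and> mp_monom m \<in> I \<and>
     (\<forall>m' d. m = m' + d \<and> mp_monom m' \<in> I \<longrightarrow> m' = m)}"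


section \<open>Toric ideal, Rees ring and special fiber ring\<close>

text \<open>The variables $T_m$ are indexed by the monomials $m \in G(I)$.\<close>

abbreviation T_var :: "nat monomial \<Rightarrow> (nat monomial, 'a::zero_neq_one) mpoly" where
  "T_var m \<equiv> mp_var m"

definition KT :: "nat monomial set \<Rightarrow> (nat monomial, 'k::field) mpoly ring" where
  "KT S = mpoly_ring UNIV S"

definition RT ::
  "nat \<Rightarrow> nat monomial set \<Rightarrow> (nat monomial, (nat, 'k::field) mpoly) mpoly ring" where
  "RT n S = mpoly_ring (carrier (poly_ring n)) S"

definition toric_ideal ::
  "nat \<Rightarrow> nat monomial set \<Rightarrow> (nat monomial, 'k::field) mpoly set" where
  "toric_ideal n S = a_kernel (KT S) (poly_ring n) (mp_eval mp_const mp_monom)"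

text \<open>
  Elements of $R[t]$ are univariate polynomials over $R$; the power of \<open>I\<close> is taken in the
  multiplicative monoid of ideals of $R$, so the zeroth power is $R$.
\<close>

definition rees_ring ::
  "nat \<Rightarrow> (nat, 'k::field) mpoly set \<Rightarrow> (nat, 'k) mpoly poly ring" where
  "rees_ring n I = ring_on {q. \<forall>i. coeff q i \<in> I [^]\<^bsub>ideals_set (poly_ring n)\<^esub> i}"

definition rees_ideal ::
  "nat \<Rightarrow> (nat, 'k::field) mpoly set \<Rightarrow> (nat monomial, (nat, 'k) mpoly) mpoly set" where
  "rees_ideal n I = a_kernel (RT n (min_gens n I)) (rees_ring n I)
     (mp_eval (\<lambda>c. [:c:]) (\<lambda>m. monom (mp_monom m) 1))"

text \<open>The ideal $(x_1,\dots,x_n)\mathcal R(I)$.\<close>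

definition rees_max :: "nat \<Rightarrow> (nat, 'k::field) mpoly set \<Rightarrow> (nat, 'k) mpoly poly set" where
  "rees_max n I = genideal (rees_ring n I) ((\<lambda>i. [:mp_var i:]) ` {1..n})"

definition fiber_ring ::
  "nat \<Rightarrow> (nat, 'k::field) mpoly set \<Rightarrow> (nat, 'k) mpoly poly set ring" where
  "fiber_ring n I = rees_ring n I Quot rees_max n I"

definition fiber_ideal ::
  "nat \<Rightarrow> (nat, 'k::field) mpoly set \<Rightarrow> (nat monomial, 'k) mpoly set" where
  "fiber_ideal n I = a_kernel (KT (min_gens n I)) (fiber_ring n I)
     (\<lambda>q. rees_max n I +>\<^bsub>rees_ring n I\<^esub>
        mp_eval (\<lambda>c. [:mp_const c:]) (\<lambda>m. monom (mp_monom m) 1) q)"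


section \<open>The relations\<close>

text \<open>
  The coefficient ring is left open, as the same relations are used both in $K[T]$ and in $R[T]$.
\<close>

definition exchange_relations ::
  "nat \<Rightarrow> nat monomial set \<Rightarrow> (nat monomial, 'a::comm_ring_1) mpoly set" where
  "exchange_relations n S =
     {T_var r * T_var s - T_var t * T_var w | r s t w. r \<in> S \<and> s \<in> S \<and> t \<in> S \<and> w \<in> S \<and>
        (\<exists>i\<in>{1..n}. \<exists>j\<in>{1..n}.
           Poly_Mapping.lookup r i > Poly_Mapping.lookup s i \<and>
           Poly_Mapping.lookup r j < Poly_Mapping.lookup s j \<and>
           t = swap_var r j i \<and> w = swap_var s i j)}"

text \<open>The exponent vector of $\sigma(x^\lambda) = \prod_k x_{\sigma(k)}^{\lambda_k}$.\<close>

definition perm_monomial :: "nat \<Rightarrow> (nat \<Rightarrow> nat) \<Rightarrow> nat monomial \<Rightarrow> nat monomial" where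
  "perm_monomial n sg lam = (\<Sum>k=1..n. Poly_Mapping.single (sg k) (Poly_Mapping.lookup lam k))"

text \<open>
  Every monomial $u$ in $x_1,\dots,x_n$ has such a presentation; $\lambda$ is unique, $\sigma$ is
  not, but the notions below do not depend on its choice.
\<close>

definition presents :: "nat \<Rightarrow> nat monomial \<Rightarrow> (nat \<Rightarrow> nat) \<Rightarrow> nat monomial \<Rightarrow> bool" where
  "presents n u sg lam \<longleftrightarrow> lam \<in> partitions n \<and> sg permutes {1..n} \<and> u = perm_monomial n sg lam"

text \<open>The leftmost nonzero entry of $a - b$ is positive.\<close>

definition leftmost_pos :: "nat \<Rightarrow> nat monomial \<Rightarrow> nat monomial \<Rightarrow> bool" where
  "leftmost_pos n a b \<longleftrightarrow>
     (\<exists>i\<in>{1..n}. Poly_Mapping.lookup a i > Poly_Mapping.lookup b i \<and>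
        (\<forall>j\<in>{1..<i}. Poly_Mapping.lookup a j = Poly_Mapping.lookup b j))"

definition prec :: "nat \<Rightarrow> nat monomial \<Rightarrow> nat monomial \<Rightarrow> bool" where
  "prec n v u \<longleftrightarrow> v \<noteq> u \<and>
     (\<exists>ta mu sg lam. presents n v ta mu \<and> presents n u sg lam \<and>
        (mu \<noteq> lam \<and> (weight n mu < weight n lam \<or>
                     weight n mu = weight n lam \<and> leftmost_pos n mu lam) \<or>
         mu = lam \<and> leftmost_pos n v u))"

definition p_index :: "nat \<Rightarrow> nat monomial \<Rightarrow> nat" where
  "p_index n lam = card {k\<in>{1..n}. int (Poly_Mapping.lookup lam k) < int (Poly_Mapping.lookup lam n) - 1}"

definition r_index :: "nat \<Rightarrow> nat monomial \<Rightarrow> nat" where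
  "r_index n lam = card {k\<in>{1..n}. Poly_Mapping.lookup lam k = Poly_Mapping.lookup lam n}"

definition u_max :: "nat \<Rightarrow> (nat \<Rightarrow> nat) \<Rightarrow> nat monomial \<Rightarrow> nat" where
  "u_max n sg lam =
     Max {sg k | k. k \<in> {1..n} \<and> Poly_Mapping.lookup lam k = Poly_Mapping.lookup lam n}"

definition C_ideal :: "nat \<Rightarrow> (nat \<Rightarrow> nat) \<Rightarrow> nat monomial \<Rightarrow> (nat, 'k::field) mpoly set" where
  "C_ideal n sg lam =
     genideal (poly_ring n) {mp_var (sg k) | k. k \<in> {1..p_index n lam}} <+>\<^bsub>poly_ring n\<^esub>
     genideal (poly_ring n) {mp_var (sg k) | k.
       k \<in> {p_index n lam + 1..n - r_index n lam} \<and> sg k < u_max n sg lam}"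

definition linear_relations ::
  "nat \<Rightarrow> nat monomial set \<Rightarrow> (nat monomial, (nat, 'k::field) mpoly) mpoly set" where
  "linear_relations n S =
     {mp_const (mp_var i) * T_var u - mp_const (mp_var (u_max n sg lam)) * T_var v | i u v sg lam.
        u \<in> S \<and> v \<in> S \<and> presents n u sg lam \<and> prec n v u \<and>
        i \<in> {1..n} \<and> (mp_var i :: (nat, 'k) mpoly) \<in> C_ideal n sg lam \<and>
        Poly_Mapping.single i 1 + u = Poly_Mapping.single (u_max n sg lam) 1 + v}"

end

(*
  The generators of I are the integer points of a permutohedron: u is one iff |u| = |lam| and
  sum_k max(u_k - c, 0) <= sum_k max(lam_k - c, 0) for all integers c. A kernel element is a
  combination of differences of monomials in the same fibre, so it suffices to connect any two
  such monomials, viewed as multisets of generators, by the given quadratic moves.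

  Toric ideal: exchanges minimising a convex cost make any two members differ by at most one in
  each coordinate. With f the floor of the average, all members then lie in f + {0,1}^n, and there
  the defining inequalities only bound partial sums in the order of decreasing f. Swaps along an
  excursion of a difference of partial sums respect these bounds, and a second convex potential
  leads to a multiset with a member whose partial sums dominate all others, by at most one. That
  member is determined by the total alone, so it can be cancelled.

  Rees ideal: read u as a pile of boxes (c, i), c <= u_i, ordered lexicographically. A linear move
  replaces the top box of u by a smaller one. When no cheaper state can be reached, the total of
  the generators is obtained by cutting off the given monomial at a common threshold box, so it is
  determined by the fibre; the toric case then applies.

  Fiber ring: the lowest-degree part of I^i t^i survives modulo (x_1, ..., x_n).
*)
theory Submission
  imports Defs
begin

text \<open>For the bases of an arbitrary matroid, connectivity under symmetric exchanges is a
  conjecture of White: the exchange property yields some partner \<open>j\<close>, but no control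
  over which one. Balancing provides that control here. Inside the cube the points are the bases of
  a nested matroid, as all constraints are upper bounds on partial sums along one order; an exchange
  can then be aimed at a stretch on which one partial sum exceeds another, and its effect on all
  partial sums is known. A single cost serves both ideals. Its level part is convex and enforces
  balance. Its index part only breaks ties, in the same way as \<open>u_max\<close> and
  \<open>prec\<close>, so that every linear move lowers the cost while the exchanges in use never
  raise it. Hence the consequences of balance and of the absence of linear moves can be combined in
  one cheapest state. Comparing only multisets of equal size is no restriction: \<open>t\<close>
  records the size in the Rees ring, and in the toric case it is the total weight divided by the
  common positive weight of the generators.\<close>

abbreviation "lookup \<equiv> Poly_Mapping.lookup"
abbreviation "keys \<equiv> Poly_Mapping.keys"
abbreviation "single \<equiv> Poly_Mapping.single"

section \<open>Integer points of a permutohedron\<close>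

lemma lookup_swap_var:
  "lookup (swap_var u i j) x = lookup u x + (if x = i then 1 else 0) - (if x = j then 1 else 0)"
  by (simp add: swap_var_def lookup_minus lookup_add lookup_single when_def)

lemma keys_swap_var: "keys (swap_var u i j) \<subseteq> insert i (keys u)"
  by (auto simp: in_keys_iff lookup_swap_var split: if_splits)

text \<open>Trades the truncated subtraction in \<open>swap_var\<close> for an equation of products,
  the form in which \<open>linear_relations\<close> states its condition on \<open>u\<close> and
  \<open>v\<close>.\<close>

lemma swap_var_eq_iff:
  assumes "i \<noteq> j" "0 < lookup u j"
  shows "v = swap_var u i j \<longleftrightarrow> single i 1 + u = single j 1 + v"
proof -
  have "v = swap_var u i j \<longleftrightarrow> (\<forall>x. lookup v x = lookup (swap_var u i j) x)"
    by (simp only: poly_mapping_eq_iff fun_eq_iff)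
  also have "\<dots> \<longleftrightarrow> (\<forall>x. lookup (single i 1 + u) x = lookup (single j 1 + v) x)"
    using assms by (intro all_cong1) (auto simp: lookup_swap_var lookup_add lookup_single when_def)
  also have "\<dots> \<longleftrightarrow> single i 1 + u = single j 1 + v"
    by (simp only: poly_mapping_eq_iff fun_eq_iff)
  finally show ?thesis .
qed

text \<open>Two terms are replaced and the others stay. Old and new terms are added on opposite
  sides, so nothing has to be subtracted, and the identity serves cut-off sums, box costs and
  squares alike.\<close>

lemma sum_swap_var:
  fixes h :: "nat \<Rightarrow> nat \<Rightarrow> 'a::comm_monoid_add"
  assumes "finite X" "i \<in> X" "j \<in> X" "i \<noteq> j"
  shows "(\<Sum>x\<in>X. h x (lookup (swap_var u i j) x)) + (h i (lookup u i) + h j (lookup u j))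
    = (\<Sum>x\<in>X. h x (lookup u x)) + (h i (lookup u i + 1) + h j (lookup u j - 1))"
proof -
  have split: "(\<Sum>x\<in>X. g x) = g i + g j + (\<Sum>x\<in>X-{i}-{j}. g x)" for g :: "nat \<Rightarrow> 'a"
    using assms sum.remove[of X i g] sum.remove[of "X - {i}" j g] by (simp add: add.assoc)
  have rest: "(\<Sum>x\<in>X-{i}-{j}. h x (lookup (swap_var u i j) x)) = (\<Sum>x\<in>X-{i}-{j}. h x (lookup u x))"
    by (rule sum.cong) (auto simp: lookup_swap_var)
  have "lookup (swap_var u i j) i = lookup u i + 1" "lookup (swap_var u i j) j = lookup u j - 1"
    using \<open>i \<noteq> j\<close> by (auto simp: lookup_swap_var)
  then show ?thesis
    unfolding split[of "\<lambda>x. h x (lookup (swap_var u i j) x)"] split[of "\<lambda>x. h x (lookup u x)"] rest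
    by (simp add: add_ac)
qed

section \<open>Cut-off sums, majorisation and the symmetric exchange property\<close>

definition excess :: "nat \<Rightarrow> nat \<Rightarrow> nat monomial \<Rightarrow> nat" where
  "excess n c u = (\<Sum>i=1..n. lookup u i - c)"

text \<open>
  Majorisation by \<open>lam\<close>, tested on the convex functions \<open>x \<mapsto> max (x - c) 0\<close> (truncated
  subtraction) with integral \<open>c\<close>; this suffices for integral vectors.
\<close>

definition perm_points :: "nat \<Rightarrow> nat monomial \<Rightarrow> nat monomial set" where
  "perm_points n lam = {u. keys u \<subseteq> {1..n} \<and> weight n u = weight n lam \<and>
     (\<forall>c. excess n c u \<le> excess n c lam)}"

lemma excess_0: "excess n 0 u = weight n u"
  by (simp add: excess_def weight_def)

lemma excess_swap_var:
  assumes "i \<in> {1..n}" "j \<in> {1..n}" "i \<noteq> j"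
  shows "excess n c (swap_var u i j) + (if c < lookup u j then 1 else 0)
    = excess n c u + (if c \<le> lookup u i then 1 else 0)"
  using sum_swap_var[of "{1..n}" i j "\<lambda>x v. v - c" u] assms
  by (auto simp: excess_def split: if_splits)

lemma perm_points_keys: "u \<in> perm_points n lam \<Longrightarrow> keys u \<subseteq> {1..n}"
  and perm_points_weight: "u \<in> perm_points n lam \<Longrightarrow> weight n u = weight n lam"
  and perm_points_excess: "u \<in> perm_points n lam \<Longrightarrow> excess n c u \<le> excess n c lam"
  by (auto simp: perm_points_def)

lemma lookup_le_weight: "x \<in> {1..n} \<Longrightarrow> lookup u x \<le> weight n u"
  unfolding weight_def by (rule member_le_sum) auto

lemma poly_mapping_eq_on:
  fixes u v :: "nat monomial"
  assumes "keys u \<subseteq> {1..n}" "keys v \<subseteq> {1..n}" "\<And>x. x \<in> {1..n} \<Longrightarrow> lookup u x = lookup v x"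
  shows "u = v"
proof (rule poly_mapping_eqI)
  fix x
  show "lookup u x = lookup v x"
    using assms by (metis in_keys_iff subsetD)
qed

text \<open>Moving a unit from \<open>j\<close> to \<open>i\<close> changes the cut-off sum at
  \<open>c\<close> by [c <= u_i] - [c < u_j]. It increases only for u_j <= c <= u_i, so slack is
  demanded at these levels alone.\<close>

lemma swap_var_perm_points:
  assumes u: "u \<in> perm_points n lam" and ij: "i \<in> {1..n}" "j \<in> {1..n}" "i \<noteq> j" and pos: "0 < lookup u j"
    and slack: "\<And>c. lookup u j \<le> c \<Longrightarrow> c \<le> lookup u i \<Longrightarrow> excess n c u < excess n c lam"
  shows "swap_var u i j \<in> perm_points n lam"
proof -
  have "excess n c (swap_var u i j) \<le> excess n c lam" for c
    using excess_swap_var[OF ij, of c u] slack[of c] perm_points_excess[OF u, of c]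
    by (auto split: if_splits)
  moreover have "weight n (swap_var u i j) = weight n lam"
    using excess_swap_var[OF ij, of 0 u] pos perm_points_weight[OF u] by (simp add: excess_0)
  moreover have "keys (swap_var u i j) \<subseteq> {1..n}"
    using keys_swap_var[of u i j] perm_points_keys[OF u] ij by blast
  ultimately show ?thesis
    by (simp add: perm_points_def)
qed

text \<open>No level needs slack when the unit goes from a larger exponent to a smaller one. This is
  the transfer principle of majorisation theory.\<close>

lemma robin_hood:
  assumes "u \<in> perm_points n lam" "i \<in> {1..n}" "j \<in> {1..n}" "lookup u i < lookup u j"
  shows "swap_var u i j \<in> perm_points n lam"
  using assms by (intro swap_var_perm_points) auto

text \<open>The clamped sum counts the boxes of \<open>u\<close> on the levels \<open>a + 1\<close>
  to \<open>b\<close>, so information on the cut-off sums at \<open>a\<close> and \<open>b\<close>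
  becomes information on the boxes in between.\<close>

lemma excess_clamp:
  assumes "a \<le> b"
  shows "excess n a u = excess n b u + (\<Sum>x=1..n. min (lookup u x - a) (b - a))"
  unfolding excess_def sum.distrib[symmetric]
  using assms by (intro sum.cong) auto

text \<open>Call a level tight if the cut-off sum attains its bound. Let \<open>a\<close> be the
  last tight level of \<open>s\<close> up to \<open>lookup s i\<close> and \<open>b\<close> the
  first tight level of \<open>r\<close> from \<open>lookup r i\<close> on. Between \<open>a\<close>
  and \<open>b\<close> the vector \<open>s\<close> has at least as many boxes as \<open>r\<close>,
  but in column \<open>i\<close> fewer; so in some column \<open>j\<close> it has more. As
  \<open>r\<close> stays below \<open>b\<close> and \<open>s\<close> rises above \<open>a\<close> in
  that column, neither move meets a tight level.\<close>

lemma symmetric_exchange: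
  assumes r: "r \<in> perm_points n lam" and s: "s \<in> perm_points n lam"
    and i: "i \<in> {1..n}" and less: "lookup s i < lookup r i"
  obtains j where "j \<in> {1..n}" "lookup r j < lookup s j"
    "swap_var r j i \<in> perm_points n lam" "swap_var s i j \<in> perm_points n lam"
proof -
  define Ts where "Ts = {c. c \<le> lookup s i \<and> excess n c s = excess n c lam}"
  define Tr where "Tr c \<longleftrightarrow> lookup r i \<le> c \<and> excess n c r = excess n c lam" for c
  define a where "a = Max Ts"
  define b where "b = (LEAST c. Tr c)"
  have "finite Ts" "0 \<in> Ts"
    using perm_points_weight[OF s] by (auto simp: Ts_def excess_0)
  then have a: "a \<in> Ts" and a_max: "\<And>c. c \<in> Ts \<Longrightarrow> c \<le> a"
    unfolding a_def using Max_in by (auto intro: Max_ge)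
  \<comment> \<open>At a level as large as the total weight every cut-off sum is 0, so
    \<open>r\<close> has a tight level and \<open>b\<close> exists; \<open>a\<close> exists since
    level 0 is tight.\<close>
  have big: "excess n (weight n lam) v = 0" if "v \<in> perm_points n lam" for v
    using lookup_le_weight[of _ n v] perm_points_weight[OF that] by (auto simp: excess_def)
  have "excess n (weight n lam) lam = 0"
    using lookup_le_weight[of _ n lam] by (auto simp: excess_def)
  then have "Tr (weight n lam)"
    using big[OF r] lookup_le_weight[OF i, of r] perm_points_weight[OF r] by (auto simp: Tr_def)
  then have b: "Tr b" and b_min: "\<And>c. Tr c \<Longrightarrow> b \<le> c"
    unfolding b_def by (auto intro: LeastI Least_le)
  have ab: "a \<le> lookup s i" "lookup r i \<le> b"
    using a b by (auto simp: Ts_def Tr_def)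
  have "\<exists>j\<in>{1..n}. lookup r j < lookup s j \<and> lookup r j < b \<and> a < lookup s j"
  proof (rule ccontr)
    assume none: "\<not> ?thesis"
    have "(\<Sum>x=1..n. min (lookup s x - a) (b - a)) < (\<Sum>x=1..n. min (lookup r x - a) (b - a))"
    proof (rule sum_strict_mono_ex1)
      show "\<forall>x\<in>{1..n}. min (lookup s x - a) (b - a) \<le> min (lookup r x - a) (b - a)"
      proof
        fix x assume "x \<in> {1..n}"
        then have "lookup s x \<le> lookup r x \<or> b \<le> lookup r x \<or> lookup s x \<le> a"
          using none by (meson not_le)
        then show "min (lookup s x - a) (b - a) \<le> min (lookup r x - a) (b - a)"
          by auto
      qed
      have "min (lookup s i - a) (b - a) < min (lookup r i - a) (b - a)"
        using ab less by auto
      then show "\<exists>x\<in>{1..n}. min (lookup s x - a) (b - a) < min (lookup r x - a) (b - a)"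
        using i by blast
    qed simp
    moreover have "a \<le> b"
      using ab less by simp
    ultimately show False
      using excess_clamp[of a b n s] excess_clamp[of a b n r] a b
        perm_points_excess[OF s, of b] perm_points_excess[OF r, of a]
      by (auto simp: Ts_def Tr_def)
  qed
  then obtain j where j: "j \<in> {1..n}" "lookup r j < lookup s j" "lookup r j < b" "a < lookup s j"
    by blast
  have ne: "j \<noteq> i"
    using j(2) less by auto
  have "excess n c r < excess n c lam" if "lookup r i \<le> c" "c \<le> lookup r j" for c
    using b_min[of c] that j(3) perm_points_excess[OF r, of c] by (force simp: Tr_def)
  then have "swap_var r j i \<in> perm_points n lam"
    using r i j(1) less ne by (intro swap_var_perm_points) auto
  moreover have "excess n c s < excess n c lam" if "lookup s j \<le> c" "c \<le> lookup s i" for c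
    using a_max[of c] that j(4) perm_points_excess[OF s, of c] by (force simp: Ts_def)
  then have "swap_var s i j \<in> perm_points n lam"
    using s i j(1,2) ne by (intro swap_var_perm_points) auto
  ultimately show thesis
    using that j by blast
qed

section \<open>Exchanges inside a unit cube\<close>

lemma sum_list_enum:
  assumes "bij_betw p {..<n} {1..n::nat}"
  shows "(\<Sum>x=1..n. g x) = (\<Sum>t<n. g (p t))"
  using sum.reindex_bij_betw[OF assms, of g] by simp

text \<open>
  When both vectors lie in the cube \<open>f + {0,1}\<^sup>n\<close> and \<open>p\<close> lists the indices by decreasing \<open>f\<close>,
  every set \<open>{x. c \<le> f x}\<close> is an initial segment of the list, so majorisation bounds partial sums.
\<close>

lemma segment_exchange:
  assumes u: "u \<in> perm_points n lam" and v: "v \<in> perm_points n lam"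
    and p: "bij_betw p {..<n} {1..n}"
    and f: "\<And>s t. s \<le> t \<Longrightarrow> t < n \<Longrightarrow> f (p t) \<le> f (p s)"
    and cube: "\<And>x. x \<in> {1..n} \<Longrightarrow> lookup u x \<in> {f x, Suc (f x)}"
      "\<And>x. x \<in> {1..n} \<Longrightarrow> lookup v x \<in> {f x, Suc (f x)}"
    and st: "s < t" "t < n"
    and at_s: "lookup v (p s) < lookup u (p s)" and at_t: "lookup u (p t) < lookup v (p t)"
    and above: "\<And>k. s < k \<Longrightarrow> k \<le> t \<Longrightarrow> (\<Sum>q<k. lookup v (p q)) < (\<Sum>q<k. lookup u (p q))"
  shows "swap_var u (p t) (p s) \<in> perm_points n lam" "swap_var v (p s) (p t) \<in> perm_points n lam"
proof -
  have ps: "p s \<in> {1..n}" "p t \<in> {1..n}" and ne: "p s \<noteq> p t"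
    using p st by (auto simp: bij_betw_def inj_on_def)
  have vals: "lookup u (p s) = Suc (f (p s))" "lookup v (p s) = f (p s)"
    "lookup u (p t) = f (p t)" "lookup v (p t) = Suc (f (p t))"
    using cube(1)[OF ps(1)] cube(2)[OF ps(1)] cube(1)[OF ps(2)] cube(2)[OF ps(2)] at_s at_t by auto
  have "f (p t) \<le> f (p s)"
    using f st by auto
  then show "swap_var u (p t) (p s) \<in> perm_points n lam"
    using vals ps u by (intro robin_hood) auto
  \<comment> \<open>The opposite move may raise the larger of two exponents of \<open>v\<close>, so
    slack is needed from \<open>Suc (f (p t))\<close> to \<open>f (p s)\<close>. For such
    \<open>c\<close> the indices with \<open>c \<le> f x\<close> are the first \<open>k\<close> of
    the list, where s < k <= t; on them \<open>v\<close> has a smaller partial sum than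
    \<open>u\<close>, and \<open>u\<close> respects the bound.\<close>
  have "excess n c v < excess n c lam" if c: "Suc (f (p t)) \<le> c" "c \<le> f (p s)" for c
  proof -
    define k where "k = (LEAST k. f (p k) < c)"
    have kt: "f (p k) < c" "k \<le> t"
      unfolding k_def using c(1) LeastI[of "\<lambda>k. f (p k) < c" t] Least_le[of "\<lambda>k. f (p k) < c" t] by auto
    have below: "c \<le> f (p q)" if "q < k" for q
      using not_less_Least[of q "\<lambda>k. f (p k) < c"] that by (auto simp: k_def)
    have "s < k"
      using f[of k s] kt(1) c(2) st by (meson le_less_trans less_le_not_le not_le order.strict_trans2)
    \<comment> \<open>Inside the cube the truncation is harmless: from position \<open>k\<close> on
      the exponent is at most \<open>c\<close> and contributes nothing, before it the exponent is at
      least \<open>c\<close>.\<close>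
    have part: "excess n c w + k * c = (\<Sum>q<k. lookup w (p q))"
      if cw: "\<And>x. x \<in> {1..n} \<Longrightarrow> lookup w x \<in> {f x, Suc (f x)}" for w
    proof -
      have cw': "lookup w (p q) \<in> {f (p q), Suc (f (p q))}" if "q < n" for q
        using cw[of "p q"] bij_betwE[OF p] that by blast
      have "excess n c w = (\<Sum>q<n. lookup w (p q) - c)"
        unfolding excess_def by (rule sum_list_enum[OF p])
      also have "\<dots> = (\<Sum>q<k. lookup w (p q) - c)"
      proof (rule sum.mono_neutral_right)
        show "\<forall>q\<in>{..<n} - {..<k}. lookup w (p q) - c = 0"
        proof
          fix q assume q: "q \<in> {..<n} - {..<k}"
          then have "f (p q) \<le> f (p k)"
            using f by auto
          then show "lookup w (p q) - c = 0"
            using cw'[of q] q kt(1) by auto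
        qed
      qed (use kt st in auto)
      also have "\<dots> + k * c = (\<Sum>q<k. lookup w (p q) - c + c)"
        by (simp only: sum.distrib) simp
      also have "\<dots> = (\<Sum>q<k. lookup w (p q))"
      proof (rule sum.cong)
        fix q assume "q \<in> {..<k}"
        then show "lookup w (p q) - c + c = lookup w (p q)"
          using below[of q] cw'[of q] kt st by auto
      qed simp
      finally show ?thesis .
    qed
    have "excess n c v < excess n c u"
      using part[OF cube(1)] part[OF cube(2)] above[OF \<open>s < k\<close> kt(2)] by linarith
    then show ?thesis
      using perm_points_excess[OF u, of c] by simp
  qed
  then show "swap_var v (p s) (p t) \<in> perm_points n lam"
    using vals by (intro swap_var_perm_points[OF v ps ne]) simp_all
qed

section \<open>Connecting multisets by exchanges\<close>

lemma sum_mset_le_bound: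
  fixes g :: "'b \<Rightarrow> nat"
  assumes "\<And>v. v \<in># M \<Longrightarrow> g v \<le> b"
  shows "(\<Sum>v\<in>#M. g v) \<le> size M * b"
  using assms by (induction M) (auto simp: add_le_mono)

lemma sum_mset_ge_bound:
  fixes g :: "'b \<Rightarrow> nat"
  assumes "\<And>v. v \<in># M \<Longrightarrow> b \<le> g v"
  shows "size M * b \<le> (\<Sum>v\<in>#M. g v)"
  using assms by (induction M) (auto simp: add_le_mono)

lemma lookup_sum_mset: "lookup (\<Sum>\<^sub># M) x = (\<Sum>u\<in>#M. lookup u x)"
  by (induction M) (simp_all add: lookup_add)

lemma weight_add: "weight n (u + v) = weight n u + weight n v"
  by (simp add: weight_def lookup_add sum.distrib)

lemma weight_sum_mset:
  assumes "set_mset M \<subseteq> perm_points n lam"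
  shows "weight n (\<Sum>\<^sub># M) = size M * weight n lam"
  using assms by (induction M) (auto simp: weight_add perm_points_weight, simp add: weight_def)

lemma swap_var_add_swap_var:
  assumes "i \<noteq> j" "0 < lookup r i" "0 < lookup s j"
  shows "swap_var r j i + swap_var s i j = r + s"
  using assms by (intro poly_mapping_eqI) (auto simp: lookup_add lookup_swap_var)

lemma ex_sorting_enum:
  fixes f :: "nat \<Rightarrow> nat"
  obtains p where "bij_betw p {..<n} {1..n}" "\<And>s t. s \<le> t \<Longrightarrow> t < n \<Longrightarrow> f (p t) \<le> f (p s)"
proof -
  define xs where "xs = rev (sort_key f [1..<Suc n])"
  have "bij_betw (\<lambda>t. xs ! t) {..<length xs} (set xs)"
    by (rule bij_betw_nth) (auto simp: xs_def)
  moreover have "set xs = {1..n}" "length xs = n"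
    by (auto simp: xs_def)
  moreover have "f (xs ! t) \<le> f (xs ! s)" if "s \<le> t" "t < n" for s t
  proof -
    have "sorted (map f (sort_key f [1..<Suc n]))"
      by simp
    then have "sorted (rev (map f xs))"
      by (simp add: xs_def rev_map)
    then show ?thesis
      using sorted_rev_nth_mono[of "map f xs" s t] that \<open>length xs = n\<close> by simp
  qed
  ultimately show thesis
    using that by metis
qed

text \<open>The factor \<open>n + 1\<close> exceeds every index \<open>i\<close>, so the level of a
  box outweighs its column.\<close>

definition box_cost :: "nat \<Rightarrow> nat \<Rightarrow> nat \<Rightarrow> nat" where
  "box_cost n i k = (\<Sum>c=1..k. c * (n + 1) + i)"

text \<open>
  Reads the exponent vector as a pile of boxes \<open>(c, i)\<close>, \<open>1 \<le> c \<le> lookup u i\<close>, each costing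
  its rank in the lexicographic order.
\<close>

definition cost :: "nat \<Rightarrow> nat monomial \<Rightarrow> nat" where
  "cost n u = (\<Sum>i=1..n. box_cost n i (lookup u i))"

lemma box_cost_Suc: "box_cost n i (Suc k) = box_cost n i k + (Suc k * (n + 1) + i)"
  by (simp add: box_cost_def)

lemma cost_swap_var:
  assumes "i \<in> {1..n}" "j \<in> {1..n}" "i \<noteq> j" "0 < lookup u j"
  shows "cost n (swap_var u i j) + (lookup u j * (n + 1) + j) = cost n u + (Suc (lookup u i) * (n + 1) + i)"
proof -
  obtain k where k: "lookup u j = Suc k"
    using assms(4) gr0_implies_Suc by blast
  show ?thesis
    using sum_swap_var[of "{1..n}" i j "box_cost n" u] assms k
    by (simp add: cost_def box_cost_Suc)
qed

text \<open>In each of the columns \<open>i\<close> and \<open>j\<close> one box is removed and one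
  is added at a level that is not higher: the indices cancel and only the levels count. The weak
  inequality is for an exchange that merely prepares a linear move.\<close>

lemma cost_exchange:
  assumes ij: "i \<in> {1..n}" "j \<in> {1..n}" and less: "lookup s i < lookup r i" "lookup r j < lookup s j"
  shows "cost n (swap_var r j i) + cost n (swap_var s i j) \<le> cost n r + cost n s"
    and "Suc (lookup s i) < lookup r i \<Longrightarrow>
      cost n (swap_var r j i) + cost n (swap_var s i j) < cost n r + cost n s"
proof -
  have ne: "i \<noteq> j"
    using less by auto
  have eqs: "cost n (swap_var r j i) + (lookup r i * (n + 1) + i) = cost n r + (Suc (lookup r j) * (n + 1) + j)"
    "cost n (swap_var s i j) + (lookup s j * (n + 1) + j) = cost n s + (Suc (lookup s i) * (n + 1) + i)"
    using cost_swap_var[of j n i r] cost_swap_var[of i n j s] ij ne less by auto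
  have j_le: "Suc (lookup r j) * (n + 1) \<le> lookup s j * (n + 1)"
    using less by (intro mult_right_mono) auto
  have "Suc (lookup s i) * (n + 1) \<le> lookup r i * (n + 1)"
    using less by (intro mult_right_mono) auto
  then show "cost n (swap_var r j i) + cost n (swap_var s i j) \<le> cost n r + cost n s"
    using eqs j_le by linarith
  assume "Suc (lookup s i) < lookup r i"
  then have "Suc (lookup s i) * (n + 1) < lookup r i * (n + 1)"
    by (intro mult_strict_right_mono) auto
  then show "cost n (swap_var r j i) + cost n (swap_var s i j) < cost n r + cost n s"
    using eqs j_le by linarith
qed

section \<open>Balanced multisets and their common cube\<close>

definition balanced :: "nat \<Rightarrow> nat monomial multiset \<Rightarrow> bool" where
  "balanced n M \<longleftrightarrow> (\<forall>u\<in>#M. \<forall>v\<in>#M. \<forall>i\<in>{1..n}. lookup u i \<le> Suc (lookup v i))"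

text \<open>The other members deviate by at most one from the exponent x of \<open>u\<close>, and
  \<open>u\<close> itself does not deviate, so the average is at least x - 1 and strictly below x +
  1. The corner of the cube depends only on the total and the size, hence is the same for all
  balanced multisets in a fibre.\<close>

lemma balanced_cube:
  assumes "balanced n M" "u \<in># M" "i \<in> {1..n}"
  shows "lookup u i \<in> {lookup (\<Sum>\<^sub># M) i div size M, Suc (lookup (\<Sum>\<^sub># M) i div size M)}"
proof -
  obtain M' where M: "M = add_mset u M'"
    using assms(2) by (metis insert_DiffM)
  let ?x = "lookup u i" and ?N = "size M'"
  have b: "lookup v i \<le> Suc ?x" "?x - 1 \<le> lookup v i" if "v \<in># M'" for v
    using assms M that by (force simp: balanced_def)+
  have "lookup (\<Sum>\<^sub># M) i \<le> ?x + ?N * Suc ?x" "?x + ?N * (?x - 1) \<le> lookup (\<Sum>\<^sub># M) i"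
    using sum_mset_le_bound[of M' "\<lambda>v. lookup v i", OF b(1)]
      sum_mset_ge_bound[of M' "?x - 1" "\<lambda>v. lookup v i", OF b(2)]
    by (simp_all add: M lookup_add lookup_sum_mset)
  then have "lookup (\<Sum>\<^sub># M) i < Suc ?x * size M" "(?x - 1) * size M \<le> lookup (\<Sum>\<^sub># M) i"
    by (auto simp: M algebra_simps)
  then have "lookup (\<Sum>\<^sub># M) i div size M < Suc ?x" "?x - 1 \<le> lookup (\<Sum>\<^sub># M) i div size M"
    by (auto simp: M div_less_iff_less_mult less_eq_div_iff_mult_less_eq)
  then show ?thesis
    by auto
qed

section \<open>Partial sums and their excursions\<close>

definition pre :: "(nat \<Rightarrow> nat) \<Rightarrow> nat \<Rightarrow> nat monomial \<Rightarrow> nat" where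
  "pre p k u = (\<Sum>q<k. lookup u (p q))"

lemma pre_swap_var:
  assumes p: "inj_on p {..<n}" and "s < n" "t < n" "s \<noteq> t" "0 < lookup u (p t)" "k \<le> n"
  shows "pre p k (swap_var u (p s) (p t)) + (if t < k then 1 else 0) = pre p k u + (if s < k then 1 else 0)"
proof -
  have ind: "(\<Sum>q<k. if p q = p x then 1 else 0) = (if x < k then 1 else (0::nat))" if "x < n" for x
  proof -
    have "(\<Sum>q<k. if p q = p x then 1 else 0) = (\<Sum>q<k. if q = x then 1 else (0::nat))"
      using p that \<open>k \<le> n\<close> by (intro sum.cong) (auto simp: inj_on_def)
    then show ?thesis
      by simp
  qed
  have "p s \<noteq> p t"
    using p assms by (auto simp: inj_on_def)
  then have "lookup (swap_var u (p s) (p t)) x + (if x = p t then 1 else 0)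
      = lookup u x + (if x = p s then 1 else 0)" for x
    using assms by (auto simp: lookup_swap_var)
  then have "(\<Sum>q<k. lookup (swap_var u (p s) (p t)) (p q) + (if p q = p t then 1 else 0))
      = (\<Sum>q<k. lookup u (p q) + (if p q = p s then 1 else 0))"
    by simp
  then show ?thesis
    using ind[of s] ind[of t] assms unfolding pre_def sum.distrib by simp
qed

text \<open>\<open>s\<close> is the last position before \<open>k\<close> with value below
  \<open>h\<close>, and \<open>Suc t\<close> the first one after it; hence \<open>D\<close> rises at
  \<open>s\<close>, falls at \<open>t\<close> and is at least \<open>h\<close> in between.\<close>

lemma excursion:
  fixes D :: "nat \<Rightarrow> int"
  assumes "D 0 < h" "D n < h" "h \<le> D k" "k \<le> n"
  obtains s t where "s < t" "t < n" "D s < D (Suc s)" "D (Suc t) < D t"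
    "\<And>x. s < x \<Longrightarrow> x \<le> t \<Longrightarrow> h \<le> D x"
proof -
  define S where "S = {x. x < k \<and> D x < h}"
  define s where "s = Max S"
  have "k \<noteq> 0" "k \<noteq> n"
    using assms(1-3) by (metis not_le)+
  then have S: "finite S" "S \<noteq> {}"
    using assms by (auto simp: S_def intro!: exI[of _ 0] gr0I)
  then have s: "s < k" "D s < h"
    using Max_in[OF S] by (auto simp: s_def S_def)
  have above_s: "h \<le> D x" if "s < x" "x \<le> k" for x
  proof (rule ccontr)
    assume "\<not> h \<le> D x"
    then have "x \<in> S"
      using that assms(3) by (cases "x = k") (auto simp: S_def)
    then show False
      using Max_ge[OF S(1), of x] that by (simp add: s_def)
  qed
  define t' where "t' = (LEAST x. k < x \<and> D x < h)"
  have "k < n \<and> D n < h"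
    using assms \<open>k \<noteq> n\<close> by auto
  then have t': "k < t' \<and> D t' < h" "t' \<le> n"
    unfolding t'_def by (rule LeastI, rule Least_le)
  have above_t: "h \<le> D x" if "k \<le> x" "x < t'" for x
    using not_less_Least[of x "\<lambda>x. k < x \<and> D x < h"] that assms(3)
    by (cases "x = k") (auto simp: t'_def)
  obtain t where t: "t' = Suc t"
    using t' by (cases t') auto
  show thesis
  proof
    show "s < t" "t < n"
      using s t t' by auto
    show "D s < D (Suc s)"
      using above_s[of "Suc s"] s by auto
    show "D (Suc t) < D t"
      using above_t[of t] t t' by auto
    show "h \<le> D x" if "s < x" "x \<le> t" for x
      using above_s[of x] above_t[of x] that t by (cases "x \<le> k") auto
  qed
qed

definition in_cube :: "nat \<Rightarrow> (nat \<Rightarrow> nat) \<Rightarrow> nat monomial \<Rightarrow> bool" where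
  "in_cube n f u \<longleftrightarrow> (\<forall>x\<in>{1..n}. lookup u x \<in> {f x, Suc (f x)})"

lemma in_cube_swap_var:
  assumes "in_cube n f u" "in_cube n f v" "i \<in> {1..n}" "j \<in> {1..n}"
    "lookup v i < lookup u i" "lookup u j < lookup v j"
  shows "in_cube n f (swap_var u j i)" "in_cube n f (swap_var v i j)"
proof -
  have "lookup u i = Suc (f i)" "lookup v i = f i" "lookup u j = f j" "lookup v j = Suc (f j)"
    using bspec[OF assms(1)[unfolded in_cube_def] assms(3)] bspec[OF assms(2)[unfolded in_cube_def] assms(3)]
      bspec[OF assms(1)[unfolded in_cube_def] assms(4)] bspec[OF assms(2)[unfolded in_cube_def] assms(4)]
      assms(5,6) by auto
  then show "in_cube n f (swap_var u j i)" "in_cube n f (swap_var v i j)"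
    using assms by (auto simp: in_cube_def lookup_swap_var)
qed

text \<open>The closure properties of membership of \<open>T_prod M - T_prod N\<close> in an ideal
  containing the exchange relations. They are kept abstract because the Rees case needs the same
  result with a fixed monomial in front of both products.\<close>

locale exchange_congruence =
  fixes n :: nat and lam :: "nat monomial"
    and E :: "nat monomial multiset \<Rightarrow> nat monomial multiset \<Rightarrow> bool"
  assumes refl: "E M M"
    and sym: "E M N \<Longrightarrow> E N M"
    and trans: "E L M \<Longrightarrow> E M N \<Longrightarrow> E L N"
    and add: "E M N \<Longrightarrow> u \<in> perm_points n lam \<Longrightarrow> E (add_mset u M) (add_mset u N)"
    and exch: "r \<in> perm_points n lam \<Longrightarrow> s \<in> perm_points n lam \<Longrightarrow> i \<in> {1..n} \<Longrightarrow> j \<in> {1..n} \<Longrightarrow>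
      lookup s i < lookup r i \<Longrightarrow> lookup r j < lookup s j \<Longrightarrow>
      swap_var r j i \<in> perm_points n lam \<Longrightarrow> swap_var s i j \<in> perm_points n lam \<Longrightarrow>
      E {#r, s#} {#swap_var r j i, swap_var s i j#}"
begin

lemma add_union:
  assumes "E M N" "set_mset L \<subseteq> perm_points n lam"
  shows "E (M + L) (N + L)"
  using assms(2) by (induction L) (auto simp: assms(1) add)

text \<open>\<open>E\<close> may relate arbitrary multisets, so the invariants of an exchange are
  recorded alongside it.\<close>

definition reaches :: "nat monomial multiset \<Rightarrow> nat monomial multiset \<Rightarrow> bool" where
  "reaches M N \<longleftrightarrow> E M N \<and> set_mset N \<subseteq> perm_points n lam \<and> \<Sum>\<^sub># N = \<Sum>\<^sub># M \<and> size N = size M"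

lemma reaches_trans: "reaches L M \<Longrightarrow> reaches M N \<Longrightarrow> reaches L N"
  by (auto simp: reaches_def intro: trans)

lemma reaches_exch:
  assumes rs: "r \<in> perm_points n lam" "s \<in> perm_points n lam" and L: "set_mset L \<subseteq> perm_points n lam"
    and ij: "i \<in> {1..n}" "j \<in> {1..n}" and less: "lookup s i < lookup r i" "lookup r j < lookup s j"
    and mem: "swap_var r j i \<in> perm_points n lam" "swap_var s i j \<in> perm_points n lam"
  shows "reaches (add_mset r (add_mset s L)) (add_mset (swap_var r j i) (add_mset (swap_var s i j) L))"
proof -
  have "E ({#r, s#} + L) ({#swap_var r j i, swap_var s i j#} + L)"
    using assms by (intro add_union exch)
  moreover have "swap_var r j i + swap_var s i j = r + s"
    using less by (intro swap_var_add_swap_var) auto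
  ultimately show ?thesis
    using mem L by (simp add: reaches_def flip: add.assoc)
qed

lemma min_cost_balanced:
  assumes M: "set_mset M \<subseteq> perm_points n lam"
    and min: "\<And>N. reaches M N \<Longrightarrow> (\<Sum>u\<in>#M. cost n u) \<le> (\<Sum>u\<in>#N. cost n u)"
  shows "balanced n M"
proof (rule ccontr)
  assume "\<not> ?thesis"
  then obtain r s i where rs: "r \<in># M" "s \<in># M" and i: "i \<in> {1..n}" and less: "Suc (lookup s i) < lookup r i"
    by (auto simp: balanced_def not_le)
  have "r \<noteq> s"
    using less by auto
  then obtain L where L: "M = add_mset r (add_mset s L)"
    using rs by (metis insert_DiffM insert_noteq_member)
  have G: "r \<in> perm_points n lam" "s \<in> perm_points n lam" "set_mset L \<subseteq> perm_points n lam"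
    using M L by auto
  obtain j where j: "j \<in> {1..n}" "lookup r j < lookup s j"
    and mem: "swap_var r j i \<in> perm_points n lam" "swap_var s i j \<in> perm_points n lam"
    using symmetric_exchange[OF G(1,2) i] less by (metis Suc_lessD)
  show False
    using min[unfolded L, OF reaches_exch[OF G i j(1) Suc_lessD[OF less] j(2) mem]]
      cost_exchange(2)[OF i j(1) Suc_lessD[OF less] j(2) less] by simp
qed

lemma ex_balanced:
  assumes "set_mset M \<subseteq> perm_points n lam"
  obtains N where "reaches M N" "balanced n N"
proof -
  have "reaches M M"
    using assms refl by (simp add: reaches_def)
  then obtain N where N: "reaches M N"
    and min: "\<forall>N'. reaches M N' \<longrightarrow> (\<Sum>u\<in>#N. cost n u) \<le> (\<Sum>u\<in>#N'. cost n u)"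
    using ex_has_least_nat[of "reaches M" M "\<lambda>N. \<Sum>u\<in>#N. cost n u"] by blast
  have "balanced n N"
    using N min reaches_trans[OF N] by (intro min_cost_balanced) (auto simp: reaches_def)
  then show thesis
    using N that by blast
qed

text \<open>Equal weights make the partial sums of \<open>u\<close> and \<open>v\<close> agree at
  both ends of the list, so a lead of \<open>h\<close> belongs to an excursion. Exchanging at its
  ends moves one unit from \<open>u\<close> to \<open>v\<close> in exactly the partial sums at the
  positions \<open>A\<close> of the excursion.\<close>

lemma segment_step:
  assumes u: "u \<in> perm_points n lam" and v: "v \<in> perm_points n lam"
    and p: "bij_betw p {..<n} {1..n}"
    and f: "\<And>s t. s \<le> t \<Longrightarrow> t < n \<Longrightarrow> f (p t) \<le> f (p s)"
    and cube: "in_cube n f u" "in_cube n f v"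
    and h: "0 < h" "k \<le> n" "pre p k v + h \<le> pre p k u"
  obtains u' v' A where "in_cube n f u'" "in_cube n f v'"
    "\<And>L. set_mset L \<subseteq> perm_points n lam \<Longrightarrow> reaches (add_mset u (add_mset v L)) (add_mset u' (add_mset v' L))"
    "A \<subseteq> {..n}" "A \<noteq> {}"
    "\<And>x. x \<in> A \<Longrightarrow> pre p x v + h \<le> pre p x u \<and> pre p x u = Suc (pre p x u') \<and> pre p x v' = Suc (pre p x v)"
    "\<And>x. x \<le> n \<Longrightarrow> x \<notin> A \<Longrightarrow> pre p x u' = pre p x u \<and> pre p x v' = pre p x v"
proof -
  define D where "D x = int (pre p x u) - int (pre p x v)" for x
  have "pre p n u = pre p n v"
    using perm_points_weight[OF u] perm_points_weight[OF v] sum_list_enum[OF p, of "lookup u"]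
      sum_list_enum[OF p, of "lookup v"] by (simp add: pre_def weight_def)
  moreover have "pre p 0 w = 0" for w
    by (simp add: pre_def)
  ultimately have "D 0 < int h" "D n < int h" "int h \<le> D k"
    using h by (auto simp: D_def)
  then obtain s t where st: "s < t" "t < n" and D: "D s < D (Suc s)" "D (Suc t) < D t"
    and seg: "\<And>x. s < x \<Longrightarrow> x \<le> t \<Longrightarrow> int h \<le> D x"
    using excursion[of D "int h" n k] h(2) by metis
  have seg': "pre p x v + h \<le> pre p x u" if "s < x" "x \<le> t" for x
    using seg[OF that] by (simp add: D_def)
  have less: "lookup v (p s) < lookup u (p s)" "lookup u (p t) < lookup v (p t)"
    using D by (simp_all add: D_def pre_def)
  have ps: "p s \<in> {1..n}" "p t \<in> {1..n}" and inj: "inj_on p {..<n}"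
    using bij_betwE[OF p] p st by (auto simp: bij_betw_def)
  have above: "(\<Sum>q<x. lookup v (p q)) < (\<Sum>q<x. lookup u (p q))" if "s < x" "x \<le> t" for x
    using seg'[OF that] h(1) by (simp add: pre_def)
  have mem: "swap_var u (p t) (p s) \<in> perm_points n lam" "swap_var v (p s) (p t) \<in> perm_points n lam"
    using segment_exchange[where f=f, OF u v p f _ _ st less above] cube by (auto simp: in_cube_def)
  show thesis
  proof
    show "in_cube n f (swap_var u (p t) (p s))" "in_cube n f (swap_var v (p s) (p t))"
      using in_cube_swap_var[OF cube ps less] .
    show "reaches (add_mset u (add_mset v L)) (add_mset (swap_var u (p t) (p s)) (add_mset (swap_var v (p s) (p t)) L))"
      if "set_mset L \<subseteq> perm_points n lam" for L
      using reaches_exch[OF u v that ps less mem] .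
    show "{s<..t} \<subseteq> {..n}" "{s<..t} \<noteq> {}"
      using st by auto
    show "pre p x v + h \<le> pre p x u \<and> pre p x u = Suc (pre p x (swap_var u (p t) (p s))) \<and>
      pre p x (swap_var v (p s) (p t)) = Suc (pre p x v)" if "x \<in> {s<..t}" for x
      using pre_swap_var[OF inj, of t s u x] pre_swap_var[OF inj, of s t v x] st less that seg'[of x] by auto
    show "pre p x (swap_var u (p t) (p s)) = pre p x u \<and> pre p x (swap_var v (p s) (p t)) = pre p x v"
      if "x \<le> n" "x \<notin> {s<..t}" for x
      using pre_swap_var[OF inj, of t s u x] pre_swap_var[OF inj, of s t v x] st less that
      by (auto split: if_splits)
  qed
qed

text \<open>
  Among all ways to single out one member \<open>u\<close>, minimise a convex potential of the partial sums,
  biased so that ties are broken in favour of large partial sums of \<open>u\<close>.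
\<close>

lemma ex_dominant:
  assumes M: "set_mset M \<subseteq> perm_points n lam" "M \<noteq> {#}"
    and f: "f = (\<lambda>x. lookup (\<Sum>\<^sub># M) x div size M)"
    and p: "bij_betw p {..<n} {1..n}"
    and sorted: "\<And>s t. s \<le> t \<Longrightarrow> t < n \<Longrightarrow> f (p t) \<le> f (p s)"
  obtains u N where "reaches M (add_mset u N)"
    "\<And>k v. k \<le> n \<Longrightarrow> v \<in># N \<Longrightarrow> pre p k v \<le> pre p k u \<and> pre p k u \<le> Suc (pre p k v)"
proof -
  \<comment> \<open>The cube condition is kept as an invariant, since \<open>segment_step\<close>
    requires it.\<close>
  define P where "P = (\<lambda>(u, N). reaches M (add_mset u N) \<and> (\<forall>v\<in>#add_mset u N. in_cube n f v))"
  \<comment> \<open>A partial sum y counts as y (y - 1) for the chosen member and as y^2 for the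
    others. Because of this asymmetry a unit moved from \<open>u\<close> to \<open>v\<close> pays
    off once \<open>u\<close> leads by 2, but one moved from \<open>v\<close> to \<open>u\<close>
    already when \<open>v\<close> leads by 1.\<close>
  define Psi where "Psi = (\<lambda>(u, N). (\<Sum>k\<le>n. pre p k u * (pre p k u - 1)) + (\<Sum>v\<in>#N. \<Sum>k\<le>n. (pre p k v)\<^sup>2))"
  obtain N0 where N0: "reaches M N0" "balanced n N0"
    using ex_balanced[OF M(1)] .
  have "size N0 = size M" "\<Sum>\<^sub># N0 = \<Sum>\<^sub># M"
    using N0(1) by (auto simp: reaches_def)
  then have "N0 \<noteq> {#}" and cube0: "\<forall>v\<in>#N0. in_cube n f v"
    using M(2) balanced_cube[OF N0(2)] by (auto simp: in_cube_def f)
  then obtain u0 N1 where "N0 = add_mset u0 N1"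
    using multiset_cases by blast
  then have "P (u0, N1)"
    using N0(1) cube0 by (simp add: P_def)
  then obtain x where x: "P x" "\<forall>y. P y \<longrightarrow> Psi x \<le> Psi y"
    using ex_has_least_nat[of P _ Psi] by blast
  obtain u N where [simp]: "x = (u, N)"
    by fastforce
  have reach: "reaches M (add_mset u N)" and cube: "\<And>v. v \<in># add_mset u N \<Longrightarrow> in_cube n f v"
    using x(1) by (auto simp: P_def)
  then have G: "u \<in> perm_points n lam" "set_mset N \<subseteq> perm_points n lam"
    by (auto simp: reaches_def)
  have no_better: False
    if N: "N = add_mset v L" and r: "reaches (add_mset u (add_mset v L)) (add_mset u' (add_mset v' L))"
      and c: "in_cube n f u'" "in_cube n f v'"
      and A: "A \<subseteq> {..n}" "A \<noteq> {}"
      and dec: "\<And>k. k \<in> A \<Longrightarrow> pre p k u' * (pre p k u' - 1) + (pre p k v')\<^sup>2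
        < pre p k u * (pre p k u - 1) + (pre p k v)\<^sup>2"
      and same: "\<And>k. k \<le> n \<Longrightarrow> k \<notin> A \<Longrightarrow> pre p k u' = pre p k u \<and> pre p k v' = pre p k v"
    for v L u' v' A
  proof -
    have "P (u', add_mset v' L)"
      using reaches_trans[OF reach] r c cube N by (auto simp: P_def)
    moreover have "(\<Sum>k\<le>n. pre p k u' * (pre p k u' - 1) + (pre p k v')\<^sup>2)
        < (\<Sum>k\<le>n. pre p k u * (pre p k u - 1) + (pre p k v)\<^sup>2)"
    proof (rule sum_strict_mono_ex1)
      show "\<forall>k\<in>{..n}. pre p k u' * (pre p k u' - 1) + (pre p k v')\<^sup>2
          \<le> pre p k u * (pre p k u - 1) + (pre p k v)\<^sup>2"
        using dec same by (metis atMost_iff le_eq_less_or_eq)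
      show "\<exists>k\<in>{..n}. pre p k u' * (pre p k u' - 1) + (pre p k v')\<^sup>2
          < pre p k u * (pre p k u - 1) + (pre p k v)\<^sup>2"
        using A dec by blast
    qed simp
    then have "Psi (u', add_mset v' L) < Psi x"
      by (simp add: Psi_def N sum.distrib)
    ultimately show False
      using x(2) by (meson not_less)
  qed
  show thesis
  proof
    show "reaches M (add_mset u N)"
      by fact
    fix k v assume k: "k \<le> n" and "v \<in># N"
    then obtain L where L: "N = add_mset v L"
      by (metis insert_DiffM)
    have v: "v \<in> perm_points n lam" "set_mset L \<subseteq> perm_points n lam" "in_cube n f v" "in_cube n f u"
      using G L cube by auto
    have "pre p k v \<le> pre p k u"
    proof (rule ccontr)
      assume "\<not> ?thesis"
      then have "pre p k u + 1 \<le> pre p k v"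
        by simp
      then obtain v' u' A where step: "in_cube n f v'" "in_cube n f u'"
        "\<And>L. set_mset L \<subseteq> perm_points n lam \<Longrightarrow> reaches (add_mset v (add_mset u L)) (add_mset v' (add_mset u' L))"
        "A \<subseteq> {..n}" "A \<noteq> {}"
        "\<And>x. x \<in> A \<Longrightarrow> pre p x u + 1 \<le> pre p x v \<and> pre p x v = Suc (pre p x v') \<and> pre p x u' = Suc (pre p x u)"
        "\<And>x. x \<le> n \<Longrightarrow> x \<notin> A \<Longrightarrow> pre p x v' = pre p x v \<and> pre p x u' = pre p x u"
        using segment_step[OF v(1) G(1) p sorted v(3,4), of 1 k] k by (metis zero_less_one)
      \<comment> \<open>With d the lead of \<open>v\<close>, the potential drops by 2d - 1.\<close>
      have "pre p x u' * (pre p x u' - 1) + (pre p x v')\<^sup>2 < pre p x u * (pre p x u - 1) + (pre p x v)\<^sup>2"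
        if x: "x \<in> A" for x
      proof -
        obtain e where e: "pre p x v' = pre p x u + e"
          using step(6)[OF x] le_Suc_ex by fastforce
        then show ?thesis
          using step(6)[OF x] by (cases "pre p x u") (auto simp: power2_eq_square algebra_simps)
      qed
      then show False
        using no_better[OF L _ step(2,1) step(4,5)] step(3)[OF v(2)] step(7)
        by (simp add: add_mset_commute)
    qed
    moreover have "pre p k u \<le> Suc (pre p k v)"
    proof (rule ccontr)
      assume "\<not> ?thesis"
      then have "pre p k v + 2 \<le> pre p k u"
        by simp
      then obtain u' v' A where step: "in_cube n f u'" "in_cube n f v'"
        "\<And>L. set_mset L \<subseteq> perm_points n lam \<Longrightarrow> reaches (add_mset u (add_mset v L)) (add_mset u' (add_mset v' L))"
        "A \<subseteq> {..n}" "A \<noteq> {}"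
        "\<And>x. x \<in> A \<Longrightarrow> pre p x v + 2 \<le> pre p x u \<and> pre p x u = Suc (pre p x u') \<and> pre p x v' = Suc (pre p x v)"
        "\<And>x. x \<le> n \<Longrightarrow> x \<notin> A \<Longrightarrow> pre p x u' = pre p x u \<and> pre p x v' = pre p x v"
        using segment_step[OF G(1) v(1) p sorted v(4,3), of 2 k] k by (metis zero_less_numeral)
      \<comment> \<open>With d the lead of \<open>u\<close>, the potential drops by 2d - 3, so a
        lead of 1 is left in place.\<close>
      have "pre p x u' * (pre p x u' - 1) + (pre p x v')\<^sup>2 < pre p x u * (pre p x u - 1) + (pre p x v)\<^sup>2"
        if x: "x \<in> A" for x
      proof -
        obtain e where e: "pre p x u' = Suc (pre p x v + e)"
          using step(6)[OF x] by (metis Suc_le_mono add_2_eq_Suc' le_Suc_ex add_Suc)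
        then show ?thesis
          using step(6)[OF x] by (auto simp: power2_eq_square algebra_simps)
      qed
      then show False
        using no_better[OF L _ step(1,2) step(4,5)] step(3)[OF v(2)] step(7) by simp
    qed
    ultimately show "pre p k v \<le> pre p k u \<and> pre p k u \<le> Suc (pre p k v)" ..
  qed
qed

section \<open>Cancelling the dominant member\<close>

lemma pre_sum_mset: "pre p k (\<Sum>\<^sub># M) = (\<Sum>u\<in>#M. pre p k u)"
  by (induction M) (simp_all add: pre_def lookup_add sum.distrib)

text \<open>On \<open>add_mset u N\<close> all values of \<open>pre p k\<close> are
  \<open>pre p k u\<close> or one less, and \<open>u\<close> attains the larger value. So
  \<open>pre p k u\<close> is the average rounded up, a function of total and size; the proof
  compares the two sums directly instead of dividing.\<close>

lemma dominant_unique: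
  assumes "reaches M (add_mset u N)" "reaches M' (add_mset u' N')"
    and "\<Sum>\<^sub># M = \<Sum>\<^sub># M'" "size M = size M'"
    and "\<And>v. v \<in># N \<Longrightarrow> pre p k v \<le> pre p k u \<and> pre p k u \<le> Suc (pre p k v)"
    and "\<And>v. v \<in># N' \<Longrightarrow> pre p k v \<le> pre p k u' \<and> pre p k u' \<le> Suc (pre p k v)"
  shows "pre p k u \<le> pre p k u'"
proof (rule ccontr)
  assume "\<not> ?thesis"
  then have less: "Suc (pre p k u') \<le> pre p k u"
    by simp
  have sums: "pre p k u + (\<Sum>v\<in>#N. pre p k v) = pre p k u' + (\<Sum>v\<in>#N'. pre p k v)"
    using assms(1-3) arg_cong[of "\<Sum>\<^sub># (add_mset u N)" "\<Sum>\<^sub># (add_mset u' N')" "pre p k"]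
    unfolding pre_sum_mset by (simp add: reaches_def)
  have sizes: "size N = size N'"
    using assms(1,2,4) by (simp add: reaches_def)
  have "size N * pre p k u' \<le> (\<Sum>v\<in>#N. pre p k v)"
  proof (rule sum_mset_ge_bound)
    show "pre p k u' \<le> pre p k v" if "v \<in># N" for v
      using assms(5)[OF that] less by linarith
  qed
  moreover have "(\<Sum>v\<in>#N'. pre p k v) \<le> size N' * pre p k u'"
    using assms(6) by (intro sum_mset_le_bound) auto
  ultimately show False
    using sums less unfolding sizes by linarith
qed

theorem exchange_connected:
  assumes "set_mset M \<subseteq> perm_points n lam" "set_mset M' \<subseteq> perm_points n lam"
    and "\<Sum>\<^sub># M = \<Sum>\<^sub># M'" "size M = size M'"
  shows "E M M'"
  using assms
proof (induction "size M" arbitrary: M M')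
  case 0
  then show ?case
    by (auto intro: refl)
next
  case (Suc m)
  then have ne: "M \<noteq> {#}" "M' \<noteq> {#}"
    by auto
  define f where "f = (\<lambda>x. lookup (\<Sum>\<^sub># M) x div size M)"
  have f': "f = (\<lambda>x. lookup (\<Sum>\<^sub># M') x div size M')"
    using Suc.prems by (simp add: f_def)
  \<comment> \<open>One enumeration serves both multisets, since \<open>f\<close> depends only on
    the common total and size; only so can the partial sums of \<open>u\<close> and
    \<open>u'\<close> be compared.\<close>
  obtain p where p: "bij_betw p {..<n} {1..n}" and sorted: "\<And>s t. s \<le> t \<Longrightarrow> t < n \<Longrightarrow> f (p t) \<le> f (p s)"
    using ex_sorting_enum[of n f] by metis
  obtain u N where u: "reaches M (add_mset u N)"
    and dom: "\<And>k v. k \<le> n \<Longrightarrow> v \<in># N \<Longrightarrow> pre p k v \<le> pre p k u \<and> pre p k u \<le> Suc (pre p k v)"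
    using ex_dominant[OF Suc.prems(1) ne(1) f_def p sorted] by metis
  obtain u' N' where u': "reaches M' (add_mset u' N')"
    and dom': "\<And>k v. k \<le> n \<Longrightarrow> v \<in># N' \<Longrightarrow> pre p k v \<le> pre p k u' \<and> pre p k u' \<le> Suc (pre p k v)"
    using ex_dominant[OF Suc.prems(2) ne(2) f' p sorted] by metis
  have pre_eq: "pre p k u = pre p k u'" if "k \<le> n" for k
  proof (rule antisym)
    show "pre p k u \<le> pre p k u'"
      by (rule dominant_unique[OF u u' Suc.prems(3,4) dom dom']) (use that in auto)
    show "pre p k u' \<le> pre p k u"
      by (rule dominant_unique[OF u' u Suc.prems(3,4)[symmetric] dom' dom]) (use that in auto)
  qed
  have "u = u'"
  proof (rule poly_mapping_eq_on)
    show "keys u \<subseteq> {1..n}" "keys u' \<subseteq> {1..n}"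
      using u u' perm_points_keys by (auto simp: reaches_def)
    fix x assume "x \<in> {1..n}"
    then obtain q where q: "q < n" "x = p q"
      using p by (metis bij_betw_iff_bijections lessThan_iff)
    then show "lookup u x = lookup u' x"
      using pre_eq[of q] pre_eq[of "Suc q"] by (simp add: pre_def)
  qed
  moreover have "E N N'"
  proof (rule Suc.hyps(1))
    show "m = size N" "size N = size N'"
      using u u' Suc by (auto simp: reaches_def)
    show "set_mset N \<subseteq> perm_points n lam" "set_mset N' \<subseteq> perm_points n lam"
      using u u' by (auto simp: reaches_def)
    show "\<Sum>\<^sub># N = \<Sum>\<^sub># N'"
      using u u' Suc.prems(3) \<open>u = u'\<close> by (auto simp: reaches_def intro: add_left_imp_eq[of u'])
  qed
  ultimately have "E (add_mset u N) (add_mset u' N')"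
    using u by (auto simp: reaches_def intro: add)
  then show ?case
    using u u' unfolding reaches_def by (blast intro: trans sym)
qed

end

section \<open>Connecting monomials of the Rees algebra\<close>

text \<open>The lexicographic rank of the topmost box in column \<open>x\<close>, cf. \<^const>\<open>cost\<close>.\<close>

definition top_rank :: "nat \<Rightarrow> nat monomial \<Rightarrow> nat \<Rightarrow> nat" where
  "top_rank n u x = lookup u x * (n + 1) + x"

lemma rank_le_iff:
  fixes n :: nat
  assumes "x \<le> n" "y \<le> n"
  shows "a * (n + 1) + x \<le> b * (n + 1) + y \<longleftrightarrow> a < b \<or> a = b \<and> x \<le> y"
proof -
  have "a * (n + 1) + x < b * (n + 1) + y" if "a < b"
  proof -
    have "Suc a * (n + 1) \<le> b * (n + 1)"
      using that by (intro mult_right_mono) auto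
    then show ?thesis
      using assms by simp
  qed
  moreover have "b * (n + 1) + y < a * (n + 1) + x" if "b < a"
  proof -
    have "Suc b * (n + 1) \<le> a * (n + 1)"
      using that by (intro mult_right_mono) auto
    then show ?thesis
      using assms by simp
  qed
  ultimately show ?thesis
    by (cases a b rule: linorder_cases) auto
qed

lemma rank_eq_iff:
  fixes n :: nat
  assumes "x \<le> n" "y \<le> n"
  shows "a * (n + 1) + x = b * (n + 1) + y \<longleftrightarrow> a = b \<and> x = y"
  using rank_le_iff[of x n y a b] rank_le_iff[of y n x b a] assms by (metis order.antisym order.refl less_asym)

lemma sum_mset_mono_cross:
  fixes g :: "'b \<Rightarrow> nat"
  assumes "size M = size N" "\<And>u v. u \<in># M \<Longrightarrow> v \<in># N \<Longrightarrow> g u \<le> g v"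
  shows "(\<Sum>u\<in>#M. g u) \<le> (\<Sum>v\<in>#N. g v)"
proof (cases "M = {#}")
  case False
  define b where "b = Max (g ` set_mset M)"
  have "b \<in> g ` set_mset M"
    unfolding b_def using False by (intro Max_in) auto
  then have "size N * b \<le> (\<Sum>v\<in>#N. g v)"
    using assms(2) by (intro sum_mset_ge_bound) auto
  moreover have "(\<Sum>u\<in>#M. g u) \<le> size M * b"
    by (intro sum_mset_le_bound) (auto simp: b_def)
  ultimately show ?thesis
    using assms(1) by simp
qed simp

text \<open>\<open>F a M b N\<close> stands for membership of \<open>x^a T_M - x^b T_N\<close> in an
  ideal containing the relations. \<open>lin\<close> covers moves of the topmost box of
  \<open>r\<close>, which lies in column \<open>u_max\<close>, to the free place of column
  \<open>i\<close> if that has smaller rank; this is the condition \<open>x_i \<in> C(u)\<close> in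
  terms of ranks.\<close>

locale rees_congruence =
  fixes n :: nat and lam :: "nat monomial"
    and F :: "nat monomial \<Rightarrow> nat monomial multiset \<Rightarrow> nat monomial \<Rightarrow> nat monomial multiset \<Rightarrow> bool"
  assumes refl: "F a M a M"
    and sym: "F a M b N \<Longrightarrow> F b N a M"
    and trans: "F a L b M \<Longrightarrow> F b M c N \<Longrightarrow> F a L c N"
    and add: "F a M b N \<Longrightarrow> u \<in> perm_points n lam \<Longrightarrow> F a (add_mset u M) b (add_mset u N)"
    and shift: "F a M b N \<Longrightarrow> keys c \<subseteq> {1..n} \<Longrightarrow> F (c + a) M (c + b) N"
    and exch: "r \<in> perm_points n lam \<Longrightarrow> s \<in> perm_points n lam \<Longrightarrow> i \<in> {1..n} \<Longrightarrow> j \<in> {1..n} \<Longrightarrow>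
      lookup s i < lookup r i \<Longrightarrow> lookup r j < lookup s j \<Longrightarrow>
      swap_var r j i \<in> perm_points n lam \<Longrightarrow> swap_var s i j \<in> perm_points n lam \<Longrightarrow>
      F 0 {#r, s#} 0 {#swap_var r j i, swap_var s i j#}"
    and lin: "r \<in> perm_points n lam \<Longrightarrow> i \<in> {1..n} \<Longrightarrow> j \<in> {1..n} \<Longrightarrow> i \<noteq> j \<Longrightarrow>
      (\<And>x. x \<in> {1..n} \<Longrightarrow> top_rank n r x \<le> top_rank n r j) \<Longrightarrow>
      Suc (lookup r i) * (n + 1) + i < top_rank n r j \<Longrightarrow>
      F (single i 1) {#r#} (single j 1) {#swap_var r i j#}"
begin

lemma exchange_congruence:
  assumes "keys a \<subseteq> {1..n}"
  shows "exchange_congruence n lam (\<lambda>M N. F a M a N)"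
proof
  show "F a {#r, s#} a {#swap_var r j i, swap_var s i j#}"
    if "r \<in> perm_points n lam" "s \<in> perm_points n lam" "i \<in> {1..n}" "j \<in> {1..n}"
      "lookup s i < lookup r i" "lookup r j < lookup s j"
      "swap_var r j i \<in> perm_points n lam" "swap_var s i j \<in> perm_points n lam" for r s i j
    using shift[OF exch[OF that] assms] by simp
qed (blast intro: refl sym trans add)+

definition rreaches ::
  "nat monomial \<Rightarrow> nat monomial multiset \<Rightarrow> nat monomial \<Rightarrow> nat monomial multiset \<Rightarrow> bool" where
  "rreaches a M b N \<longleftrightarrow> F a M b N \<and> keys b \<subseteq> {1..n} \<and> set_mset N \<subseteq> perm_points n lam \<and>
     b + \<Sum>\<^sub># N = a + \<Sum>\<^sub># M \<and> size N = size M"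

lemma rreaches_trans: "rreaches a L b M \<Longrightarrow> rreaches b M c N \<Longrightarrow> rreaches a L c N"
  by (auto simp: rreaches_def intro: trans)

lemma add_union:
  assumes "F a M b N" "set_mset L \<subseteq> perm_points n lam"
  shows "F a (M + L) b (N + L)"
  using assms(2) by (induction L) (auto simp: assms(1) add)

text \<open>The monomial gives up \<open>x_i\<close> and receives \<open>x_j\<close>, while a box
  travels from column \<open>j\<close> to column \<open>i\<close>, so the product with all
  generators is unchanged. The cost drops by the difference of the two ranks.\<close>

lemma rreaches_lin:
  assumes a: "keys a \<subseteq> {1..n}" "0 < lookup a i"
    and r: "r \<in> perm_points n lam" and L: "set_mset L \<subseteq> perm_points n lam"
    and ij: "i \<in> {1..n}" "j \<in> {1..n}" "i \<noteq> j"
    and top: "\<And>x. x \<in> {1..n} \<Longrightarrow> top_rank n r x \<le> top_rank n r j"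
    and less: "Suc (lookup r i) * (n + 1) + i < top_rank n r j"
  shows "\<exists>b. rreaches a (add_mset r L) b (add_mset (swap_var r i j) L)"
    and "cost n (swap_var r i j) < cost n r"
proof -
  define c where "c = a - single i 1"
  have c: "keys c \<subseteq> {1..n}" "a = c + single i 1"
    using a by (auto simp: c_def in_keys_iff lookup_minus lookup_single lookup_add when_def subset_iff intro!: poly_mapping_eqI)
  have pos: "lookup r i < lookup r j"
    using less rank_le_iff[of i n j "Suc (lookup r i)" "lookup r j"] ij by (auto simp: top_rank_def)
  have "F (c + single i 1) ({#r#} + L) (c + single j 1) ({#swap_var r i j#} + L)"
    by (rule add_union[OF shift[OF lin[OF r ij top less] c(1)] L])
  moreover have "swap_var r i j \<in> perm_points n lam"
    using robin_hood[OF r ij(1,2) pos] .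
  moreover have "keys (c + single j 1) \<subseteq> {1..n}"
    using keys_add[of c "single j (1::nat)"] c(1) ij by auto
  moreover have "single j 1 + swap_var r i j = single i 1 + r"
    using swap_var_eq_iff[OF ij(3), of r "swap_var r i j"] pos by simp
  then have "c + single j 1 + (swap_var r i j + \<Sum>\<^sub># L) = c + single i 1 + (r + \<Sum>\<^sub># L)"
    by (metis add.assoc)
  ultimately have "rreaches a (add_mset r L) (c + single j 1) (add_mset (swap_var r i j) L)"
    using L by (simp add: rreaches_def c(2))
  then show "\<exists>b. rreaches a (add_mset r L) b (add_mset (swap_var r i j) L)" ..
  show "cost n (swap_var r i j) < cost n r"
    using cost_swap_var[of i n j r] ij pos less by (simp add: top_rank_def)
qed

text \<open>
  \<open>top_rank n u j\<close> is the threshold at which the exponents of \<open>a + \<Sum>\<^sub># M\<close> are cut off.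
\<close>

definition saturated :: "nat monomial \<Rightarrow> nat monomial multiset \<Rightarrow> nat monomial \<Rightarrow> nat \<Rightarrow> bool" where
  "saturated a M u j \<longleftrightarrow> j \<in> {1..n} \<and>
     (\<forall>v\<in>#M. \<forall>x\<in>{1..n}. top_rank n v x \<le> top_rank n u j) \<and>
     (\<forall>v\<in>#M. \<forall>x\<in>{1..n}. 0 < lookup a x \<longrightarrow> top_rank n u j \<le> Suc (lookup v x) * (n + 1) + x)"

text \<open>Take the topmost box of the whole multiset, in column \<open>j\<close> of
  \<open>u\<close>, and suppose a variable \<open>x\<close> dividing \<open>a\<close> could fill a
  lower place of some \<open>v\<close>. Only a generator carrying a topmost box can give it up, so
  if column \<open>x\<close> of \<open>u\<close> is higher than that of \<open>v\<close>, the two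
  are first exchanged at \<open>x\<close>. By balance this lowers the column to the height it has in
  \<open>v\<close>. The exchange does not raise the cost and leaves the topmost box alone, and a
  linear move then lowers the cost.\<close>

lemma min_cost_saturated:
  assumes M: "keys a \<subseteq> {1..n}" "set_mset M \<subseteq> perm_points n lam" "M \<noteq> {#}" and n: "0 < n"
    and min: "\<And>b N. rreaches a M b N \<Longrightarrow> (\<Sum>u\<in>#M. cost n u) \<le> (\<Sum>u\<in>#N. cost n u)"
  obtains u j where "saturated a M u j"
proof -
  interpret ex: exchange_congruence n lam "\<lambda>M N. F a M a N"
    by (rule exchange_congruence) fact
  have rr: "rreaches a M a N" if "ex.reaches M N" for N
    using that M by (simp add: rreaches_def ex.reaches_def)
  have bal: "balanced n M"
    using ex.min_cost_balanced[OF M(2)] min rr by blast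
  define K where "K = (\<lambda>(u, x). top_rank n u x) ` (set_mset M \<times> {1..n})"
  have K: "finite K" "K \<noteq> {}"
    using M n by (auto simp: K_def)
  obtain u j where u: "u \<in># M" and j: "j \<in> {1..n}" and uj: "top_rank n u j = Max K"
    using Max_in[OF K] by (force simp: K_def)
  have top: "top_rank n v x \<le> top_rank n u j" if "v \<in># M" "x \<in> {1..n}" for v x
    unfolding uj using K(1) that by (intro Max_ge) (auto simp: K_def)
  have "top_rank n u j \<le> Suc (lookup v x) * (n + 1) + x"
    if v: "v \<in># M" and x: "x \<in> {1..n}" and pos: "0 < lookup a x" for v x
  proof (rule ccontr)
    assume "\<not> ?thesis"
    then have less: "Suc (lookup v x) * (n + 1) + x < top_rank n u j"
      by simp
    have "lookup u j \<le> Suc (lookup v j)"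
      using bal u v j by (auto simp: balanced_def)
    then have "lookup u j * (n + 1) \<le> Suc (lookup v j) * (n + 1)"
      by (intro mult_right_mono) auto
    \<comment> \<open>By balance the topmost box of \<open>u\<close> is at most one level above
      column \<open>j\<close> of \<open>v\<close>, so the free place there is not below it.\<close>
    then have "x \<noteq> j"
      using less by (auto simp: top_rank_def)
    show False
    proof (cases "lookup u x \<le> lookup v x")
      case True
      obtain L where L: "M = add_mset u L"
        using u by (metis insert_DiffM)
      have "Suc (lookup u x) * (n + 1) \<le> Suc (lookup v x) * (n + 1)"
        using True by (intro mult_right_mono) auto
      then have "Suc (lookup u x) * (n + 1) + x < top_rank n u j"
        using less by simp
      then obtain b where "rreaches a M b (add_mset (swap_var u x j) L)" "cost n (swap_var u x j) < cost n u"
        using rreaches_lin[of a x u L j] M x j \<open>x \<noteq> j\<close> pos top u by (auto simp: L)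
      then show False
        using min[of b "add_mset (swap_var u x j) L"] by (simp add: L)
    next
      case False
      then have vx: "lookup v x < lookup u x"
        by simp
      then have "u \<noteq> v"
        by auto
      then obtain L where L: "M = add_mset u (add_mset v L)"
        using u v by (metis insert_DiffM insert_noteq_member)
      have G: "u \<in> perm_points n lam" "v \<in> perm_points n lam" "set_mset L \<subseteq> perm_points n lam"
        using M L by auto
      obtain k where k: "k \<in> {1..n}" "lookup u k < lookup v k"
        and mem: "swap_var u k x \<in> perm_points n lam" "swap_var v x k \<in> perm_points n lam"
        using symmetric_exchange[OF G(1,2) x vx] by metis
      let ?r = "swap_var u k x" and ?N = "add_mset (swap_var v x k) L"
      have N: "rreaches a M a (add_mset ?r ?N)"
        using rr ex.reaches_exch[OF G x k(1) vx k(2) mem] by (simp add: L)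
      have "top_rank n v j \<le> top_rank n u j"
        using top v j by blast
      \<comment> \<open>Column \<open>j\<close> of \<open>v\<close> is not higher than that of
        \<open>u\<close>, so the partner supplied by the exchange cannot be
        \<open>j\<close>.\<close>
      then have "k \<noteq> j"
        using k(2) rank_le_iff[of j n j] j by (auto simp: top_rank_def)
      have "k \<noteq> x"
        using k(2) vx by auto
      have rx: "lookup ?r x = lookup v x"
        using bal u v x vx \<open>k \<noteq> x\<close> by (force simp: balanced_def lookup_swap_var)
      have rj: "top_rank n ?r j = top_rank n u j"
        using \<open>k \<noteq> j\<close> \<open>x \<noteq> j\<close> by (simp add: top_rank_def lookup_swap_var)
      \<comment> \<open>Column \<open>k\<close> gains a box but stays within its height in
        \<open>v\<close>, whose boxes do not exceed the threshold either.\<close>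
      have rtop: "top_rank n ?r y \<le> top_rank n ?r j" if y: "y \<in> {1..n}" for y
      proof -
        have "lookup ?r y \<le> lookup u y \<or> lookup ?r y \<le> lookup v y"
          using k(2) by (auto simp: lookup_swap_var)
        then have "top_rank n ?r y \<le> top_rank n u y \<or> top_rank n ?r y \<le> top_rank n v y"
          unfolding top_rank_def by (metis add_le_mono1 mult_le_mono1)
        then show ?thesis
          using top[OF u y] top[OF v y] rj by auto
      qed
      have "Suc (lookup ?r x) * (n + 1) + x < top_rank n ?r j"
        using less rx rj by simp
      then obtain b where b: "rreaches a (add_mset ?r ?N) b (add_mset (swap_var ?r x j) ?N)"
        and c: "cost n (swap_var ?r x j) < cost n ?r"
        using rreaches_lin[of a x ?r ?N j] M x j \<open>x \<noteq> j\<close> pos rtop mem G by auto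
      show False
        using min[OF rreaches_trans[OF N b]] c cost_exchange(1)[OF x k(1) vx k(2)] by (simp add: L)
    qed
  qed
  then show thesis
    using that[of u j] j top by (auto simp: saturated_def)
qed

text \<open>If the variable \<open>x\<close> does not divide \<open>b\<close>, its exponent in the
  common product comes from \<open>N\<close> alone. If it does, the first free place of column
  \<open>x\<close> in every member of \<open>N\<close> is not below the larger threshold, whereas no
  box of \<open>M\<close> passes the smaller one. Only the threshold box itself can then be in
  \<open>M\<close> and missing in \<open>N\<close>, whence the exception for \<open>j\<close> at
  equal thresholds.\<close>

lemma saturated_mono:
  assumes s: "saturated a M u j" "saturated b N v k" and le: "top_rank n u j \<le> top_rank n v k"
    and eq: "a + \<Sum>\<^sub># M = b + \<Sum>\<^sub># N" "size M = size N"
    and x: "x \<in> {1..n}" "x \<noteq> j \<or> top_rank n u j \<noteq> top_rank n v k"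
  shows "lookup (\<Sum>\<^sub># M) x \<le> lookup (\<Sum>\<^sub># N) x"
proof (cases "lookup b x = 0")
  case True
  then show ?thesis
    using arg_cong[OF eq(1), of "\<lambda>w. lookup w x"] by (simp add: lookup_add)
next
  case False
  have "lookup r x \<le> lookup t x" if "r \<in># M" "t \<in># N" for r t
  proof (rule ccontr)
    assume "\<not> ?thesis"
    then have "Suc (lookup t x) * (n + 1) \<le> lookup r x * (n + 1)"
      by (intro mult_right_mono) auto
    moreover have "top_rank n r x \<le> top_rank n u j" "top_rank n v k \<le> Suc (lookup t x) * (n + 1) + x"
      using s that x(1) False by (auto simp: saturated_def)
    ultimately have "top_rank n r x = top_rank n u j" "top_rank n u j = top_rank n v k"
      using le by (auto simp: top_rank_def)
    then show False
      using x s rank_eq_iff[of x n j "lookup r x" "lookup u j"] by (auto simp: top_rank_def saturated_def)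
  qed
  then show ?thesis
    unfolding lookup_sum_mset using eq(2) by (intro sum_mset_mono_cross) auto
qed

text \<open>With different thresholds the totals compare coordinatewise, and their equal weights
  force equality. With equal thresholds every coordinate except \<open>j\<close> is compared both
  ways, and the weight fixes the remaining one.\<close>

lemma saturated_unique:
  assumes s: "saturated a M u j" "saturated b N v k"
    and le: "top_rank n u j \<le> top_rank n v k"
    and G: "set_mset M \<subseteq> perm_points n lam" "set_mset N \<subseteq> perm_points n lam"
    and eq: "a + \<Sum>\<^sub># M = b + \<Sum>\<^sub># N" "size M = size N"
  shows "\<Sum>\<^sub># M = \<Sum>\<^sub># N"
proof -
  let ?A = "lookup (\<Sum>\<^sub># M)" and ?B = "lookup (\<Sum>\<^sub># N)"
  have total: "(\<Sum>x=1..n. ?A x) = (\<Sum>x=1..n. ?B x)"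
    using weight_sum_mset[OF G(1)] weight_sum_mset[OF G(2)] eq(2) by (simp add: weight_def)
  have "?A x = ?B x" if x: "x \<in> {1..n}" for x
  proof (cases "top_rank n u j = top_rank n v k")
    case True
    have j: "j \<in> {1..n}"
      using s by (simp add: saturated_def)
    have "j = k"
      using True s rank_eq_iff[of j n k] by (auto simp: top_rank_def saturated_def)
    have other: "?A y = ?B y" if "y \<in> {1..n} - {j}" for y
      using saturated_mono[OF s le eq, of y] saturated_mono[OF s(2,1) _ eq[symmetric], of y] that True \<open>j = k\<close>
      by simp
    moreover have "?A j = ?B j"
      using total other sum.remove[of "{1..n}" j ?A] sum.remove[of "{1..n}" j ?B] j by simp
    ultimately show ?thesis
      using x by (cases "x = j") auto
  next
    case False
    then have "?A y \<le> ?B y" if "y \<in> {1..n}" for y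
      using saturated_mono[OF s le eq that] by blast
    then show ?thesis
      using sum_mono_inv[OF total _ x] by simp
  qed
  moreover have "?A x = ?B x" if "x \<notin> {1..n}" for x
  proof -
    have "lookup w x = 0" if "w \<in># M + N" for w
      using that G perm_points_keys[of w n lam] \<open>x \<notin> {1..n}\<close> by (fastforce simp: in_keys_iff)
    then show ?thesis
      by (simp add: lookup_sum_mset cong: image_mset_cong)
  qed
  ultimately show ?thesis
    by (metis poly_mapping_eqI)
qed

lemma ex_saturated:
  assumes "keys a \<subseteq> {1..n}" "set_mset M \<subseteq> perm_points n lam" "M \<noteq> {#}" "0 < n"
  obtains b N u j where "rreaches a M b N" "saturated b N u j"
proof -
  have "rreaches a M a M"
    using assms refl by (simp add: rreaches_def)
  then obtain x where x: "(\<lambda>(b, N). rreaches a M b N) x"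
    and min: "\<And>y. (\<lambda>(b, N). rreaches a M b N) y \<Longrightarrow> (\<Sum>u\<in>#snd x. cost n u) \<le> (\<Sum>u\<in>#snd y. cost n u)"
    using ex_has_least_nat[of "\<lambda>(b, N). rreaches a M b N" "(a, M)" "\<lambda>x. \<Sum>u\<in>#snd x. cost n u"] by auto
  obtain b N where bN: "x = (b, N)"
    by fastforce
  have r: "rreaches a M b N"
    using x by (simp add: bN)
  then have N: "keys b \<subseteq> {1..n}" "set_mset N \<subseteq> perm_points n lam" "N \<noteq> {#}"
    using assms(3) by (auto simp: rreaches_def)
  have "(\<Sum>u\<in>#N. cost n u) \<le> (\<Sum>u\<in>#N'. cost n u)" if "rreaches b N b' N'" for b' N'
    using min[of "(b', N')"] rreaches_trans[OF r that] by (simp add: bN)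
  then obtain u j where "saturated b N u j"
    using min_cost_saturated[OF N assms(4)] by metis
  then show thesis
    using that r by blast
qed

theorem rees_connected:
  assumes a: "keys a \<subseteq> {1..n}" "set_mset M \<subseteq> perm_points n lam"
    and b: "keys b \<subseteq> {1..n}" "set_mset N \<subseteq> perm_points n lam"
    and eq: "a + \<Sum>\<^sub># M = b + \<Sum>\<^sub># N" "size M = size N" and n: "0 < n"
  shows "F a M b N"
proof (cases "M = {#}")
  case True
  then show ?thesis
    using eq refl by simp
next
  case False
  then have "N \<noteq> {#}"
    using eq(2) by auto
  obtain a' M' u j where M': "rreaches a M a' M'" "saturated a' M' u j"
    using ex_saturated[OF a False n] .
  obtain b' N' v k where N': "rreaches b N b' N'" "saturated b' N' v k"
    using ex_saturated[OF b \<open>N \<noteq> {#}\<close> n] .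
  have G: "set_mset M' \<subseteq> perm_points n lam" "set_mset N' \<subseteq> perm_points n lam" "keys a' \<subseteq> {1..n}"
    and eq': "a' + \<Sum>\<^sub># M' = b' + \<Sum>\<^sub># N'" "size M' = size N'"
    using M'(1) N'(1) eq by (auto simp: rreaches_def)
  have sums: "\<Sum>\<^sub># M' = \<Sum>\<^sub># N'"
  proof (cases "top_rank n u j \<le> top_rank n v k")
    case True
    then show ?thesis
      using saturated_unique[OF M'(2) N'(2) _ G(1,2) eq'] by blast
  next
    case False
    then show ?thesis
      using saturated_unique[OF N'(2) M'(2) _ G(2,1) eq'[symmetric]] by simp
  qed
  interpret ex: exchange_congruence n lam "\<lambda>M N. F a' M a' N"
    by (rule exchange_congruence) fact
  have "a' = b'"
    using eq'(1) sums by simp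
  moreover have "F a' M' a' N'"
    using ex.exchange_connected[OF G(1,2) sums eq'(2)] .
  ultimately show ?thesis
    using M'(1) N'(1) unfolding rreaches_def by (blast intro: trans sym)
qed

end

section \<open>Sorted presentations of monomials\<close>

lemma ex_sorting_perm:
  fixes h :: "nat \<Rightarrow> nat"
  obtains sg where "sg permutes {1..n}" "\<And>k l. k \<in> {1..n} \<Longrightarrow> l \<in> {1..n} \<Longrightarrow> k \<le> l \<Longrightarrow> h (sg k) \<le> h (sg l)"
proof -
  obtain p where p: "bij_betw p {..<n} {1..n}" and s: "\<And>s t. s \<le> t \<Longrightarrow> t < n \<Longrightarrow> h (p t) \<le> h (p s)"
    using ex_sorting_enum[of n h] by metis
  define sg where "sg k = (if k \<in> {1..n} then p (n - k) else k)" for k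
  have "bij_betw (\<lambda>k. n - k) {1..n} {..<n}"
    by (rule bij_betw_byWitness[where f' = "\<lambda>k. n - k"]) auto
  then have "bij_betw (p \<circ> (\<lambda>k. n - k)) {1..n} {1..n}"
    using p by (rule bij_betw_trans)
  then have "bij_betw sg {1..n} {1..n}"
    by (rule bij_betw_cong[THEN iffD1, rotated]) (simp add: sg_def)
  then have "sg permutes {1..n}"
    by (rule bij_imp_permutes) (auto simp: sg_def)
  moreover have "h (sg k) \<le> h (sg l)" if "k \<in> {1..n}" "l \<in> {1..n}" "k \<le> l" for k l
    using s[of "n - l" "n - k"] that by (simp add: sg_def)
  ultimately show thesis
    using that by blast
qed

lemma lookup_perm_monomial:
  assumes sg: "sg permutes {1..n}" and k: "k \<in> {1..n}"
  shows "lookup (perm_monomial n sg mu) (sg k) = lookup mu k"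
proof -
  have "lookup (perm_monomial n sg mu) (sg k) = (\<Sum>l=1..n. if l = k then lookup mu l else 0)"
    unfolding perm_monomial_def lookup_sum
    using permutes_inj[OF sg] by (intro sum.cong) (auto simp: lookup_single when_def inj_def)
  then show ?thesis
    using k by simp
qed

lemma keys_perm_monomial:
  assumes "sg permutes {1..n}"
  shows "keys (perm_monomial n sg mu) \<subseteq> {1..n}"
proof -
  have "keys (perm_monomial n sg mu) \<subseteq> (\<Union>k\<in>{1..n}. keys (single (sg k) (lookup mu k)))"
    unfolding perm_monomial_def by (rule Poly_Mapping.keys_sum)
  then show ?thesis
    using permutes_in_image[OF assms] by (fastforce split: if_splits)
qed

lemma presentsI:
  assumes "mu \<in> partitions n" "sg permutes {1..n}" "keys u \<subseteq> {1..n}"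
    and "\<And>k. k \<in> {1..n} \<Longrightarrow> lookup u (sg k) = lookup mu k"
  shows "presents n u sg mu"
proof -
  have "u = perm_monomial n sg mu"
  proof (rule poly_mapping_eq_on)
    fix x assume "x \<in> {1..n}"
    then obtain k where "k \<in> {1..n}" "x = sg k"
      using permutes_image[OF assms(2)] by (metis imageE)
    then show "lookup u x = lookup (perm_monomial n sg mu) x"
      using assms(4) lookup_perm_monomial[OF assms(2)] by simp
  qed (use assms keys_perm_monomial in auto)
  then show ?thesis
    using assms by (simp add: presents_def)
qed

definition sorted_by :: "nat \<Rightarrow> (nat \<Rightarrow> nat) \<Rightarrow> nat monomial \<Rightarrow> nat monomial" where
  "sorted_by n sg u = (\<Sum>k=1..n. single k (lookup u (sg k)))"

lemma lookup_sorted_by: "lookup (sorted_by n sg u) k = (if k \<in> {1..n} then lookup u (sg k) else 0)"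
  by (simp add: sorted_by_def lookup_sum lookup_single when_def)

lemma sorted_by_partition:
  assumes "\<And>k l. k \<in> {1..n} \<Longrightarrow> l \<in> {1..n} \<Longrightarrow> k \<le> l \<Longrightarrow> lookup u (sg k) \<le> lookup u (sg l)"
  shows "sorted_by n sg u \<in> partitions n"
  using assms by (auto simp: partitions_def in_keys_iff lookup_sorted_by mono_on_def split: if_splits)

lemma presents_sorted_by:
  assumes "sg permutes {1..n}" "keys u \<subseteq> {1..n}"
    and "\<And>k l. k \<in> {1..n} \<Longrightarrow> l \<in> {1..n} \<Longrightarrow> k \<le> l \<Longrightarrow> lookup u (sg k) \<le> lookup u (sg l)"
  shows "presents n u sg (sorted_by n sg u)"
  using assms by (intro presentsI sorted_by_partition) (auto simp: lookup_sorted_by)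

text \<open>\<open>top_rank\<close> settles equal exponents in favour of the larger index, exactly
  as \<open>u_max\<close> does.\<close>

lemma u_max_eq:
  assumes "presents n r sg mu" and j: "j \<in> {1..n}"
    and top: "\<And>x. x \<in> {1..n} \<Longrightarrow> top_rank n r x \<le> top_rank n r j"
  shows "u_max n sg mu = j" "lookup mu n = lookup r j"
proof -
  have sg: "sg permutes {1..n}" and mu: "mu \<in> partitions n" and look: "\<And>k. k \<in> {1..n} \<Longrightarrow> lookup r (sg k) = lookup mu k"
    using assms(1) lookup_perm_monomial by (auto simp: presents_def)
  have le: "lookup r x < lookup r j \<or> lookup r x = lookup r j \<and> x \<le> j" if "x \<in> {1..n}" for x
    using top[OF that] rank_le_iff[of x n j] that j by (auto simp: top_rank_def)
  obtain l where l: "l \<in> {1..n}" "j = sg l"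
    using permutes_image[OF sg] j by (metis imageE)
  have "lookup mu l \<le> lookup mu n"
    using mu l by (auto simp: partitions_def mono_on_def)
  moreover have "lookup mu n \<le> lookup r j"
    using le[of "sg n"] look[of n] permutes_in_image[OF sg, of n] j by fastforce
  ultimately show eq: "lookup mu n = lookup r j"
    using look[OF l(1)] l(2) by simp
  show "u_max n sg mu = j"
    unfolding u_max_def
  proof (rule Max_eqI)
    show "j \<in> {sg k |k. k \<in> {1..n} \<and> lookup mu k = lookup mu n}"
      using l look eq by auto
    show "y \<le> j" if y: "y \<in> {sg k |k. k \<in> {1..n} \<and> lookup mu k = lookup mu n}" for y
    proof -
      obtain k where k: "y = sg k" "k \<in> {1..n}" "lookup mu k = lookup mu n"
        using y by blast
      then have "y \<in> {1..n}"
        using permutes_in_image[OF sg] by blast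
      then show ?thesis
        using le[of y] look[of k] k eq by simp
    qed
  qed simp
qed

section \<open>Linear moves as the relations given by \<open>C(u)\<close>\<close>

lemma card_initial_segment_ge:
  fixes S :: "nat set"
  assumes "finite S" "\<And>x. 1 \<le> x \<Longrightarrow> x \<le> k \<Longrightarrow> x \<in> S"
  shows "k \<le> card S"
  using card_mono[of S "{1..k}"] assms by (simp add: subset_iff)

lemma card_below_less:
  fixes S :: "nat set"
  assumes "S \<subseteq> {1..n}" "\<And>x. x \<in> S \<Longrightarrow> x < k"
  shows "card S < k \<or> k = 0"
proof -
  have "S \<subseteq> {1..<k}"
    using assms by force
  then show ?thesis
    using card_mono[of "{1..<k}" S] by auto
qed

text \<open>
  The presentation of \<open>r\<close> puts \<open>i\<close> last and \<open>j\<close> first among the indices with the same exponent;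
  then the same permutation still sorts \<open>swap_var r i j\<close>, unless the two exponents differ by one.
\<close>

lemma linear_move_presentation:
  assumes keys: "keys r \<subseteq> {1..n}" and ij: "i \<in> {1..n}" "j \<in> {1..n}" "i \<noteq> j"
    and top: "\<And>x. x \<in> {1..n} \<Longrightarrow> top_rank n r x \<le> top_rank n r j"
    and less: "Suc (lookup r i) * (n + 1) + i < top_rank n r j"
  obtains sg mu k where "presents n r sg mu" "u_max n sg mu = j" "prec n (swap_var r i j) r"
    "i = sg k" "k \<in> {1..p_index n mu} \<or> k \<in> {p_index n mu + 1..n - r_index n mu} \<and> sg k < u_max n sg mu"
proof -
  have cases: "Suc (lookup r i) < lookup r j \<or> Suc (lookup r i) = lookup r j \<and> i < j"
    using less rank_le_iff[of j n i "lookup r j" "Suc (lookup r i)"] ij by (auto simp: top_rank_def)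
  \<comment> \<open>The corrections 0, 1 and 2 stay below the factor 3, so they only order equal
    exponents.\<close>
  define h where "h x = 3 * lookup r x + (if x = i then 2 else if x = j then 0 else 1)" for x
  obtain sg where sg: "sg permutes {1..n}"
    and sorted: "\<And>k l. k \<in> {1..n} \<Longrightarrow> l \<in> {1..n} \<Longrightarrow> k \<le> l \<Longrightarrow> h (sg k) \<le> h (sg l)"
    using ex_sorting_perm[of n h] by metis
  define mu where "mu = sorted_by n sg r"
  have inj: "sg k = sg l \<longleftrightarrow> k = l" for k l
    using permutes_inj[OF sg] by (auto simp: inj_def)
  have h_le: "lookup r x \<le> lookup r y" if "h x \<le> h y" for x y
    using that by (auto simp: h_def split: if_splits)
  have pres: "presents n r sg mu"
    unfolding mu_def using sg keys h_le sorted by (intro presents_sorted_by) blast+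
  have mu: "lookup mu k = lookup r (sg k)" if "k \<in> {1..n}" for k
    using that unfolding mu_def lookup_sorted_by by simp
  have mono: "lookup mu k \<le> lookup mu l" if "k \<in> {1..n}" "l \<in> {1..n}" "k \<le> l" for k l
    using mu that h_le sorted by simp
  note umax = u_max_eq[OF pres ij(2) top]
  obtain k where k: "k \<in> {1..n}" "i = sg k"
    using permutes_image[OF sg] ij by (metis imageE)
  obtain l where l: "l \<in> {1..n}" "j = sg l"
    using permutes_image[OF sg] ij by (metis imageE)
  have kl: "k < l"
    using cases mono[OF l(1) k(1)] mu[OF k(1)] mu[OF l(1)] k l by (cases "k < l") auto
  let ?v = "swap_var r i j"
  have vkeys: "keys ?v \<subseteq> {1..n}"
    using keys_swap_var[of r i j] keys ij by auto
  have "prec n ?v r"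
  proof (cases "Suc (lookup r i) < lookup r j")
    case True
    \<comment> \<open>The unit moves from position \<open>l\<close> to the smaller position
      \<open>k\<close> of the sorted vector; the first change is a gain, which places
      \<open>?m\<close> before \<open>mu\<close>.\<close>
    let ?m = "swap_var mu k l"
    have m: "lookup ?m q = lookup ?v (sg q)" if "q \<in> {1..n}" for q
      using that mu[of q] by (simp add: lookup_swap_var inj k(2) l(2))
    have "mono_on {1..n} (lookup ?m)"
    proof (rule mono_onI)
      fix q t assume qt: "q \<in> {1..n}" "t \<in> {1..n}" "q \<le> t"
      have "h (sg q) \<le> h (sg t)"
        using sorted qt by simp
      then have "lookup ?v (sg q) \<le> lookup ?v (sg t) \<or> q = t"
        using True ij(3) inj[of q t] by (auto simp: lookup_swap_var h_def split: if_splits)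
      then show "lookup ?m q \<le> lookup ?m t"
        using m qt by auto
    qed
    moreover have "keys ?m \<subseteq> {1..n}"
      using keys_swap_var[of mu k l] pres k(1) by (auto simp: presents_def partitions_def)
    ultimately have "presents n ?v sg ?m"
      using sg vkeys m by (intro presentsI) (auto simp: partitions_def)
    moreover have "weight n ?m = weight n mu"
      using excess_swap_var[of k n l 0 mu] k(1) l kl mu[OF l(1)] True by (simp add: excess_0)
    moreover have "leftmost_pos n ?m mu"
      unfolding leftmost_pos_def
    proof (intro bexI conjI ballI)
      show "lookup mu k < lookup ?m k"
        using kl by (simp add: lookup_swap_var)
      show "lookup ?m q = lookup mu q" if "q \<in> {1..<k}" for q
        using that kl by (simp add: lookup_swap_var)
    qed (rule k(1))
    moreover have "lookup ?m k \<noteq> lookup mu k"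
      using kl by (simp add: lookup_swap_var)
    then have "?m \<noteq> mu"
      by auto
    moreover have "lookup ?v i \<noteq> lookup r i"
      using ij(3) by (simp add: lookup_swap_var)
    then have "?v \<noteq> r"
      by auto
    ultimately show ?thesis
      using pres unfolding prec_def by blast
  next
    case False
    then have ij': "Suc (lookup r i) = lookup r j" "i < j"
      using cases by auto
    \<comment> \<open>Exponents differing by one are merely interchanged. The sorted vector stays
      \<open>mu\<close>, and i < j decides the comparison of the exponent vectors
      themselves.\<close>
    define ta where "ta = Transposition.transpose i j \<circ> sg"
    have "ta permutes {1..n}"
      unfolding ta_def using sg permutes_swap_id[OF ij(1,2)] by (rule permutes_compose)
    moreover have "lookup ?v (Transposition.transpose i j x) = lookup r x" for x
      using ij'(1) ij(3) by (auto simp: lookup_swap_var Transposition.transpose_def)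
    then have "lookup ?v (ta q) = lookup mu q" if "q \<in> {1..n}" for q
      using mu[OF that] by (simp add: ta_def)
    ultimately have "presents n ?v ta mu"
      using pres vkeys by (intro presentsI) (auto simp: presents_def)
    moreover have "leftmost_pos n ?v r"
      unfolding leftmost_pos_def
    proof (intro bexI conjI ballI)
      show "lookup r i < lookup ?v i"
        using ij(3) by (simp add: lookup_swap_var)
      show "lookup ?v q = lookup r q" if "q \<in> {1..<i}" for q
        using that ij' by (simp add: lookup_swap_var)
    qed (rule ij(1))
    moreover have "lookup ?v i \<noteq> lookup r i"
      using ij(3) by (simp add: lookup_swap_var)
    then have "?v \<noteq> r"
      by auto
    ultimately show ?thesis
      using pres unfolding prec_def by blast
  qed
  \<comment> \<open>The two cases are the two parts of \<open>C(u)\<close>: exponent at most the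
    maximum minus 2, or the maximum minus 1 together with i < j. As \<open>mu\<close> is monotone,
    \<open>p_index\<close> and \<open>r_index\<close> are the lengths of an initial and a final
    segment of positions.\<close>
  moreover have "k \<in> {1..p_index n mu} \<or> k \<in> {p_index n mu + 1..n - r_index n mu} \<and> sg k < u_max n sg mu"
  proof (cases "Suc (lookup r i) < lookup r j")
    case True
    have "k \<le> p_index n mu"
      unfolding p_index_def
    proof (rule card_initial_segment_ge)
      fix x assume "1 \<le> x" "x \<le> k"
      then show "x \<in> {k \<in> {1..n}. int (lookup mu k) < int (lookup mu n) - 1}"
        using mono[of x k] k mu[OF k(1)] True umax(2) by auto
    qed simp
    then show ?thesis
      using k(1) by auto
  next
    case False
    then have ij': "Suc (lookup r i) = lookup r j" "i < j"
      using cases by auto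
    have "p_index n mu < k \<or> k = 0"
      unfolding p_index_def
    proof (rule card_below_less)
      fix x assume x: "x \<in> {k \<in> {1..n}. int (lookup mu k) < int (lookup mu n) - 1}"
      then have "lookup mu x < lookup mu k"
        using k mu[OF k(1)] ij' umax(2) by auto
      then show "x < k"
        using mono[of k x] k x by (cases "x < k") auto
    qed auto
    moreover have "r_index n mu \<le> n - k"
    proof -
      have "{x \<in> {1..n}. lookup mu x = lookup mu n} \<subseteq> {k<..n}"
      proof
        fix x assume x: "x \<in> {x \<in> {1..n}. lookup mu x = lookup mu n}"
        then have "lookup mu k < lookup mu x"
          using k mu[OF k(1)] ij' umax(2) by auto
        then show "x \<in> {k<..n}"
          using mono[of x k] k x by (cases "k < x") auto
      qed
      from card_mono[OF _ this] show ?thesis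
        by (simp add: r_index_def)
    qed
    ultimately show ?thesis
      using k ij' umax(1) by auto
  qed
  ultimately show thesis
    using that pres umax(1) k(2) by blast
qed

section \<open>Subrings and their ideals\<close>

definition is_subring :: "'a::comm_ring_1 set \<Rightarrow> bool" where
  "is_subring A \<longleftrightarrow> 0 \<in> A \<and> 1 \<in> A \<and> (\<forall>x\<in>A. - x \<in> A) \<and> (\<forall>x\<in>A. \<forall>y\<in>A. x + y \<in> A \<and> x * y \<in> A)"

lemma is_subring_mult: "is_subring A \<Longrightarrow> x \<in> A \<Longrightarrow> y \<in> A \<Longrightarrow> x * y \<in> A"
  by (simp add: is_subring_def)

lemma is_subring_diff:
  assumes "is_subring A" "x \<in> A" "y \<in> A"
  shows "x - y \<in> A"
proof -
  have "x + - y \<in> A"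
    using assms unfolding is_subring_def by blast
  then show ?thesis
    by simp
qed

lemma ring_on_simps [simp]:
  "carrier (ring_on A) = A" "mult (ring_on A) = (*)" "one (ring_on A) = 1"
  "zero (ring_on A) = 0" "add (ring_on A) = (+)"
  by (simp_all add: ring_on_def)

lemma cring_ring_on:
  assumes "is_subring A"
  shows "cring (ring_on A)"
proof (rule cringI)
  show "abelian_group (ring_on A)"
  proof (rule abelian_groupI)
    show "\<exists>y\<in>carrier (ring_on A). y \<oplus>\<^bsub>ring_on A\<^esub> x = \<zero>\<^bsub>ring_on A\<^esub>" if "x \<in> carrier (ring_on A)" for x
      using assms that by (auto simp: is_subring_def intro!: bexI[of _ "- x"])
  qed (use assms in \<open>auto simp: is_subring_def add_ac\<close>)
  show "Group.comm_monoid (ring_on A)"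
    by (rule comm_monoidI) (use assms in \<open>auto simp: is_subring_def mult_ac\<close>)
qed (auto simp: distrib_right)

text \<open>The ideals of \<open>ring_on A\<close> in terms of the type class operations; closure
  under negation comes from multiplication by \<open>- 1\<close>.\<close>

definition ideal_of :: "'a::comm_ring_1 set \<Rightarrow> 'a set \<Rightarrow> bool" where
  "ideal_of A J \<longleftrightarrow> J \<subseteq> A \<and> 0 \<in> J \<and> (\<forall>x\<in>J. \<forall>y\<in>J. x + y \<in> J) \<and> (\<forall>a\<in>A. \<forall>x\<in>J. a * x \<in> J)"

lemma ideal_ring_on_iff:
  assumes A: "is_subring A"
  shows "ideal J (ring_on A) \<longleftrightarrow> ideal_of A J"
proof
  interpret R: cring "ring_on A"
    by (rule cring_ring_on) fact
  assume "ideal J (ring_on A)"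
  then interpret ideal J "ring_on A" .
  show "ideal_of A J"
    unfolding ideal_of_def
    using a_subset zero_closed a_closed I_l_closed by simp
next
  interpret R: cring "ring_on A"
    by (rule cring_ring_on) fact
  assume J: "ideal_of A J"
  have neg: "- x \<in> J" if "x \<in> J" for x
  proof -
    have "- 1 \<in> A"
      using A by (simp add: is_subring_def)
    then have "- 1 * x \<in> J"
      using J that unfolding ideal_of_def by blast
    then show ?thesis
      by simp
  qed
  have minus: "\<ominus>\<^bsub>ring_on A\<^esub> x = - x" if "x \<in> A" for x
    using A that R.minus_equality[of "- x" x] by (simp add: is_subring_def)
  show "ideal J (ring_on A)"
  proof (rule idealI)
    show "subgroup J (add_monoid (ring_on A))"
    proof (rule R.add.subgroupI)
      show "\<ominus>\<^bsub>ring_on A\<^esub> x \<in> J" if "x \<in> J" for x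
        using that J minus[of x] neg[of x] by (auto simp: ideal_of_def)
    qed (use J in \<open>auto simp: ideal_of_def\<close>)
    fix a x assume "a \<in> J" "x \<in> carrier (ring_on A)"
    then have "x * a \<in> J"
      using J by (simp add: ideal_of_def)
    then show "x \<otimes>\<^bsub>ring_on A\<^esub> a \<in> J" "a \<otimes>\<^bsub>ring_on A\<^esub> x \<in> J"
      by (simp_all add: mult.commute)
  qed (rule R.ring_axioms)
qed

text \<open>Turns membership in a generated ideal into membership in an arbitrary ideal
  \<open>J\<close> above the generators, modulo which the congruences are then formed.\<close>

lemma genideal_ring_on:
  assumes "is_subring A"
  shows "genideal (ring_on A) X = \<Inter> {J. ideal_of A J \<and> X \<subseteq> J}"
  using ideal_ring_on_iff[OF assms] by (simp add: genideal_def)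

lemma ideal_of_diff: "is_subring A \<Longrightarrow> ideal_of A J \<Longrightarrow> x \<in> J \<Longrightarrow> y \<in> J \<Longrightarrow> x - y \<in> J"
proof -
  assume A: "is_subring A" "ideal_of A J" "x \<in> J" "y \<in> J"
  then have "- 1 * y \<in> J"
    unfolding ideal_of_def is_subring_def by blast
  then have "x + - 1 * y \<in> J"
    using A unfolding ideal_of_def by blast
  then show ?thesis
    by simp
qed

lemma ideal_of_sum: "ideal_of A J \<Longrightarrow> (\<And>x. x \<in> X \<Longrightarrow> f x \<in> J) \<Longrightarrow> sum f X \<in> J"
  by (induction X rule: infinite_finite_induct) (auto simp: ideal_of_def)

lemma ideal_of_genideal:
  assumes "is_subring A" "X \<subseteq> A"
  shows "ideal_of A (genideal (ring_on A) X)"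
proof -
  interpret cring "ring_on A"
    by (rule cring_ring_on) fact
  show ?thesis
    using genideal_ideal[of X] assms by (simp add: ideal_ring_on_iff)
qed

text \<open>Choose one representative per fibre of \<open>g\<close>. Replacing every
  \<open>e k\<close> by the value at its representative changes the sum by an element of
  \<open>J\<close>, and what remains vanishes because the coefficients in each fibre add up to
  0.\<close>

lemma fibre_sum_in_ideal:
  fixes c e :: "'i \<Rightarrow> 'a::comm_ring_1"
  assumes X: "finite X" and J: "ideal_of A J"
    and ident: "\<And>k l. k \<in> X \<Longrightarrow> l \<in> X \<Longrightarrow> g k = g l \<Longrightarrow> c k * (e k - e l) \<in> J"
    and zero: "\<And>w. (\<Sum>k\<in>{k\<in>X. g k = w}. c k) = 0"
  shows "(\<Sum>k\<in>X. c k * e k) \<in> J"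
proof -
  define r where "r w = (SOME k. k \<in> X \<and> g k = w)" for w
  have r: "r (g k) \<in> X \<and> g (r (g k)) = g k" if "k \<in> X" for k
    unfolding r_def by (rule someI[of _ k]) (use that in simp)
  have "(\<Sum>k\<in>X. c k * e k) = (\<Sum>k\<in>X. c k * (e k - e (r (g k)))) + (\<Sum>k\<in>X. c k * e (r (g k)))"
    by (simp add: sum.distrib[symmetric] algebra_simps)
  also have "(\<Sum>k\<in>X. c k * e (r (g k))) = (\<Sum>w\<in>g ` X. \<Sum>k\<in>{k\<in>X. g k = w}. c k * e (r (g k)))"
    by (rule sum.group[symmetric]) (use X in auto)
  also have "\<dots> = (\<Sum>w\<in>g ` X. (\<Sum>k\<in>{k\<in>X. g k = w}. c k) * e (r w))"
    unfolding sum_distrib_right by (intro sum.cong) auto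
  also have "\<dots> = 0"
    by (simp add: zero)
  finally show ?thesis
    using ideal_of_sum[OF J, of X "\<lambda>k. c k * (e k - e (r (g k)))"] ident r by simp
qed

section \<open>Polynomials and evaluation\<close>

lemma mp_monom_add: "mp_monom (m + m') = mp_monom m * (mp_monom m' :: ('v, 'a::comm_semiring_1) mpoly)"
  by (simp add: mp_monom_def mult_single)

lemma mp_const_mult: "mp_const (a * b) = mp_const a * (mp_const b :: ('v, 'a::comm_semiring_1) mpoly)"
  by (simp add: mp_const_def mult_single)

lemma mp_const_add: "mp_const (a + b) = mp_const a + (mp_const b :: ('v, 'a::comm_semiring_1) mpoly)"
  by (simp add: mp_const_def single_add)

lemma mp_const_0 [simp]: "mp_const 0 = 0"
  by (simp add: mp_const_def)

lemma mp_const_1 [simp]: "mp_const 1 = (1 :: ('v, 'a::comm_semiring_1) mpoly)"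
  by (simp add: mp_const_def)

lemma mp_monom_0 [simp]: "mp_monom 0 = (1 :: ('v, 'a::comm_semiring_1) mpoly)"
  by (simp add: mp_monom_def)

lemma mp_const_sum: "mp_const (sum f X) = (\<Sum>x\<in>X. mp_const (f x) :: ('v, 'a::comm_semiring_1) mpoly)"
  by (induction X rule: infinite_finite_induct) (simp_all add: mp_const_add)

lemma mp_const_times_monom: "mp_const c * mp_monom m = (single m c :: ('v, 'a::comm_semiring_1) mpoly)"
  by (simp add: mp_const_def mp_monom_def mult_single)

lemma mpoly_sum_single: "q = (\<Sum>m\<in>keys q. single m (lookup q m))"
  by (rule poly_mapping_eqI) (simp add: lookup_sum lookup_single when_def in_keys_iff)

definition poly_carrier :: "'a::comm_ring_1 set \<Rightarrow> 'v set \<Rightarrow> ('v, 'a) mpoly set" where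
  "poly_carrier A V = {q. \<forall>m\<in>keys q. lookup q m \<in> A \<and> keys m \<subseteq> V}"

lemma mpoly_ring_eq: "mpoly_ring A V = ring_on (poly_carrier A V)"
  by (simp add: mpoly_ring_def poly_carrier_def)

lemma poly_carrier_add:
  assumes A: "is_subring A" and pq: "p \<in> poly_carrier A V" "q \<in> poly_carrier A V"
  shows "p + q \<in> poly_carrier A V"
proof -
  have "lookup (p + q) m \<in> A \<and> keys m \<subseteq> V" if m: "m \<in> keys (p + q)" for m
  proof
    have "lookup r m \<in> A" if "r \<in> {p, q}" for r
      using that pq A by (cases "m \<in> keys r") (auto simp: poly_carrier_def is_subring_def in_keys_iff)
    then show "lookup (p + q) m \<in> A"
      using A by (simp add: lookup_add is_subring_def)
    show "keys m \<subseteq> V"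
      using m keys_add[of p q] pq by (auto simp: poly_carrier_def)
  qed
  then show ?thesis
    by (simp add: poly_carrier_def)
qed

lemma poly_carrier_single: "c \<in> A \<Longrightarrow> keys m \<subseteq> V \<Longrightarrow> single m c \<in> poly_carrier A V"
  by (auto simp: poly_carrier_def)

lemma poly_carrier_sum:
  assumes "is_subring A" "\<And>x. x \<in> X \<Longrightarrow> f x \<in> poly_carrier A V"
  shows "sum f X \<in> poly_carrier A V"
  using assms(2)
  by (induction X rule: infinite_finite_induct) (auto simp: poly_carrier_add[OF assms(1)], auto simp: poly_carrier_def)

lemma is_subring_poly_carrier:
  assumes A: "is_subring A"
  shows "is_subring (poly_carrier A V)"
  unfolding is_subring_def
proof (intro conjI ballI)
  show "0 \<in> poly_carrier A V"
    by (simp add: poly_carrier_def)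
  show "1 \<in> poly_carrier A V"
    using poly_carrier_single[of 1 A 0 V] A by (simp add: is_subring_def)
  show "- p \<in> poly_carrier A V" if "p \<in> poly_carrier A V" for p
    using that A by (simp add: poly_carrier_def is_subring_def in_keys_iff)
  fix p q assume pq: "p \<in> poly_carrier A V" "q \<in> poly_carrier A V"
  then show "p + q \<in> poly_carrier A V"
    by (rule poly_carrier_add[OF A])
  have "p * q = (\<Sum>m\<in>keys p. \<Sum>m'\<in>keys q. single (m + m') (lookup p m * lookup q m'))"
    by (subst mpoly_sum_single[of p], subst mpoly_sum_single[of q]) (simp add: sum_product mult_single)
  also have "\<dots> \<in> poly_carrier A V"
    using pq A by (intro poly_carrier_sum poly_carrier_single)
      (auto simp: poly_carrier_def is_subring_def dest!: subsetD[OF keys_add])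
  finally show "p * q \<in> poly_carrier A V" .
qed

lemma is_subring_UNIV [simp]: "is_subring UNIV"
  by (simp add: is_subring_def)

definition mon_eval :: "('v \<Rightarrow> 'b::comm_semiring_1) \<Rightarrow> 'v monomial \<Rightarrow> 'b" where
  "mon_eval f m = (\<Prod>v\<in>keys m. f v ^ lookup m v)"

lemma mon_eval_superset:
  assumes "finite V" "keys m \<subseteq> V"
  shows "mon_eval f m = (\<Prod>v\<in>V. f v ^ lookup m v)"
  unfolding mon_eval_def using assms by (intro prod.mono_neutral_left) (auto simp: in_keys_iff)

lemma mon_eval_add: "mon_eval f (m + m') = mon_eval f m * mon_eval f m'"
proof -
  let ?V = "keys m \<union> keys m'"
  have "mon_eval f (m + m') = (\<Prod>v\<in>?V. f v ^ lookup (m + m') v)"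
    using keys_add[of m m'] by (intro mon_eval_superset) auto
  also have "\<dots> = (\<Prod>v\<in>?V. f v ^ lookup m v) * (\<Prod>v\<in>?V. f v ^ lookup m' v)"
    by (simp add: lookup_add power_add prod.distrib)
  also have "\<dots> = mon_eval f m * mon_eval f m'"
    by (subst (1 2) mon_eval_superset[of ?V]) auto
  finally show ?thesis .
qed

lemma mp_eval_superset:
  assumes "finite X" "keys q \<subseteq> X" "h 0 = 0"
  shows "mp_eval h f q = (\<Sum>m\<in>X. h (lookup q m) * mon_eval f m)"
  unfolding mp_eval_def mon_eval_def using assms
  by (intro sum.mono_neutral_left) (auto simp: in_keys_iff)

text \<open>The embeddings of \<open>K\<close> in \<open>R\<close> and of \<open>R\<close> in
  \<open>R[t]\<close> are both instances, so evaluation is shown to be multiplicative once for the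
  toric and the Rees map.\<close>

locale coeff_hom =
  fixes h :: "'a::comm_ring_1 \<Rightarrow> 'b::comm_ring_1"
  assumes hom_0: "h 0 = 0" and hom_1: "h 1 = 1"
    and hom_add: "h (a + b) = h a + h b" and hom_mult: "h (a * b) = h a * h b"
begin

lemma mp_eval_single: "mp_eval h f (single m c) = h c * mon_eval f m"
  by (subst mp_eval_superset[of "{m}"]) (auto simp: hom_0)

lemma mp_eval_monom: "mp_eval h f (mp_monom m) = mon_eval f m"
  by (simp add: mp_monom_def mp_eval_single hom_1)

lemma mp_eval_0: "mp_eval h f 0 = 0"
  by (simp add: mp_eval_def)

lemma mp_eval_add: "mp_eval h f (p + q) = mp_eval h f p + mp_eval h f q"
proof -
  let ?X = "keys p \<union> keys q"
  have "mp_eval h f r = (\<Sum>m\<in>?X. h (lookup r m) * mon_eval f m)" if "r \<in> {p, q, p + q}" for r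
    using that keys_add[of p q] by (intro mp_eval_superset) (auto simp: hom_0)
  then show ?thesis
    by (simp add: lookup_add hom_add distrib_right sum.distrib)
qed

lemma mp_eval_sum: "mp_eval h f (sum g X) = (\<Sum>x\<in>X. mp_eval h f (g x))"
  by (induction X rule: infinite_finite_induct) (simp_all add: mp_eval_0 mp_eval_add)

lemma mp_eval_mult: "mp_eval h f (p * q) = mp_eval h f p * mp_eval h f q"
proof -
  have *: "mp_eval h f (p * q)
      = (\<Sum>m\<in>keys p. \<Sum>m'\<in>keys q. mp_eval h f (single m (lookup p m)) * mp_eval h f (single m' (lookup q m')))"
    by (subst mpoly_sum_single[of p], subst mpoly_sum_single[of q])
      (simp add: sum_product mult_single mp_eval_sum mp_eval_single mon_eval_add hom_mult mult_ac)
  have eval: "mp_eval h f r = (\<Sum>m\<in>keys r. mp_eval h f (single m (lookup r m)))" for r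
    by (subst (1) mpoly_sum_single[of r]) (simp add: mp_eval_sum)
  show ?thesis
    unfolding * sum_product[symmetric] by (simp add: eval[symmetric])
qed

lemma mp_eval_diff: "mp_eval h f (p - q) = mp_eval h f p - mp_eval h f q"
  using mp_eval_add[of f "p - q" q] by simp

lemma ideal_of_kernel:
  assumes "is_subring A"
  shows "ideal_of A {q \<in> A. mp_eval h f q = 0}"
  using assms by (auto simp: ideal_of_def is_subring_def mp_eval_0 mp_eval_add mp_eval_mult)

end

lemma coeff_hom_mp_const: "coeff_hom (mp_const :: 'a::comm_ring_1 \<Rightarrow> ('v, 'a) mpoly)"
  by unfold_locales (simp_all add: mp_const_add mp_const_mult)

lemma coeff_hom_pCons: "coeff_hom (\<lambda>c :: 'a::comm_ring_1. [:c:])"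
  by unfold_locales (simp_all add: one_pCons)

section \<open>Monomials as multisets\<close>

text \<open>Reads a monomial in the variables \<open>T_m\<close> as a multiset of generators, the
  form in which connectivity is stated.\<close>

definition mset_of :: "'v monomial \<Rightarrow> 'v multiset" where
  "mset_of m = Abs_multiset (lookup m)"

lemma count_mset_of [simp]: "count (mset_of m) = lookup m"
  unfolding mset_of_def by (rule count_Abs_multiset) simp

lemma set_mset_of [simp]: "set_mset (mset_of m) = keys m"
  by (auto simp: set_mset_def in_keys_iff)

lemma prod_mset_count:
  fixes f :: "'v \<Rightarrow> 'b::comm_monoid_mult"
  assumes "finite V" "set_mset M \<subseteq> V"
  shows "(\<Prod>u\<in>#M. f u) = (\<Prod>u\<in>V. f u ^ count M u)"
  using assms(2)
proof (induction M)
  case (add x M)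
  have "(\<Prod>u\<in>V. f u ^ count (add_mset x M) u) = (\<Prod>u\<in>V. (if u = x then f u else 1) * f u ^ count M u)"
    by (intro prod.cong) auto
  then show ?case
    using add assms(1) by (simp add: prod.distrib)
qed simp

lemma mon_eval_eq: "mon_eval f m = (\<Prod>u\<in>#mset_of m. f u)"
  by (simp add: mon_eval_def prod_mset_count[of "keys m"])

lemma prod_mset_mp_monom: "(\<Prod>u\<in>#M. mp_monom u) = (mp_monom (\<Sum>\<^sub># M) :: ('v, 'a::comm_semiring_1) mpoly)"
  by (induction M) (simp_all add: mp_monom_add)

lemma prod_mset_monom:
  "(\<Prod>u\<in>#M. Polynomial.monom (mp_monom u) 1)
    = (Polynomial.monom (mp_monom (\<Sum>\<^sub># M)) (size M) :: ('v, 'a::comm_ring_1) mpoly poly)"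
  by (induction M) (simp_all add: mp_monom_add Polynomial.mult_monom flip: one_pCons monom_0)

definition T_prod :: "'v multiset \<Rightarrow> ('v, 'a::comm_semiring_1) mpoly" where
  "T_prod M = (\<Prod>u\<in>#M. mp_var u)"

lemma T_prod_simps [simp]: "T_prod {#} = 1" "T_prod (add_mset u M) = mp_var u * T_prod M"
  by (simp_all add: T_prod_def)

lemma mp_var_power: "mp_var v ^ k = (mp_monom (single v k) :: ('v, 'a::comm_semiring_1) mpoly)"
  by (induction k) (simp_all add: mp_var_def flip: mp_monom_add single_add)

lemma prod_mp_monom: "(\<Prod>x\<in>X. mp_monom (g x)) = (mp_monom (\<Sum>x\<in>X. g x) :: ('v, 'a::comm_semiring_1) mpoly)"
  by (induction X rule: infinite_finite_induct) (simp_all add: mp_monom_add)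

lemma mp_monom_eq_T_prod: "mp_monom m = (T_prod (mset_of m) :: ('v, 'a::comm_semiring_1) mpoly)"
proof -
  have "T_prod (mset_of m) = (\<Prod>v\<in>keys m. mp_var v ^ lookup m v :: ('v, 'a) mpoly)"
    by (simp add: T_prod_def prod_mset_count[of "keys m"])
  also have "\<dots> = mp_monom (\<Sum>v\<in>keys m. single v (lookup m v))"
    by (simp add: mp_var_power prod_mp_monom)
  also have "\<dots> = mp_monom m"
    by (simp flip: mpoly_sum_single)
  finally show ?thesis ..
qed

lemma mp_var_in_carrier: "is_subring A \<Longrightarrow> v \<in> V \<Longrightarrow> mp_var v \<in> poly_carrier A V"
  unfolding mp_var_def mp_monom_def by (rule poly_carrier_single) (auto simp: is_subring_def)

lemma mp_const_in_carrier: "c \<in> A \<Longrightarrow> mp_const c \<in> poly_carrier A V"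
  unfolding mp_const_def by (rule poly_carrier_single) auto

lemma mp_monom_in_carrier: "is_subring A \<Longrightarrow> keys m \<subseteq> V \<Longrightarrow> mp_monom m \<in> poly_carrier A V"
  unfolding mp_monom_def by (rule poly_carrier_single) (auto simp: is_subring_def)

section \<open>The toric ideal\<close>

lemma poly_ring_eq: "poly_ring n = ring_on (poly_carrier UNIV {1..n})"
  by (simp add: poly_ring_def mpoly_ring_eq)

lemma toric_ideal_eq:
  "toric_ideal n S = {q \<in> poly_carrier UNIV S. mp_eval mp_const mp_monom q = (0 :: (nat, 'k::field) mpoly)}"
  by (simp add: toric_ideal_def a_kernel_def' KT_def mpoly_ring_eq poly_ring_eq)

text \<open>A vanishing image thus says that the coefficients in each fibre add up to 0, as
  \<open>fibre_sum_in_ideal\<close> demands.\<close>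

lemma lookup_toric_eval:
  "lookup (mp_eval mp_const mp_monom q :: (nat, 'k::field) mpoly) w
    = (\<Sum>m\<in>{m\<in>keys q. \<Sum>\<^sub># (mset_of m) = w}. lookup q m)"
proof -
  have "mp_eval mp_const mp_monom q = (\<Sum>m\<in>keys q. single (\<Sum>\<^sub># (mset_of m)) (lookup q m))"
    unfolding mp_eval_def mon_eval_def[symmetric] mon_eval_eq prod_mset_mp_monom mp_const_times_monom ..
  then show ?thesis
    by (simp add: lookup_sum lookup_single when_def sum.If_cases Int_def)
qed

lemma exchange_relations_subset_toric:
  "exchange_relations n S \<subseteq> (toric_ideal n S :: (nat monomial, 'k::field) mpoly set)"
proof
  interpret coeff_hom "mp_const :: 'k \<Rightarrow> (nat, 'k) mpoly"
    by (rule coeff_hom_mp_const)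
  fix q :: "(nat monomial, 'k) mpoly" assume "q \<in> exchange_relations n S"
  then obtain r s t w i j where q: "q = T_var r * T_var s - T_var t * T_var w"
    and S: "r \<in> S" "s \<in> S" "t \<in> S" "w \<in> S"
    and less: "lookup s i < lookup r i" "lookup r j < lookup s j"
    and tw: "t = swap_var r j i" "w = swap_var s i j"
    unfolding exchange_relations_def by blast
  have "t + w = r + s"
    unfolding tw using less by (intro swap_var_add_swap_var) auto
  moreover have "mp_eval mp_const mp_monom (T_var v) = (mp_monom v :: (nat, 'k) mpoly)" for v
    by (simp add: mp_var_def mp_eval_monom mon_eval_def)
  ultimately have "mp_eval mp_const mp_monom q = (0 :: (nat, 'k) mpoly)"
    by (simp add: q mp_eval_diff mp_eval_mult flip: mp_monom_add)
  moreover have "q \<in> poly_carrier UNIV S"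
    unfolding q using S by (intro is_subring_diff is_subring_mult is_subring_poly_carrier mp_var_in_carrier) auto
  ultimately show "q \<in> toric_ideal n S"
    by (simp add: toric_ideal_eq)
qed

lemma toric_ideal_generated:
  assumes pos: "0 < weight n lam"
  shows "(toric_ideal n (perm_points n lam) :: (nat monomial, 'k::field) mpoly set)
    = genideal (KT (perm_points n lam)) (exchange_relations n (perm_points n lam))"
proof
  let ?G = "perm_points n lam" and ?A = "poly_carrier UNIV (perm_points n lam) :: (nat monomial, 'k) mpoly set"
  interpret coeff_hom "mp_const :: 'k \<Rightarrow> (nat, 'k) mpoly"
    by (rule coeff_hom_mp_const)
  have A: "is_subring ?A"
    by (simp add: is_subring_poly_carrier)
  have gen: "genideal (KT ?G) X = \<Inter> {J. ideal_of ?A J \<and> X \<subseteq> J}" for X :: "(nat monomial, 'k) mpoly set"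
    unfolding KT_def mpoly_ring_eq by (rule genideal_ring_on[OF A])
  have "ideal_of ?A (toric_ideal n ?G)"
    unfolding toric_ideal_eq by (rule ideal_of_kernel[OF A])
  then show "genideal (KT ?G) (exchange_relations n ?G) \<subseteq> (toric_ideal n ?G :: (nat monomial, 'k) mpoly set)"
    unfolding gen using exchange_relations_subset_toric by blast
  show "toric_ideal n ?G \<subseteq> (genideal (KT ?G) (exchange_relations n ?G) :: (nat monomial, 'k) mpoly set)"
    unfolding gen
  proof (intro subsetI InterI, clarify)
    fix q :: "(nat monomial, 'k) mpoly" and J
    assume q: "q \<in> toric_ideal n ?G" and J: "ideal_of ?A J" and ex: "exchange_relations n ?G \<subseteq> J"
    interpret exchange_congruence n lam "\<lambda>M N. T_prod M - T_prod N \<in> J"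
    proof
      show "T_prod M - T_prod M \<in> J" for M
        using J by (simp add: ideal_of_def)
      show "T_prod N - T_prod M \<in> J" if "T_prod M - T_prod N \<in> J" for M N
        using ideal_of_diff[OF A J _ that, of 0] J by (simp add: ideal_of_def)
      show "T_prod L - T_prod N \<in> J" if "T_prod L - T_prod M \<in> J" "T_prod M - T_prod N \<in> J" for L M N
      proof -
        have "T_prod L - T_prod M + (T_prod M - T_prod N) \<in> J"
          using J that unfolding ideal_of_def by blast
        then show ?thesis
          by simp
      qed
      show "T_prod (add_mset u M) - T_prod (add_mset u N) \<in> J" if "T_prod M - T_prod N \<in> J" "u \<in> ?G" for u M N
      proof -
        have "mp_var u * (T_prod M - T_prod N) \<in> J"
          using J that(1) mp_var_in_carrier[OF is_subring_UNIV that(2)] unfolding ideal_of_def by blast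
        then show ?thesis
          by (simp add: right_diff_distrib)
      qed
      show "T_prod {#r, s#} - T_prod {#swap_var r j i, swap_var s i j#} \<in> J"
        if "r \<in> ?G" "s \<in> ?G" "i \<in> {1..n}" "j \<in> {1..n}" "lookup s i < lookup r i" "lookup r j < lookup s j"
          "swap_var r j i \<in> ?G" "swap_var s i j \<in> ?G" for r s i j
      proof -
        have "T_var r * T_var s - T_var (swap_var r j i) * T_var (swap_var s i j) \<in> J"
          by (rule subsetD[OF ex]) (use that in \<open>unfold exchange_relations_def, blast\<close>)
        then show ?thesis
          by simp
      qed
    qed
    have qA: "q \<in> ?A" and q0: "mp_eval mp_const mp_monom q = (0 :: (nat, 'k) mpoly)"
      using q by (simp_all add: toric_ideal_eq)
    have "(\<Sum>m\<in>keys q. mp_const (lookup q m) * mp_monom m) \<in> J"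
    proof (rule fibre_sum_in_ideal[OF _ J, where g = "\<lambda>m. \<Sum>\<^sub># (mset_of m)"])
      fix k l assume kl: "k \<in> keys q" "l \<in> keys q" "\<Sum>\<^sub># (mset_of k) = \<Sum>\<^sub># (mset_of l)"
      then have G: "set_mset (mset_of k) \<subseteq> ?G" "set_mset (mset_of l) \<subseteq> ?G"
        using qA by (auto simp: poly_carrier_def)
      \<comment> \<open>The toric map records only the total; as all generators have the same
        positive weight, the total determines the number of factors.\<close>
      have "size (mset_of k) * weight n lam = size (mset_of l) * weight n lam"
        using weight_sum_mset[OF G(1)] weight_sum_mset[OF G(2)] kl(3) by metis
      then have "size (mset_of k) = size (mset_of l)"
        using pos by (metis mult_right_cancel less_not_refl2)
      then have "mp_monom k - mp_monom l \<in> J"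
        unfolding mp_monom_eq_T_prod by (rule exchange_connected[OF G kl(3)])
      then show "mp_const (lookup q k) * (mp_monom k - mp_monom l) \<in> J"
        using J mp_const_in_carrier[of _ UNIV ?G] unfolding ideal_of_def by blast
    next
      show "(\<Sum>k\<in>{k\<in>keys q. \<Sum>\<^sub># (mset_of k) = w}. mp_const (lookup q k)) = (0 :: (nat monomial, 'k) mpoly)" for w
        unfolding mp_const_sum[symmetric] lookup_toric_eval[symmetric] q0 by simp
    qed simp
    then show "q \<in> J"
      unfolding mp_const_times_monom by (simp flip: mpoly_sum_single)
  qed
qed

section \<open>The principal symmetric strongly shifted ideal\<close>

abbreviation xpoly :: "nat \<Rightarrow> (nat, 'k::field) mpoly set" where
  "xpoly n \<equiv> poly_carrier UNIV {1..n}"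

lemma is_subring_xpoly: "is_subring (xpoly n)"
  by (simp add: is_subring_poly_carrier)

lemma genideal_monomials:
  assumes M: "\<And>m. m \<in> M \<Longrightarrow> keys m \<subseteq> {1..n}"
  shows "(genideal (poly_ring n) (mp_monom ` M) :: (nat, 'k::field) mpoly set)
    = {q \<in> xpoly n. \<forall>m\<in>keys q. \<exists>u\<in>M. \<exists>d. m = u + d}" (is "_ = ?D")
proof
  have mem: "m \<in> keys p \<Longrightarrow> p \<in> ?D \<Longrightarrow> \<exists>u\<in>M. \<exists>d. m = u + d" for m and p :: "(nat, 'k) mpoly"
    by blast
  have "ideal_of (xpoly n) ?D"
    unfolding ideal_of_def
  proof (intro conjI ballI)
    show "0 \<in> ?D"
      by (simp add: poly_carrier_def)
    fix p q :: "(nat, 'k) mpoly" assume q: "q \<in> ?D"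
    show "p + q \<in> ?D" if p: "p \<in> ?D"
    proof -
      have "\<exists>u\<in>M. \<exists>d. m = u + d" if "m \<in> keys (p + q)" for m
        using keys_add[of p q] that mem[OF _ p] mem[OF _ q] by blast
      moreover have "p + q \<in> xpoly n"
        using p q by (intro poly_carrier_add) auto
      ultimately show ?thesis
        by blast
    qed
    show "p * q \<in> ?D" if p: "p \<in> xpoly n"
    proof -
      have "\<exists>u\<in>M. \<exists>d. m = u + d" if m: "m \<in> keys (p * q)" for m
      proof -
        obtain a b where ab: "m = a + b" "b \<in> keys q"
          using keys_mult[of p q] m by blast
        then obtain u d where "u \<in> M" "b = u + d"
          using mem[OF _ q] by blast
        then have "m = u + (a + d)"
          by (simp add: ab add_ac)
        then show ?thesis
          using \<open>u \<in> M\<close> by blast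
      qed
      moreover have "p * q \<in> xpoly n"
        using p q by (intro is_subring_mult is_subring_xpoly) auto
      ultimately show ?thesis
        by blast
    qed
  qed auto
  moreover have "mp_monom ` M \<subseteq> ?D"
  proof
    fix p :: "(nat, 'k) mpoly" assume "p \<in> mp_monom ` M"
    then obtain m where m: "m \<in> M" "p = mp_monom m"
      by blast
    have "m = m + 0"
      by simp
    then have "\<forall>m'\<in>keys p. \<exists>u\<in>M. \<exists>d. m' = u + d"
      using m by (auto simp: mp_monom_def intro!: bexI[of _ m] exI[of _ 0])
    moreover have "p \<in> xpoly n"
      unfolding m(2) using M[OF m(1)] by (intro mp_monom_in_carrier) auto
    ultimately show "p \<in> ?D"
      by blast
  qed
  ultimately show "genideal (poly_ring n) (mp_monom ` M) \<subseteq> ?D"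
    unfolding poly_ring_eq genideal_ring_on[OF is_subring_xpoly] by blast
  show "?D \<subseteq> genideal (poly_ring n) (mp_monom ` M)"
    unfolding poly_ring_eq genideal_ring_on[OF is_subring_xpoly]
  proof (intro subsetI InterI, clarify)
    fix q :: "(nat, 'k) mpoly" and J :: "(nat, 'k) mpoly set"
    assume q: "q \<in> xpoly n" "\<forall>m\<in>keys q. \<exists>u\<in>M. \<exists>d. m = u + d"
      and J: "ideal_of (xpoly n) J" "mp_monom ` M \<subseteq> J"
    have "single m (lookup q m) \<in> J" if m: "m \<in> keys q" for m
    proof -
      obtain u d where u: "u \<in> M" "m = u + d"
        using q(2) m by blast
      have "keys d \<subseteq> keys m"
        unfolding u(2) by (auto simp: in_keys_iff lookup_add)
      then have "single d (lookup q m) \<in> xpoly n"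
        using q(1) m by (intro poly_carrier_single) (auto simp: poly_carrier_def)
      then have "single d (lookup q m) * mp_monom u \<in> J"
        using J u(1) unfolding ideal_of_def by blast
      then show ?thesis
        by (simp add: mp_monom_def mult_single u(2) add.commute)
    qed
    then have "(\<Sum>m\<in>keys q. single m (lookup q m)) \<in> J"
      by (rule ideal_of_sum[OF J(1)])
    then show "q \<in> J"
      by (simp flip: mpoly_sum_single)
  qed
qed

section \<open>The symmetric group acting on monomials and polynomials\<close>

definition perm_mon :: "(nat \<Rightarrow> nat) \<Rightarrow> nat monomial \<Rightarrow> nat monomial" where
  "perm_mon sg m = (\<Sum>v\<in>keys m. single (sg v) (lookup m v))"

lemma lookup_perm_mon:
  assumes "inj sg"
  shows "lookup (perm_mon sg m) (sg x) = lookup m x"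
proof -
  have "lookup (perm_mon sg m) (sg x) = (\<Sum>v\<in>keys m. if v = x then lookup m v else 0)"
    unfolding perm_mon_def lookup_sum using assms
    by (intro sum.cong) (auto simp: lookup_single when_def inj_def)
  then show ?thesis
    by (simp add: in_keys_iff)
qed

lemma poly_mapping_eq_perm:
  assumes "sg permutes {1..n}" "\<And>x. lookup u (sg x) = lookup v (sg x)"
  shows "u = v"
proof (rule poly_mapping_eqI)
  show "lookup u y = lookup v y" for y
    using assms(2)[of "Hilbert_Choice.inv sg y"] permutes_inverses(1)[OF assms(1)] by simp
qed

lemma perm_mon_inv:
  assumes "sg permutes {1..n}"
  shows "perm_mon sg (perm_mon (Hilbert_Choice.inv sg) m) = m"
proof (rule poly_mapping_eq_perm[OF assms])
  have "lookup (perm_mon (Hilbert_Choice.inv sg) m) (Hilbert_Choice.inv sg (sg x)) = lookup m (sg x)" for x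
    using permutes_inj[OF permutes_inv[OF assms]] by (rule lookup_perm_mon)
  then show "lookup (perm_mon sg (perm_mon (Hilbert_Choice.inv sg) m)) (sg x) = lookup m (sg x)" for x
    using lookup_perm_mon[OF permutes_inj[OF assms]] permutes_inverses(2)[OF assms] by simp
qed

lemma perm_mon_add:
  assumes "sg permutes {1..n}"
  shows "perm_mon sg (u + v) = perm_mon sg u + perm_mon sg v"
  by (rule poly_mapping_eq_perm[OF assms]) (simp add: lookup_add lookup_perm_mon[OF permutes_inj[OF assms]])

lemma keys_perm_mon:
  assumes "sg permutes {1..n}" "keys m \<subseteq> {1..n}"
  shows "keys (perm_mon sg m) \<subseteq> {1..n}"
proof
  fix y assume "y \<in> keys (perm_mon sg m)"
  then have "Hilbert_Choice.inv sg y \<in> keys m"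
    using lookup_perm_mon[OF permutes_inj[OF assms(1)], of m "Hilbert_Choice.inv sg y"] permutes_inverses(1)[OF assms(1)]
    by (simp add: in_keys_iff)
  then show "y \<in> {1..n}"
    using assms permutes_in_image[OF permutes_inv[OF assms(1)], of y] by blast
qed

lemma sum_perm_mon:
  assumes "sg permutes {1..n}"
  shows "(\<Sum>x=1..n. g (lookup (perm_mon sg m) x)) = (\<Sum>x=1..n. g (lookup m x))"
  using sum.permute[OF assms, of "\<lambda>x. g (lookup (perm_mon sg m) x)"]
  by (simp add: lookup_perm_mon[OF permutes_inj[OF assms]] comp_def)

lemma perm_mon_perm_points:
  assumes "sg permutes {1..n}" "u \<in> perm_points n lam"
  shows "perm_mon sg u \<in> perm_points n lam"
  using assms sum_perm_mon[OF assms(1), of "\<lambda>x. x" u] sum_perm_mon[OF assms(1), of "\<lambda>x. x - c" u for c]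
    keys_perm_mon[OF assms(1)]
  by (simp add: perm_points_def weight_def excess_def)

lemma perm_mon_sorted_by:
  assumes "sg permutes {1..n}" "keys u \<subseteq> {1..n}"
  shows "perm_mon sg (sorted_by n sg u) = u"
proof (rule poly_mapping_eq_perm[OF assms(1)])
  fix x
  show "lookup (perm_mon sg (sorted_by n sg u)) (sg x) = lookup u (sg x)"
    using assms permutes_in_image[OF assms(1), of x]
    by (auto simp: lookup_perm_mon[OF permutes_inj[OF assms(1)]] lookup_sorted_by in_keys_iff subset_iff)
qed

lemma sorted_by_eq_perm_mon:
  assumes "sg permutes {1..n}" "keys u \<subseteq> {1..n}"
  shows "sorted_by n sg u = perm_mon (Hilbert_Choice.inv sg) u"
  using perm_mon_sorted_by[OF assms] perm_mon_inv[OF permutes_inv[OF assms(1)], of "sorted_by n sg u"]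
  by (simp add: permutes_inv_inv[OF assms(1)])

lemma perm_act_single: "perm_act sg (single m c) = single (perm_mon sg m) (c :: 'k::field)"
proof -
  interpret coeff_hom "mp_const :: 'k \<Rightarrow> (nat, 'k) mpoly"
    by (rule coeff_hom_mp_const)
  show ?thesis
    by (simp add: perm_act_def mp_eval_single mon_eval_def mp_var_power prod_mp_monom
        mp_const_times_monom perm_mon_def)
qed

lemma perm_act_monom: "perm_act sg (mp_monom m) = mp_monom (perm_mon sg m)"
  by (simp add: mp_monom_def perm_act_single)

lemma perm_act_eq: "perm_act sg (q :: (nat, 'k::field) mpoly) = (\<Sum>m\<in>keys q. single (perm_mon sg m) (lookup q m))"
proof -
  interpret coeff_hom "mp_const :: 'k \<Rightarrow> (nat, 'k) mpoly"
    by (rule coeff_hom_mp_const)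
  have "perm_act sg q = perm_act sg (\<Sum>m\<in>keys q. single m (lookup q m))"
    by (simp flip: mpoly_sum_single)
  also have "\<dots> = (\<Sum>m\<in>keys q. perm_act sg (single m (lookup q m)))"
    unfolding perm_act_def by (rule mp_eval_sum)
  finally show ?thesis
    by (simp add: perm_act_single)
qed

lemma perm_act_inv:
  assumes "sg permutes {1..n}"
  shows "perm_act sg (perm_act (Hilbert_Choice.inv sg) q) = (q :: (nat, 'k::field) mpoly)"
proof -
  interpret coeff_hom "mp_const :: 'k \<Rightarrow> (nat, 'k) mpoly"
    by (rule coeff_hom_mp_const)
  have "perm_act sg (perm_act (Hilbert_Choice.inv sg) q) = (\<Sum>m\<in>keys q. perm_act sg (single (perm_mon (Hilbert_Choice.inv sg) m) (lookup q m)))"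
    unfolding perm_act_eq[of "Hilbert_Choice.inv sg"] unfolding perm_act_def by (rule mp_eval_sum)
  then show ?thesis
    by (simp add: perm_act_single perm_mon_inv[OF assms] flip: mpoly_sum_single)
qed

section \<open>The ideal generated by the points of the permutohedron\<close>

definition perm_ideal :: "nat \<Rightarrow> nat monomial \<Rightarrow> (nat, 'k::field) mpoly set" where
  "perm_ideal n lam = genideal (poly_ring n) (mp_monom ` perm_points n lam)"

lemma perm_ideal_eq:
  "perm_ideal n lam = {q \<in> xpoly n. \<forall>m\<in>keys q. \<exists>u\<in>perm_points n lam. \<exists>d. m = u + d}"
  unfolding perm_ideal_def by (rule genideal_monomials) (rule perm_points_keys)

lemma ideal_of_perm_ideal: "ideal_of (xpoly n) (perm_ideal n lam)"
  unfolding perm_ideal_def poly_ring_eq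
  by (rule ideal_of_genideal[OF is_subring_xpoly])
    (use perm_points_keys in \<open>blast intro: mp_monom_in_carrier is_subring_UNIV\<close>)

lemma mp_monom_in_perm_ideal:
  "mp_monom m \<in> (perm_ideal n lam :: (nat, 'k::field) mpoly set)
    \<longleftrightarrow> keys m \<subseteq> {1..n} \<and> (\<exists>u\<in>perm_points n lam. \<exists>d. m = u + d)"
  by (auto simp: perm_ideal_eq poly_carrier_def mp_monom_def)

lemma partition_in_perm_points: "lam \<in> partitions n \<Longrightarrow> lam \<in> perm_points n lam"
  by (simp add: perm_points_def partitions_def)

lemma perm_act_perm_ideal:
  assumes "sg permutes {1..n}" "q \<in> perm_ideal n lam"
  shows "perm_act sg q \<in> (perm_ideal n lam :: (nat, 'k::field) mpoly set)"
  unfolding perm_act_eq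
proof (rule ideal_of_sum[OF ideal_of_perm_ideal])
  fix m assume m: "m \<in> keys q"
  then obtain u d where u: "u \<in> perm_points n lam" "m = u + d"
    using assms(2) by (auto simp: perm_ideal_eq)
  have "keys m \<subseteq> {1..n}"
    using assms(2) m by (auto simp: perm_ideal_eq poly_carrier_def)
  then have "single (perm_mon sg m) (lookup q m) \<in> xpoly n"
    by (intro poly_carrier_single keys_perm_mon[OF assms(1)]) auto
  moreover have "perm_mon sg m = perm_mon sg u + perm_mon sg d"
    unfolding u(2) by (rule perm_mon_add[OF assms(1)])
  then have "\<forall>m'\<in>keys (single (perm_mon sg m) (lookup q m)). \<exists>u\<in>perm_points n lam. \<exists>d. m' = u + d"
    using perm_mon_perm_points[OF assms(1) u(1)] by auto
  ultimately show "single (perm_mon sg m) (lookup q m) \<in> perm_ideal n lam"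
    unfolding perm_ideal_eq by (intro CollectI conjI)
qed

lemma symmetric_strongly_shifted_perm_ideal:
  "symmetric_strongly_shifted n (perm_ideal n lam :: (nat, 'k::field) mpoly set)"
  unfolding symmetric_strongly_shifted_def symmetric_monomial_ideal_def monomial_ideal_def
proof (intro conjI allI impI ballI)
  show "\<exists>M. (\<forall>m\<in>M. keys m \<subseteq> {1..n}) \<and> (perm_ideal n lam :: (nat, 'k) mpoly set) = genideal (poly_ring n) (mp_monom ` M)"
    using perm_points_keys[of _ n lam] by (intro exI[of _ "perm_points n lam"]) (simp add: perm_ideal_def)
  show "perm_act sg ` perm_ideal n lam = (perm_ideal n lam :: (nat, 'k) mpoly set)" if sg: "sg permutes {1..n}" for sg
  proof
    show "perm_act sg ` perm_ideal n lam \<subseteq> (perm_ideal n lam :: (nat, 'k) mpoly set)"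
      using perm_act_perm_ideal[OF sg] by blast
    show "perm_ideal n lam \<subseteq> perm_act sg ` (perm_ideal n lam :: (nat, 'k) mpoly set)"
    proof
      fix q :: "(nat, 'k) mpoly" assume "q \<in> perm_ideal n lam"
      then have "perm_act (Hilbert_Choice.inv sg) q \<in> perm_ideal n lam"
        by (rule perm_act_perm_ideal[OF permutes_inv[OF sg]])
      then show "q \<in> perm_act sg ` perm_ideal n lam"
        using perm_act_inv[OF sg, of q] by (metis imageI)
    qed
  qed
  fix m i j assume m: "m \<in> P_of n (perm_ideal n lam :: (nat, 'k) mpoly set)"
    and ij: "i \<in> {1..n}" "j \<in> {1..n}" and less: "i < j \<and> lookup m i < lookup m j"
  have "keys m \<subseteq> {1..n}" "\<exists>u\<in>perm_points n lam. \<exists>d. m = u + d"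
    using m unfolding P_of_def mp_monom_in_perm_ideal by auto
  then obtain u d where u: "u \<in> perm_points n lam" "m = u + d" and mk: "keys m \<subseteq> {1..n}"
    by blast
  have "keys (swap_var m i j) \<subseteq> {1..n}"
    using keys_swap_var[of m i j] mk ij by auto
  \<comment> \<open>If \<open>x_j\<close> divides the cofactor \<open>d\<close>, the shift can act
    there. Otherwise \<open>u\<close> carries the whole exponent at \<open>j\<close>, which exceeds
    its own exponent at \<open>i\<close>.\<close>
  moreover have "\<exists>v\<in>perm_points n lam. \<exists>e. swap_var m i j = v + e"
  proof (cases "lookup d j = 0")
    case True
    then have "lookup u i < lookup u j"
      using less by (simp add: u(2) lookup_add)
    then have "swap_var u i j \<in> perm_points n lam"
      using robin_hood[OF u(1) ij] by simp
    moreover have "swap_var m i j = swap_var u i j + d"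
      using \<open>lookup u i < lookup u j\<close> by (intro poly_mapping_eqI) (auto simp: u(2) lookup_add lookup_swap_var)
    ultimately show ?thesis
      by blast
  next
    case False
    then have "swap_var m i j = u + swap_var d i j"
      by (intro poly_mapping_eqI) (auto simp: u(2) lookup_add lookup_swap_var)
    then show ?thesis
      using u(1) by blast
  qed
  ultimately show "mp_monom (swap_var m i j) \<in> (perm_ideal n lam :: (nat, 'k) mpoly set)"
    by (simp add: mp_monom_in_perm_ideal)
qed

text \<open>The definition grants shifts of sorted vectors only. Symmetry extends them to all
  vectors: sort, shift, and permute back.\<close>

lemma symmetric_strongly_shifted_swap:
  fixes J :: "(nat, 'k::field) mpoly set"
  assumes J: "symmetric_strongly_shifted n J" and v: "mp_monom v \<in> J" "keys v \<subseteq> {1..n}"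
    and ab: "a \<in> {1..n}" "b \<in> {1..n}" "lookup v a < lookup v b"
  shows "mp_monom (swap_var v a b) \<in> J"
proof -
  have act: "perm_act sg q \<in> J" if "sg permutes {1..n}" "q \<in> J" for sg q
    using J that by (auto simp: symmetric_strongly_shifted_def symmetric_monomial_ideal_def)
  obtain ta where ta: "ta permutes {1..n}"
    and sorted: "\<And>k l. k \<in> {1..n} \<Longrightarrow> l \<in> {1..n} \<Longrightarrow> k \<le> l \<Longrightarrow> lookup v (ta k) \<le> lookup v (ta l)"
    using ex_sorting_perm[of n "lookup v"] by metis
  let ?w = "sorted_by n ta v"
  have "mp_monom ?w \<in> J"
    using act[OF permutes_inv[OF ta] v(1)] by (simp add: perm_act_monom sorted_by_eq_perm_mon[OF ta v(2)])
  then have w: "?w \<in> P_of n J"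
    using sorted_by_partition[OF sorted] by (simp add: P_of_def)
  obtain k l where kl: "k \<in> {1..n}" "a = ta k" "l \<in> {1..n}" "b = ta l"
    using permutes_image[OF ta] ab by (metis imageE)
  have less: "lookup ?w k < lookup ?w l"
    using ab(3) kl by (simp add: lookup_sorted_by)
  have "k < l"
    using ab(3) sorted[OF kl(3,1)] kl by (cases "k < l") auto
  then have "mp_monom (swap_var ?w k l) \<in> J"
    using J w less kl by (auto simp: symmetric_strongly_shifted_def)
  then have "mp_monom (perm_mon ta (swap_var ?w k l)) \<in> J"
    using act[OF ta] by (simp flip: perm_act_monom)
  moreover have "perm_mon ta (swap_var ?w k l) = swap_var v a b"
  proof (rule poly_mapping_eq_perm[OF ta])
    have "lookup ?w x = lookup v (ta x)" for x
      using lookup_perm_mon[OF permutes_inj[OF ta], of ?w x] by (simp add: perm_mon_sorted_by[OF ta v(2)])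
    moreover have "ta x = ta y \<longleftrightarrow> x = y" for x y
      using permutes_inj[OF ta] by (auto simp: inj_def)
    ultimately show "lookup (perm_mon ta (swap_var ?w k l)) (ta x) = lookup (swap_var v a b) (ta x)" for x
      by (simp add: lookup_perm_mon[OF permutes_inj[OF ta]] lookup_swap_var kl)
  qed
  ultimately show ?thesis
    by simp
qed

text \<open>
  A point other than a permutation of \<open>lam\<close> arises by a shift from a point with larger sum of
  squares, which the exchange property with \<open>lam\<close> provides.
\<close>

lemma perm_points_in_ideal:
  fixes J :: "(nat, 'k::field) mpoly set"
  assumes J: "symmetric_strongly_shifted n J" and lam: "lam \<in> partitions n" "mp_monom lam \<in> J"
    and u: "u \<in> perm_points n lam"
  shows "mp_monom u \<in> J"
  using u
\<comment> \<open>The square of the weight bounds the sum of squares, so increasing the latter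
  terminates.\<close>
proof (induction "(weight n lam)\<^sup>2 - (\<Sum>x=1..n. (lookup u x)\<^sup>2)" arbitrary: u rule: less_induct)
  case less
  note u = less.prems
  have act: "perm_act sg q \<in> J" if "sg permutes {1..n}" "q \<in> J" for sg q
    using J that by (auto simp: symmetric_strongly_shifted_def symmetric_monomial_ideal_def)
  obtain sg where sg: "sg permutes {1..n}"
    and sorted: "\<And>k l. k \<in> {1..n} \<Longrightarrow> l \<in> {1..n} \<Longrightarrow> k \<le> l \<Longrightarrow> lookup u (sg k) \<le> lookup u (sg l)"
    using ex_sorting_perm[of n "lookup u"] by metis
  let ?s = "sorted_by n sg u"
  note uk = perm_points_keys[OF u]
  have sG: "?s \<in> perm_points n lam"
    using perm_mon_perm_points[OF permutes_inv[OF sg] u] by (simp add: sorted_by_eq_perm_mon[OF sg uk])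
  have "mp_monom ?s \<in> J"
  proof (cases "?s = lam")
    case True
    then show ?thesis
      using lam by simp
  next
    case False
    define S where "S = {x \<in> {1..n}. lookup ?s x \<noteq> lookup lam x}"
    have "S \<noteq> {}"
      using False poly_mapping_eq_on[OF perm_points_keys[OF sG] perm_points_keys[OF partition_in_perm_points[OF lam(1)]]]
      by (auto simp: S_def)
    have "finite S"
      by (simp add: S_def)
    \<comment> \<open>At the last difference the sorted vector must be smaller than
      \<open>lam\<close>: if it were larger, its cut-off sum at \<open>lookup lam j\<close> would
      exceed the bound.\<close>
    define j where "j = Max S"
    have j: "j \<in> {1..n}" "lookup ?s j \<noteq> lookup lam j"
      using Max_in[OF \<open>finite S\<close> \<open>S \<noteq> {}\<close>] by (simp_all add: j_def S_def)
    have same: "lookup ?s x = lookup lam x" if "x \<in> {1..n}" "j < x" for x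
    proof (rule ccontr)
      assume "\<not> ?thesis"
      then have "x \<in> S"
        using that by (simp add: S_def)
      then show False
        using Max_ge[OF \<open>finite S\<close>, of x] that by (simp add: j_def)
    qed
    have s_mono: "lookup ?s x \<le> lookup ?s y" if "x \<in> {1..n}" "y \<in> {1..n}" "x \<le> y" for x y
      using that sorted by (simp add: lookup_sorted_by)
    have "lookup ?s j < lookup lam j"
    proof (rule ccontr)
      assume "\<not> ?thesis"
      then have gt: "lookup lam j < lookup ?s j"
        using j(2) by simp
      have "excess n (lookup lam j) lam < excess n (lookup lam j) ?s"
        unfolding excess_def
      proof (rule sum_strict_mono_ex1)
        show "\<forall>x\<in>{1..n}. lookup lam x - lookup lam j \<le> lookup ?s x - lookup lam j"
        proof
          fix x assume x: "x \<in> {1..n}"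
          consider "x < j" | "x = j" | "j < x"
            by linarith
          then show "lookup lam x - lookup lam j \<le> lookup ?s x - lookup lam j"
          proof cases
            case 1
            then have "lookup lam x \<le> lookup lam j"
              using lam(1) x j(1) by (auto simp: partitions_def mono_on_def)
            then show ?thesis
              by simp
          qed (use gt same x in auto)
        qed
        show "\<exists>x\<in>{1..n}. lookup lam x - lookup lam j < lookup ?s x - lookup lam j"
          using j(1) gt by force
      qed simp
      then show False
        using perm_points_excess[OF sG, of "lookup lam j"] by simp
    qed
    then obtain k where k: "k \<in> {1..n}" "lookup lam k < lookup ?s k" and vG: "swap_var ?s j k \<in> perm_points n lam"
      using symmetric_exchange[OF partition_in_perm_points[OF lam(1)] sG j(1)] by metis
    let ?v = "swap_var ?s j k"
    have "k \<noteq> j"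
      using k(2) \<open>lookup ?s j < lookup lam j\<close> by auto
    \<comment> \<open>Beyond \<open>j\<close> the vectors agree, so the unit comes from an earlier,
      hence not larger, entry of the sorted vector; adding it at \<open>j\<close> increases the sum
      of squares.\<close>
    then have "k < j"
      using same[OF k(1)] k(2) by (cases "k < j") auto
    have kj: "lookup ?s k \<le> lookup ?s j"
      using s_mono[OF k(1) j(1)] \<open>k < j\<close> by simp
    have squares: "(\<Sum>x=1..n. (lookup w x)\<^sup>2) \<le> (weight n lam)\<^sup>2" if "w \<in> perm_points n lam" for w
    proof -
      have "(\<Sum>x=1..n. (lookup w x)\<^sup>2) \<le> (\<Sum>x=1..n. lookup w x * weight n w)"
        unfolding power2_eq_square by (intro sum_mono mult_left_mono lookup_le_weight) auto
      also have "\<dots> = (weight n lam)\<^sup>2"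
        using perm_points_weight[OF that] by (simp add: weight_def power2_eq_square flip: sum_distrib_right)
      finally show ?thesis .
    qed
    have "(\<Sum>x=1..n. (lookup ?s x)\<^sup>2) = (\<Sum>x=1..n. (lookup u x)\<^sup>2)"
      using sum_perm_mon[OF sg, of "\<lambda>x. x\<^sup>2" ?s] by (simp add: perm_mon_sorted_by[OF sg uk])
    moreover have "(\<Sum>x=1..n. (lookup ?v x)\<^sup>2) + ((lookup ?s j)\<^sup>2 + (lookup ?s k)\<^sup>2)
        = (\<Sum>x=1..n. (lookup ?s x)\<^sup>2) + ((lookup ?s j + 1)\<^sup>2 + (lookup ?s k - 1)\<^sup>2)"
      using sum_swap_var[of "{1..n}" j k "\<lambda>x. power2" ?s] j(1) k(1) \<open>k \<noteq> j\<close> by simp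
    moreover obtain e where e: "lookup ?s k = Suc e"
      using k(2) by (cases "lookup ?s k") auto
    have "(lookup ?s j)\<^sup>2 + (lookup ?s k)\<^sup>2 < (lookup ?s j + 1)\<^sup>2 + (lookup ?s k - 1)\<^sup>2"
      using kj unfolding e by (simp add: power2_eq_square)
    ultimately have "(\<Sum>x=1..n. (lookup u x)\<^sup>2) < (\<Sum>x=1..n. (lookup ?v x)\<^sup>2)"
      by linarith
    then have vJ: "mp_monom ?v \<in> J"
      using less.hyps[OF _ vG] squares[OF vG] by linarith
    have "lookup ?v k < lookup ?v j"
      using kj k(2) \<open>k \<noteq> j\<close> by (simp add: lookup_swap_var)
    then have "mp_monom (swap_var ?v k j) \<in> J"
      using symmetric_strongly_shifted_swap[OF J vJ perm_points_keys[OF vG] k(1) j(1)] by simp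
    moreover have "swap_var ?v k j = ?s"
      using k(2) \<open>k \<noteq> j\<close> by (intro poly_mapping_eqI) (auto simp: lookup_swap_var)
    ultimately show ?thesis
      by simp
  qed
  show ?case
    using act[OF sg \<open>mp_monom ?s \<in> J\<close>] by (simp add: perm_act_monom perm_mon_sorted_by[OF sg uk])
qed

lemma Sss_eq_perm_ideal:
  assumes "lam \<in> partitions n"
  shows "Sss n {lam} = (perm_ideal n lam :: (nat, 'k::field) mpoly set)"
proof
  have "lam = lam + 0"
    by simp
  then have "mp_monom lam \<in> (perm_ideal n lam :: (nat, 'k) mpoly set)"
    using partition_in_perm_points[OF assms] perm_points_keys unfolding mp_monom_in_perm_ideal by blast
  then show "Sss n {lam} \<subseteq> (perm_ideal n lam :: (nat, 'k) mpoly set)"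
    using symmetric_strongly_shifted_perm_ideal by (auto simp: Sss_def)
  show "perm_ideal n lam \<subseteq> (Sss n {lam} :: (nat, 'k) mpoly set)"
    unfolding Sss_def
  proof (rule Inter_greatest, elim CollectE conjE)
    fix J :: "(nat, 'k) mpoly set"
    assume J: "symmetric_strongly_shifted n J" "mp_monom ` {lam} \<subseteq> J"
    obtain M where M: "\<forall>m\<in>M. keys m \<subseteq> {1..n}" "J = genideal (poly_ring n) (mp_monom ` M)"
      using J(1) unfolding symmetric_strongly_shifted_def symmetric_monomial_ideal_def monomial_ideal_def by blast
    have "ideal_of (xpoly n) J"
      unfolding M(2) poly_ring_eq using M(1)
      by (intro ideal_of_genideal is_subring_xpoly) (auto intro!: mp_monom_in_carrier)
    moreover have "mp_monom ` perm_points n lam \<subseteq> J"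
      using perm_points_in_ideal[OF J(1) assms] J(2) by auto
    ultimately show "perm_ideal n lam \<subseteq> J"
      unfolding perm_ideal_def poly_ring_eq genideal_ring_on[OF is_subring_xpoly] by blast
  qed
qed

lemma weight_eq_0:
  assumes "weight n d = 0" "keys d \<subseteq> {1..n}"
  shows "d = 0"
  using assms by (intro poly_mapping_eq_on[of d n 0]) (auto simp: weight_def)

text \<open>All points have the same weight, so none of them properly divides another.\<close>

lemma min_gens_perm_ideal: "min_gens n (perm_ideal n lam :: (nat, 'k::field) mpoly set) = perm_points n lam"
proof (intro equalityI subsetI)
  fix m assume m: "m \<in> min_gens n (perm_ideal n lam :: (nat, 'k) mpoly set)"
  then obtain u d where u: "u \<in> perm_points n lam" "m = u + d"
    by (auto simp: min_gens_def mp_monom_in_perm_ideal)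
  have "u = u + 0"
    by simp
  then have "mp_monom u \<in> (perm_ideal n lam :: (nat, 'k) mpoly set)"
    using u(1) perm_points_keys unfolding mp_monom_in_perm_ideal by blast
  then have "u = m"
    using m u(2) by (auto simp: min_gens_def)
  then show "m \<in> perm_points n lam"
    using u(1) by simp
next
  fix u assume u: "u \<in> perm_points n lam"
  have "u = u + 0"
    by simp
  then have uI: "mp_monom u \<in> (perm_ideal n lam :: (nat, 'k) mpoly set)"
    using u perm_points_keys unfolding mp_monom_in_perm_ideal by blast
  have "m = u" if m: "u = m + d" "mp_monom m \<in> (perm_ideal n lam :: (nat, 'k) mpoly set)" for m d
  proof -
    obtain v e where v: "v \<in> perm_points n lam" "m = v + e"
      using m(2) by (auto simp: mp_monom_in_perm_ideal)
    have "weight n d = 0"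
      using perm_points_weight[OF u] perm_points_weight[OF v(1)] by (simp add: m(1) v(2) weight_add)
    moreover have "keys d \<subseteq> keys u"
      unfolding m(1) by (auto simp: in_keys_iff lookup_add)
    ultimately show ?thesis
      using weight_eq_0[of n d] perm_points_keys[OF u] m(1) by auto
  qed
  then show "u \<in> min_gens n (perm_ideal n lam :: (nat, 'k) mpoly set)"
    using uI perm_points_keys[OF u] by (auto simp: min_gens_def)
qed

section \<open>The special fiber ring\<close>

lemma poly_ring_simps:
  "carrier (poly_ring n) = xpoly n" "mult (poly_ring n) = (*)" "zero (poly_ring n) = 0" "add (poly_ring n) = (+)"
  by (simp_all add: poly_ring_eq)

lemma ideal_poly_ring_iff: "ideal J (poly_ring n) \<longleftrightarrow> ideal_of (xpoly n) J"
  unfolding poly_ring_eq by (rule ideal_ring_on_iff[OF is_subring_xpoly])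

lemma lookup_fiber_eval:
  "lookup (coeff (mp_eval (\<lambda>c. [:mp_const c:]) (\<lambda>m. Polynomial.monom (mp_monom m) 1) q :: (nat, 'k::field) mpoly poly) N) w
    = (\<Sum>m\<in>{m\<in>keys q. size (mset_of m) = N \<and> \<Sum>\<^sub># (mset_of m) = w}. lookup q m)"
proof -
  have "mp_eval (\<lambda>c. [:mp_const c:]) (\<lambda>m. Polynomial.monom (mp_monom m) 1) q
    = (\<Sum>m\<in>keys q. Polynomial.monom (single (\<Sum>\<^sub># (mset_of m)) (lookup q m)) (size (mset_of m)))"
    unfolding mp_eval_def mon_eval_def[symmetric] mon_eval_eq prod_mset_monom
    by (simp add: smult_monom mp_const_times_monom)
  then have "lookup (coeff (mp_eval (\<lambda>c. [:mp_const c:]) (\<lambda>m. Polynomial.monom (mp_monom m) 1) q :: (nat, 'k) mpoly poly) N) w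
    = (\<Sum>m\<in>keys q. if size (mset_of m) = N \<and> \<Sum>\<^sub># (mset_of m) = w then lookup q m else 0)"
    by (simp add: coeff_sum lookup_sum) (rule sum.cong; simp add: lookup_single)
  then show ?thesis
    by (simp add: sum.If_cases Int_def)
qed

locale rees_powers =
  fixes n d :: nat and I :: "(nat, 'k::field) mpoly set"
  assumes ideal: "ideal_of (xpoly n) I"
    and low_weight: "\<And>q m. q \<in> I \<Longrightarrow> m \<in> keys q \<Longrightarrow> d \<le> weight n m"
begin

section \<open>Powers of the ideal and the degrees of their terms\<close>

definition P :: "nat \<Rightarrow> (nat, 'k) mpoly set" where
  "P i = I [^]\<^bsub>ideals_set (poly_ring n)\<^esub> i"

sublocale R: cring "poly_ring n"
  unfolding poly_ring_eq by (rule cring_ring_on[OF is_subring_xpoly])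

sublocale ideals: comm_monoid "ideals_set (poly_ring n)"
  by (rule R.ideals_set_is_comm_monoid)

lemma I_carrier: "I \<in> carrier (ideals_set (poly_ring n))"
  using ideal by (simp add: ideals_set_def ideal_poly_ring_iff)

lemma P_0: "P 0 = xpoly n"
  unfolding P_def using ideals.nat_pow_0[of I] by (simp add: ideals_set_def poly_ring_simps)

lemma ideal_of_P: "ideal_of (xpoly n) (P i)"
  using ideals.nat_pow_closed[OF I_carrier, of i] unfolding P_def[symmetric]
  by (simp add: ideals_set_def ideal_poly_ring_iff)

lemma P_mult: "x \<in> P i \<Longrightarrow> y \<in> P j \<Longrightarrow> x * y \<in> P (i + j)"
  using ideal_prod.prod[of x "P i" y "P j" "poly_ring n"] ideals.nat_pow_mult[OF I_carrier, of i j]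
  unfolding P_def[symmetric] by (simp add: ideals_set_def poly_ring_simps)

lemma P_weight: "q \<in> P i \<Longrightarrow> m \<in> keys q \<Longrightarrow> i * d \<le> weight n m"
proof (induction i arbitrary: q m)
  case (Suc i)
  have "P (Suc i) = ideal_prod (poly_ring n) (P i) I"
    unfolding P_def ideals.nat_pow_Suc by (simp add: ideals_set_def)
  then have "q \<in> ideal_prod (poly_ring n) (P i) I"
    using Suc.prems(1) by simp
  then have "\<forall>m\<in>keys q. Suc i * d \<le> weight n m"
  proof induction
    case (prod x y)
    show ?case
    proof
      fix m assume "m \<in> keys (x \<otimes>\<^bsub>poly_ring n\<^esub> y)"
      then obtain a b where "m = a + b" "a \<in> keys x" "b \<in> keys y"
        using keys_mult[of x y] by (auto simp: poly_ring_eq)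
      then show "Suc i * d \<le> weight n m"
        using Suc.IH[OF prod(1)] low_weight[OF prod(2)] by (fastforce simp: weight_add)
    qed
  next
    case (sum x y)
    then show ?case
      using keys_add[of x y] by (auto simp: poly_ring_eq)
  qed
  then show ?case
    using Suc.prems(2) by blast
qed simp

definition rees_carrier :: "(nat, 'k) mpoly poly set" where
  "rees_carrier = {q. \<forall>i. coeff q i \<in> P i}"

lemma rees_ring_eq: "rees_ring n I = ring_on rees_carrier"
  by (simp add: rees_ring_def rees_carrier_def P_def)

lemma P_closed: "0 \<in> P i" "x \<in> P i \<Longrightarrow> y \<in> P i \<Longrightarrow> x + y \<in> P i"
  "x \<in> P i \<Longrightarrow> - x \<in> P i"
  using ideal_of_P[of i] ideal_of_diff[OF is_subring_xpoly ideal_of_P, of 0 i x]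
  by (auto simp: ideal_of_def)

lemma is_subring_rees_carrier: "is_subring rees_carrier"
  unfolding is_subring_def
proof (intro conjI ballI)
  show "0 \<in> rees_carrier" "1 \<in> rees_carrier"
    using is_subring_xpoly[of n] by (auto simp: rees_carrier_def P_closed coeff_1 P_0 is_subring_def)
  fix x y assume x: "x \<in> rees_carrier"
  then show "- x \<in> rees_carrier"
    by (simp add: rees_carrier_def P_closed)
  assume y: "y \<in> rees_carrier"
  then show "x + y \<in> rees_carrier"
    using x by (simp add: rees_carrier_def P_closed)
  have "coeff x j * coeff y (i - j) \<in> P i" if "j \<in> {..i}" for i j
    using P_mult[of "coeff x j" j "coeff y (i - j)" "i - j"] x y that by (simp add: rees_carrier_def)
  then have "coeff (x * y) i \<in> P i" for i
    unfolding coeff_mult by (rule ideal_of_sum[OF ideal_of_P])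
  then show "x * y \<in> rees_carrier"
    by (simp add: rees_carrier_def)
qed

text \<open>Elements of \<open>I\<^sup>i\<close> have degree at least \<open>i d\<close>, and a variable raises the degree.\<close>

lemma rees_max_weight:
  assumes "q \<in> rees_max n I" "m \<in> keys (coeff q i)"
  shows "i * d < weight n m"
proof -
  define J where "J = {q \<in> rees_carrier. \<forall>i. \<forall>m\<in>keys (coeff q i). i * d < weight n m}"
  have "ideal_of rees_carrier J"
    unfolding ideal_of_def
  proof (intro conjI ballI)
    show "0 \<in> J"
      by (simp add: J_def rees_carrier_def P_closed)
    fix x y assume y: "y \<in> J"
    show "x + y \<in> J" if x: "x \<in> J"
    proof -
      have "x + y \<in> rees_carrier"
        using x y is_subring_rees_carrier unfolding is_subring_def J_def by blast
      moreover have "i * d < weight n m" if "m \<in> keys (coeff (x + y) i)" for i m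
        using that x y keys_add[of "coeff x i" "coeff y i"] unfolding J_def coeff_add by blast
      ultimately show ?thesis
        unfolding J_def by blast
    qed
    show "x * y \<in> J" if x: "x \<in> rees_carrier"
    proof -
      have "x * y \<in> rees_carrier"
        using x y is_subring_mult[OF is_subring_rees_carrier] unfolding J_def by blast
      moreover have "i * d < weight n m" if m: "m \<in> keys (coeff (x * y) i)" for i m
      proof -
        obtain j where j: "j \<le> i" "m \<in> keys (coeff x j * coeff y (i - j))"
          using m Poly_Mapping.keys_sum[of "\<lambda>j. coeff x j * coeff y (i - j)" "{..i}"]
          unfolding coeff_mult by blast
        then obtain a b where ab: "m = a + b" "a \<in> keys (coeff x j)" "b \<in> keys (coeff y (i - j))"
          using keys_mult[of "coeff x j" "coeff y (i - j)"] by blast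
        have "j * d \<le> weight n a"
          using P_weight[OF _ ab(2)] x by (simp add: rees_carrier_def)
        moreover have "(i - j) * d < weight n b"
          using y ab(3) by (simp add: J_def)
        ultimately have "j * d + (i - j) * d < weight n m"
          by (simp add: ab(1) weight_add)
        then show ?thesis
          using j(1) by (simp flip: distrib_right)
      qed
      ultimately show ?thesis
        unfolding J_def by blast
    qed
  qed (simp add: J_def)
  moreover have "[:mp_var i:] \<in> J" if i: "i \<in> {1..n}" for i
  proof -
    have "mp_var i \<in> P 0"
      unfolding P_0 using i by (intro mp_var_in_carrier) auto
    then have "[:mp_var i:] \<in> rees_carrier"
      by (auto simp: rees_carrier_def coeff_pCons P_closed split: nat.split)
    moreover have "0 < weight n (single i (1::nat))"
      using lookup_le_weight[OF i, of "single i 1"] by simp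
    ultimately show ?thesis
      by (auto simp: J_def coeff_pCons mp_var_def mp_monom_def split: nat.splits)
  qed
  ultimately have "rees_max n I \<subseteq> J"
    unfolding rees_max_def rees_ring_eq genideal_ring_on[OF is_subring_rees_carrier] by blast
  then show ?thesis
    using assms by (auto simp: J_def)
qed

lemma zero_in_rees_max: "0 \<in> rees_max n I"
  unfolding rees_max_def rees_ring_eq genideal_ring_on[OF is_subring_rees_carrier]
  by (auto simp: ideal_of_def)

lemma fiber_ideal_iff:
  "q \<in> fiber_ideal n I \<longleftrightarrow> q \<in> poly_carrier UNIV (min_gens n I) \<and>
    rees_max n I +>\<^bsub>rees_ring n I\<^esub> mp_eval (\<lambda>c. [:mp_const c:]) (\<lambda>m. Polynomial.monom (mp_monom m) 1) q = rees_max n I"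
  by (simp add: fiber_ideal_def a_kernel_def' KT_def mpoly_ring_eq fiber_ring_def FactRing_def)

text \<open>A monomial in N of the variables \<open>T_m\<close> is sent to a term in t^N of degree
  exactly N d. The terms of \<open>rees_max\<close> in t^N have larger degree, so an image lying in
  it has no terms at all.\<close>

lemma fiber_ideal_eq_toric_ideal:
  assumes d: "d = weight n lam" "0 < d" and gens: "min_gens n I = perm_points n lam"
  shows "fiber_ideal n I = toric_ideal n (min_gens n I)"
proof (rule Set.set_eqI)
  fix q :: "(nat monomial, 'k) mpoly"
  let ?e = "mp_eval (\<lambda>c. [:mp_const c:]) (\<lambda>m. Polynomial.monom (mp_monom m) 1) q :: (nat, 'k) mpoly poly"
  let ?t = "mp_eval mp_const mp_monom q :: (nat, 'k) mpoly"
  show "q \<in> fiber_ideal n I \<longleftrightarrow> q \<in> toric_ideal n (min_gens n I)"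
  proof (cases "q \<in> poly_carrier UNIV (min_gens n I)")
    case True
    have w: "weight n (\<Sum>\<^sub># (mset_of m)) = size (mset_of m) * d" if "m \<in> keys q" for m
      unfolding d(1) using True that by (intro weight_sum_mset) (auto simp: poly_carrier_def gens)
    \<comment> \<open>As \<open>d\<close> is positive, the degree of \<open>w\<close> determines the
      number of factors, so the grading by \<open>t\<close> does not refine the fibres of the toric
      map.\<close>
    have top: "lookup (coeff ?e N) w = lookup ?t w" if "weight n w = N * d" for N w
    proof -
      have "{m \<in> keys q. size (mset_of m) = N \<and> \<Sum>\<^sub># (mset_of m) = w} = {m \<in> keys q. \<Sum>\<^sub># (mset_of m) = w}"
        using w that d(2) by force
      then show ?thesis
        by (simp only: lookup_fiber_eval lookup_toric_eval)
    qed
    have other: "lookup (coeff ?e N) w = 0" if "weight n w \<noteq> N * d" for N w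
    proof -
      have "{m \<in> keys q. size (mset_of m) = N \<and> \<Sum>\<^sub># (mset_of m) = w} = {}"
        using w that by force
      then show ?thesis
        by (simp only: lookup_fiber_eval sum.empty)
    qed
    have "?t = 0" if f: "q \<in> fiber_ideal n I"
    proof (rule poly_mapping_eqI)
      fix w
      have "0 + ?e \<in> rees_max n I +>\<^bsub>rees_ring n I\<^esub> ?e"
        using zero_in_rees_max by (auto simp: a_r_coset_def' rees_ring_eq)
      then have e: "?e \<in> rees_max n I"
        using f by (simp add: fiber_ideal_iff)
      show "lookup ?t w = lookup 0 w"
      proof (cases "\<exists>m\<in>keys q. \<Sum>\<^sub># (mset_of m) = w")
        case True
        then obtain N where N: "weight n w = N * d"
          using w by blast
        then have "w \<notin> keys (coeff ?e N)"
          using rees_max_weight[OF e, of w N] by auto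
        then show ?thesis
          using top[OF N] by (simp add: in_keys_iff)
      next
        case False
        then have "{m \<in> keys q. \<Sum>\<^sub># (mset_of m) = w} = {}"
          by blast
        then show ?thesis
          by (simp only: lookup_toric_eval sum.empty lookup_zero)
      qed
    qed
    moreover have "q \<in> fiber_ideal n I" if t: "?t = 0"
    proof -
      have "lookup (coeff ?e N) w = 0" for N w
        using top[of w N] other[of w N] t by (cases "weight n w = N * d") auto
      then have "?e = 0"
        by (intro poly_eqI poly_mapping_eqI) simp
      then show ?thesis
        using True by (auto simp: fiber_ideal_iff a_r_coset_def' rees_ring_eq)
    qed
    ultimately show ?thesis
      using True by (auto simp: toric_ideal_eq)
  qed (simp add: fiber_ideal_iff toric_ideal_eq)
qed

end

section \<open>The Rees ideal\<close>

lemma rees_ideal_eq: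
  "rees_ideal n I = {q \<in> poly_carrier (xpoly n) (min_gens n I).
    mp_eval (\<lambda>c. [:c:]) (\<lambda>m. Polynomial.monom (mp_monom m) 1) q = (0 :: (nat, 'k::field) mpoly poly)}"
  by (simp add: rees_ideal_def a_kernel_def' RT_def mpoly_ring_eq poly_ring_eq rees_ring_def)

text \<open>Terms are indexed by pairs, a monomial in the \<open>T_m\<close> and one in the
  \<open>x_i\<close>. Terms with the same number of \<open>T\<close> factors and the same total
  exponent have images in the same place, and they form the fibres to be connected.\<close>

lemma lookup_rees_eval:
  "lookup (coeff (mp_eval (\<lambda>c. [:c:]) (\<lambda>m. Polynomial.monom (mp_monom m) 1) q :: (nat, 'k::field) mpoly poly) N) w
    = (\<Sum>x\<in>{x \<in> Sigma (keys q) (\<lambda>m. keys (lookup q m)).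
        (size (mset_of (fst x)), snd x + \<Sum>\<^sub># (mset_of (fst x))) = (N, w)}. lookup (lookup q (fst x)) (snd x))"
proof -
  let ?S = "\<lambda>m. \<Sum>\<^sub># (mset_of m)"
  have mult: "p * mp_monom b = (\<Sum>a\<in>keys p. single (a + b) (lookup p a))" for p :: "(nat, 'k) mpoly" and b
    by (subst (1) mpoly_sum_single[of p]) (simp add: sum_distrib_right mp_monom_def mult_single)
  have "mp_eval (\<lambda>c. [:c:]) (\<lambda>m. Polynomial.monom (mp_monom m) 1) q
    = (\<Sum>m\<in>keys q. Polynomial.monom (\<Sum>a\<in>keys (lookup q m). single (a + ?S m) (lookup (lookup q m) a)) (size (mset_of m)))"
    unfolding mp_eval_def mon_eval_def[symmetric] mon_eval_eq prod_mset_monom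
    by (simp add: smult_monom mult)
  then have "lookup (coeff (mp_eval (\<lambda>c. [:c:]) (\<lambda>m. Polynomial.monom (mp_monom m) 1) q :: (nat, 'k) mpoly poly) N) w
    = (\<Sum>m\<in>keys q. \<Sum>a\<in>keys (lookup q m). if (size (mset_of m), a + ?S m) = (N, w) then lookup (lookup q m) a else 0)"
    by (simp add: coeff_sum lookup_sum) (intro sum.cong refl, auto simp: lookup_sum lookup_single when_def)
  also have "\<dots> = (\<Sum>x\<in>Sigma (keys q) (\<lambda>m. keys (lookup q m)).
      if (size (mset_of (fst x)), snd x + ?S (fst x)) = (N, w) then lookup (lookup q (fst x)) (snd x) else 0)"
    by (subst sum.Sigma) (auto simp: split_beta)
  finally show ?thesis
    by (subst sum.inter_filter) auto
qed

section \<open>The relations inside the Rees ideal\<close>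

lemma mem_C_ideal:
  assumes "k \<in> {1..p_index n mu} \<or> k \<in> {p_index n mu + 1..n - r_index n mu} \<and> sg k < u_max n sg mu"
  shows "mp_var (sg k) \<in> (C_ideal n sg mu :: (nat, 'k::field) mpoly set)"
proof -
  have gen: "x \<in> X \<Longrightarrow> x \<in> genideal (poly_ring n) X" "0 \<in> genideal (poly_ring n) X"
    for x and X :: "(nat, 'k) mpoly set"
    unfolding poly_ring_eq genideal_ring_on[OF is_subring_xpoly] ideal_of_def by auto
  have "x + y \<in> C_ideal n sg mu"
    if "x \<in> genideal (poly_ring n) {mp_var (sg k) | k. k \<in> {1..p_index n mu}}"
      "y \<in> genideal (poly_ring n) {mp_var (sg k) | k. k \<in> {p_index n mu + 1..n - r_index n mu} \<and> sg k < u_max n sg mu}"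
    for x y :: "(nat, 'k) mpoly"
    using that unfolding C_ideal_def set_add_def' by (auto simp: poly_ring_eq)
  from this[OF gen(1) gen(2)] this[OF gen(2) gen(1)] show ?thesis
    using assms by fastforce
qed

lemma rees_eval_var:
  "mp_eval (\<lambda>c. [:c:]) (\<lambda>m. Polynomial.monom (mp_monom m) 1) (mp_const c * T_var u)
    = (Polynomial.monom (c * mp_monom u) 1 :: (nat, 'k::field) mpoly poly)"
proof -
  interpret coeff_hom "\<lambda>c :: (nat, 'k) mpoly. [:c:]"
    by (rule coeff_hom_pCons)
  show ?thesis
    by (simp add: mp_var_def mp_const_times_monom mp_eval_single mon_eval_def smult_monom)
qed

lemma relations_in_rees_kernel:
  assumes S: "\<And>u. u \<in> S \<Longrightarrow> keys u \<subseteq> {1..n}"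
  shows "exchange_relations n S \<union> linear_relations n S \<subseteq> {q \<in> poly_carrier (xpoly n) S.
    mp_eval (\<lambda>c. [:c:]) (\<lambda>m. Polynomial.monom (mp_monom m) 1) q = (0 :: (nat, 'k::field) mpoly poly)}"
proof
  interpret coeff_hom "\<lambda>c :: (nat, 'k) mpoly. [:c:]"
    by (rule coeff_hom_pCons)
  let ?e = "mp_eval (\<lambda>c. [:c:]) (\<lambda>m. Polynomial.monom (mp_monom m) 1) ::
    (nat monomial, (nat, 'k) mpoly) mpoly \<Rightarrow> (nat, 'k) mpoly poly"
  have A: "is_subring (poly_carrier (xpoly n) S :: (nat monomial, (nat, 'k) mpoly) mpoly set)"
    by (intro is_subring_poly_carrier is_subring_xpoly)
  have T: "T_var u \<in> (poly_carrier (xpoly n) S :: (nat monomial, (nat, 'k) mpoly) mpoly set)" if "u \<in> S" for u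
    using that by (intro mp_var_in_carrier is_subring_xpoly)
  have C: "mp_const (mp_var i) \<in> (poly_carrier (xpoly n) S :: (nat monomial, (nat, 'k) mpoly) mpoly set)"
    if "i \<in> {1..n}" for i
    using that by (intro mp_const_in_carrier mp_var_in_carrier) auto
  have eT: "?e (T_var u) = Polynomial.monom (mp_monom u) 1" for u
    using rees_eval_var[of 1 u] by simp
  fix q :: "(nat monomial, (nat, 'k) mpoly) mpoly"
  assume "q \<in> exchange_relations n S \<union> linear_relations n S"
  then show "q \<in> {q \<in> poly_carrier (xpoly n) S. ?e q = 0}"
  proof
    assume "q \<in> exchange_relations n S"
    then obtain r s t w i j where q: "q = T_var r * T_var s - T_var t * T_var w"
      and m: "r \<in> S" "s \<in> S" "t \<in> S" "w \<in> S"
      and less: "lookup s i < lookup r i" "lookup r j < lookup s j"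
      and tw: "t = swap_var r j i" "w = swap_var s i j"
      unfolding exchange_relations_def by blast
    have "t + w = r + s"
      unfolding tw using less by (intro swap_var_add_swap_var) auto
    then have "?e q = 0"
      by (simp add: q mp_eval_diff mp_eval_mult eT Polynomial.mult_monom del: One_nat_def flip: mp_monom_add)
    moreover have "q \<in> poly_carrier (xpoly n) S"
      unfolding q using m by (intro is_subring_diff is_subring_mult A T)
    ultimately show ?thesis
      by simp
  next
    assume "q \<in> linear_relations n S"
    then obtain i u v sg mu where q: "q = mp_const (mp_var i) * T_var u - mp_const (mp_var (u_max n sg mu)) * T_var v"
      and m: "u \<in> S" "v \<in> S" "i \<in> {1..n}" and eq: "single i 1 + u = single (u_max n sg mu) 1 + v"
      unfolding linear_relations_def by blast
    have "?e q = 0"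
      unfolding q mp_eval_diff rees_eval_var by (simp add: mp_var_def eq del: One_nat_def flip: mp_monom_add)
    \<comment> \<open>The equation makes \<open>u_max n sg mu\<close> a variable of the left-hand
      side, and so an index in \<open>{1..n}\<close>.\<close>
    moreover have "u_max n sg mu \<in> keys (single i 1 + u)"
      unfolding eq by (simp add: in_keys_iff lookup_add)
    then have "u_max n sg mu \<in> {1..n}"
      using keys_add[of "single i (1::nat)" u] S[OF m(1)] m(3) by auto
    then have "q \<in> poly_carrier (xpoly n) S"
      unfolding q using m by (intro is_subring_diff is_subring_mult A T C)
    ultimately show ?thesis
      by simp
  qed
qed

lemma rees_ideal_generated:
  assumes pos: "0 < n" and gens: "min_gens n I = perm_points n lam"
  shows "(rees_ideal n I :: (nat monomial, (nat, 'k::field) mpoly) mpoly set)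
    = genideal (RT n (perm_points n lam))
        (exchange_relations n (perm_points n lam) \<union> linear_relations n (perm_points n lam))"
proof
  let ?G = "perm_points n lam"
  let ?A = "poly_carrier (xpoly n) ?G :: (nat monomial, (nat, 'k) mpoly) mpoly set"
  let ?e = "mp_eval (\<lambda>c. [:c:]) (\<lambda>m. Polynomial.monom (mp_monom m) 1) ::
    (nat monomial, (nat, 'k) mpoly) mpoly \<Rightarrow> (nat, 'k) mpoly poly"
  interpret coeff_hom "\<lambda>c :: (nat, 'k) mpoly. [:c:]"
    by (rule coeff_hom_pCons)
  have A: "is_subring ?A"
    by (intro is_subring_poly_carrier is_subring_xpoly)
  have gen: "genideal (RT n ?G) X = \<Inter> {J. ideal_of ?A J \<and> X \<subseteq> J}" for X
    unfolding RT_def poly_ring_eq ring_on_simps mpoly_ring_eq by (rule genideal_ring_on[OF A])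
  have rees: "rees_ideal n I = {q \<in> ?A. ?e q = 0}"
    unfolding rees_ideal_eq gens ..
  have "ideal_of ?A (rees_ideal n I)"
    unfolding rees by (rule ideal_of_kernel[OF A])
  moreover have "exchange_relations n ?G \<union> linear_relations n ?G \<subseteq> rees_ideal n I"
    unfolding rees by (rule relations_in_rees_kernel[OF perm_points_keys])
  ultimately show "genideal (RT n ?G) (exchange_relations n ?G \<union> linear_relations n ?G) \<subseteq> rees_ideal n I"
    unfolding gen by (intro Inter_lower CollectI conjI)
  show "rees_ideal n I \<subseteq> genideal (RT n ?G) (exchange_relations n ?G \<union> linear_relations n ?G)"
    unfolding gen
  proof (intro subsetI InterI, elim CollectE conjE)
    fix q :: "(nat monomial, (nat, 'k) mpoly) mpoly" and J
    assume q: "q \<in> rees_ideal n I" and J: "ideal_of ?A J"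
      and rel: "exchange_relations n ?G \<union> linear_relations n ?G \<subseteq> J"
    define X where "X a = (mp_const (mp_monom a) :: (nat monomial, (nat, 'k) mpoly) mpoly)" for a
    have XA: "X a \<in> ?A" if "keys a \<subseteq> {1..n}" for a
      unfolding X_def using that by (intro mp_const_in_carrier mp_monom_in_carrier) auto
    have X_add: "X (a + b) = X a * X b" for a b
      by (simp add: X_def mp_monom_add mp_const_mult)
    have X_0: "X 0 = 1"
      by (simp add: X_def)
    have mult: "a * x \<in> J" if "a \<in> ?A" "x \<in> J" for a x
      using J that unfolding ideal_of_def by blast
    interpret rees_congruence n lam "\<lambda>a M b N. X a * T_prod M - X b * T_prod N \<in> J"
    proof
      show "X a * T_prod M - X a * T_prod M \<in> J" for a M
        using J by (simp add: ideal_of_def)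
      show "X b * T_prod N - X a * T_prod M \<in> J" if "X a * T_prod M - X b * T_prod N \<in> J" for a b M N
        using ideal_of_diff[OF A J _ that, of 0] J by (simp add: ideal_of_def)
      show "X a * T_prod L - X c * T_prod N \<in> J"
        if "X a * T_prod L - X b * T_prod M \<in> J" "X b * T_prod M - X c * T_prod N \<in> J" for a b c L M N
      proof -
        have "X a * T_prod L - X b * T_prod M + (X b * T_prod M - X c * T_prod N) \<in> J"
          using J that unfolding ideal_of_def by blast
        then show ?thesis
          by simp
      qed
      show "X a * T_prod (add_mset u M) - X b * T_prod (add_mset u N) \<in> J"
        if "X a * T_prod M - X b * T_prod N \<in> J" "u \<in> ?G" for a b u M N
        using mult[OF mp_var_in_carrier[OF is_subring_xpoly that(2)] that(1)]
        by (simp add: right_diff_distrib mult.left_commute)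
      show "X (c + a) * T_prod M - X (c + b) * T_prod N \<in> J"
        if "X a * T_prod M - X b * T_prod N \<in> J" "keys c \<subseteq> {1..n}" for a b c M N
        using mult[OF XA[OF that(2)] that(1)] by (simp add: X_add right_diff_distrib mult.assoc)
      show "X 0 * T_prod {#r, s#} - X 0 * T_prod {#swap_var r j i, swap_var s i j#} \<in> J"
        if "r \<in> ?G" "s \<in> ?G" "i \<in> {1..n}" "j \<in> {1..n}" "lookup s i < lookup r i" "lookup r j < lookup s j"
          "swap_var r j i \<in> ?G" "swap_var s i j \<in> ?G" for r s i j
      proof -
        have "T_var r * T_var s - T_var (swap_var r j i) * T_var (swap_var s i j)
            \<in> (exchange_relations n ?G :: (nat monomial, (nat, 'k) mpoly) mpoly set)"
          using that unfolding exchange_relations_def by blast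
        then show ?thesis
          using rel by (auto simp: X_0)
      qed
      show "X (single i 1) * T_prod {#r#} - X (single j 1) * T_prod {#swap_var r i j#} \<in> J"
        if r: "r \<in> ?G" and ij: "i \<in> {1..n}" "j \<in> {1..n}" "i \<noteq> j"
          and top: "\<And>x. x \<in> {1..n} \<Longrightarrow> top_rank n r x \<le> top_rank n r j"
          and less: "Suc (lookup r i) * (n + 1) + i < top_rank n r j" for r i j
      proof -
        obtain sg mu k where pres: "presents n r sg mu" "u_max n sg mu = j" "prec n (swap_var r i j) r"
          and k: "i = sg k" "k \<in> {1..p_index n mu} \<or> k \<in> {p_index n mu + 1..n - r_index n mu} \<and> sg k < u_max n sg mu"
          using linear_move_presentation[OF perm_points_keys[OF r] ij top less] by metis
        have pos': "lookup r i < lookup r j"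
          using less rank_le_iff[of j n i "lookup r j" "Suc (lookup r i)"] ij by (auto simp: top_rank_def)
        have C: "(mp_var i :: (nat, 'k) mpoly) \<in> C_ideal n sg mu"
          unfolding k(1) by (rule mem_C_ideal[OF k(2)])
        have eq: "single i 1 + r = single (u_max n sg mu) 1 + swap_var r i j"
          using swap_var_eq_iff[OF ij(3), of r "swap_var r i j"] pos' pres(2) by simp
        have "mp_const (mp_var i) * T_var r - mp_const (mp_var (u_max n sg mu)) * T_var (swap_var r i j)
            \<in> (linear_relations n ?G :: (nat monomial, (nat, 'k) mpoly) mpoly set)"
          unfolding linear_relations_def using r robin_hood[OF r ij(1,2) pos'] pres(1,3) ij(1) C eq by blast
        then show ?thesis
          using rel by (auto simp: X_def pres(2) mp_var_def)
      qed
    qed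
    let ?I = "Sigma (keys q) (\<lambda>m. keys (lookup q m))"
    have qA: "q \<in> ?A" and q0: "?e q = 0"
      using q by (simp_all add: rees)
    \<comment> \<open>The coefficients in \<open>R\<close> are split into their terms as well;
      \<open>mp_const (mp_const c)\<close> is a scalar from \<open>K\<close> taken through
      \<open>R\<close> into \<open>R[T]\<close>. What remains are monomials in both sets of
      variables, to which \<open>rees_connected\<close> applies.\<close>
    have "(\<Sum>x\<in>?I. mp_const (mp_const (lookup (lookup q (fst x)) (snd x))) * (X (snd x) * mp_monom (fst x))) \<in> J"
    proof (rule fibre_sum_in_ideal[OF _ J, where
        g = "\<lambda>x. (size (mset_of (fst x)), snd x + \<Sum>\<^sub># (mset_of (fst x)))"])
      fix x y assume xy: "x \<in> ?I" "y \<in> ?I"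
        and eq: "(size (mset_of (fst x)), snd x + \<Sum>\<^sub># (mset_of (fst x)))
          = (size (mset_of (fst y)), snd y + \<Sum>\<^sub># (mset_of (fst y)))"
      have G: "set_mset (mset_of (fst z)) \<subseteq> ?G" "keys (snd z) \<subseteq> {1..n}" if "z \<in> ?I" for z
        using qA that by (fastforce simp: poly_carrier_def)+
      have "X (snd x) * mp_monom (fst x) - X (snd y) * mp_monom (fst y) \<in> J"
        unfolding mp_monom_eq_T_prod using eq pos
        by (intro rees_connected G xy) auto
      then show "mp_const (mp_const (lookup (lookup q (fst x)) (snd x)))
          * (X (snd x) * mp_monom (fst x) - X (snd y) * mp_monom (fst y)) \<in> J"
        by (intro mult mp_const_in_carrier) auto
    next
      show "(\<Sum>x\<in>{x\<in>?I. (size (mset_of (fst x)), snd x + \<Sum>\<^sub># (mset_of (fst x))) = w}.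
          mp_const (mp_const (lookup (lookup q (fst x)) (snd x)))) = (0 :: (nat monomial, (nat, 'k) mpoly) mpoly)" for w
        using lookup_rees_eval[of q "fst w" "snd w"] q0
        by (simp flip: mp_const_sum)
    qed auto
    also have "(\<Sum>x\<in>?I. mp_const (mp_const (lookup (lookup q (fst x)) (snd x))) * (X (snd x) * mp_monom (fst x)))
      = (\<Sum>m\<in>keys q. \<Sum>a\<in>keys (lookup q m). mp_const (single a (lookup (lookup q m) a)) * mp_monom m)"
    proof -
      have term_eq: "mp_const (mp_const c) * (X a * y) = mp_const (single a c) * y" for c a y
        unfolding X_def mp_const_times_monom[symmetric] mp_const_mult by (rule mult.assoc[symmetric])
      show ?thesis
        by (simp add: sum.Sigma split_beta term_eq)
    qed
    also have "\<dots> = (\<Sum>m\<in>keys q. mp_const (lookup q m) * mp_monom m)"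
      by (simp flip: sum_distrib_right mp_const_sum mpoly_sum_single)
    also have "\<dots> = q"
      unfolding mp_const_times_monom by (simp flip: mpoly_sum_single)
    finally show "q \<in> J" .
  qed
qed

theorem theorem6p5:
  fixes n :: nat and lam :: "nat monomial" and I :: "(nat, 'k::field) mpoly set"
  assumes "lam \<in> partitions n"
    and "I = Sss n {lam}"
    and "I \<noteq> carrier (poly_ring n)"
  shows "toric_ideal n (min_gens n I) = fiber_ideal n I \<and>
    toric_ideal n (min_gens n I) = genideal (KT (min_gens n I)) (exchange_relations n (min_gens n I)) \<and>
    rees_ideal n I = genideal (RT n (min_gens n I))
      (exchange_relations n (min_gens n I) \<union> linear_relations n (min_gens n I))"
proof -
  have I: "I = perm_ideal n lam"
    using assms Sss_eq_perm_ideal by blast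
  have gens: "min_gens n I = perm_points n lam"
    unfolding I by (rule min_gens_perm_ideal)
  \<comment> \<open>For weight 0 the generator is 1 and the ideal is all of \<open>R\<close>, which
    properness excludes.\<close>
  have pos: "0 < weight n lam"
  proof (rule ccontr)
    assume "\<not> ?thesis"
    then have "lam = 0"
      using assms(1) by (intro weight_eq_0[of n]) (auto simp: partitions_def)
    then have "\<exists>u\<in>perm_points n lam. \<exists>d. m = u + d" for m
      using partition_in_perm_points[OF assms(1)] by (intro bexI[of _ lam] exI[of _ m]) auto
    then have "I = carrier (poly_ring n)"
      by (simp add: I perm_ideal_eq poly_ring_eq)
    then show False
      using assms(3) by simp
  qed
  then have n: "0 < n"
    by (cases n) (auto simp: weight_def)
  interpret rees_powers n "weight n lam" I
  proof
    show "ideal_of (xpoly n) I"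
      unfolding I by (rule ideal_of_perm_ideal)
    fix q m assume "q \<in> I" "m \<in> keys q"
    then obtain u d where "u \<in> perm_points n lam" "m = u + d"
      by (auto simp: I perm_ideal_eq)
    then show "weight n lam \<le> weight n m"
      using perm_points_weight[of u n lam] by (simp add: weight_add)
  qed
  show ?thesis
    using fiber_ideal_eq_toric_ideal[OF refl pos gens] toric_ideal_generated[OF pos]
      rees_ideal_generated[OF n gens] by (simp add: gens)
qed

end
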